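(* Let $N\ge3$, $p\in(1,2)$, let $\Omega\subset\mathbb{R}^N$ be a nonempty smooth open bounded set, let $w$ be the nonnegative ground state of $-\Delta u=Q_\Omega|u|^{p-2}u$, $u\in X^p$, and let $K$ denote the support of $w$. 1. If $\Omega$ is starshaped, then $K$ is starshaped. 2. If $\Omega$ is strictly starshaped, then $\partial K$ is locally the graph of a Lipschitz function.
   Context: $Q_\Omega(x)=1$ if $x\in\Omega$ and $Q_\Omega(x)=-1$ if $x\in\mathbb{R}^N\setminus\Omega$. $D^{1,2}(\mathbb{R}^N)=\{u\in L^{2^*}(\mathbb{R}^N):\nabla u\in L^2(\mathbb{R}^N,\mathbb{R}^N)\}$, $2^*=\frac{2N}{N-2}$; $X^p=D^{1,2}(\mathbb{R}^N)\cap L^p(\mathbb{R}^N)$. The energy is $I_p(u)=\frac12\int_{\mathbb{R}^N}|\nabla u|^2-\frac1p\int_{\mathbb{R}^N}Q_\Omega|u|^p$, $u\in X^p$. The nonnegative ground state is the (unique) nonnegative $w\in X^p$ with $I_p(w)=\inf_{X^p}I_p$; it is a weak solution of the equation. A set $A\subset\mathbb{R}^N$ is starshaped if there is $x_0\in A$ such that the segment from $x_0$ to $x$ is contained in $A$ for every $x\in A$. A smooth bounded open set $\Omega$ is strictly starshaped if there is $x_0\in\Omega$ such that $\nu_\Omega(x)\cdot(x-x_0)>0$ for every $x\in\partial\Omega$, where $\nu_\Omega$ is the outer unit normal. *)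

theory Defs
  imports "HOL-Analysis.Analysis"
begin

section \<open>Smooth functions and Sobolev-type spaces\<close>

text \<open>On an open set \<open>S\<close>, \<open>Ck_on k f S\<close> says that \<open>f\<close> is of class \<open>C\<^sup>k\<close>. It is only meant for
  open sets, since the derivatives are taken at points and not within \<open>S\<close>.\<close>

primrec Ck_on :: "nat \<Rightarrow> ('a::euclidean_space \<Rightarrow> real) \<Rightarrow> 'a set \<Rightarrow> bool" where
  "Ck_on 0 f S \<longleftrightarrow> continuous_on S f"
| "Ck_on (Suc k) f S \<longleftrightarrow> (\<forall>x\<in>S. f differentiable (at x)) \<and>
     (\<forall>v. Ck_on k (\<lambda>x. frechet_derivative f (at x) v) S)"

definition smooth_on :: "('a::euclidean_space \<Rightarrow> real) \<Rightarrow> 'a set \<Rightarrow> bool" where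
  "smooth_on f S \<longleftrightarrow> (\<forall>k. Ck_on k f S)"

definition test_function :: "('a::euclidean_space \<Rightarrow> real) \<Rightarrow> bool" where
  "test_function \<phi> \<longleftrightarrow> smooth_on \<phi> UNIV \<and> compact (closure {x. \<phi> x \<noteq> 0})"

definition locally_integrable :: "('a::euclidean_space \<Rightarrow> 'b::euclidean_space) \<Rightarrow> bool" where
  "locally_integrable f \<longleftrightarrow> (\<forall>C. compact C \<longrightarrow> f absolutely_integrable_on C)"

text \<open>Integration by parts is tested in every direction \<open>v\<close>, i.e.
  \<open>\<integral> u \<partial>\<^sub>v \<phi> = - \<integral> \<phi> (G \<bullet> v)\<close>.\<close>

definition has_weak_gradient ::
    "('a::euclidean_space \<Rightarrow> real) \<Rightarrow> ('a \<Rightarrow> 'a) \<Rightarrow> bool" where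
  "has_weak_gradient u G \<longleftrightarrow> locally_integrable u \<and> locally_integrable G \<and>
     (\<forall>\<phi> v. test_function \<phi> \<longrightarrow>
       (LINT x|lebesgue. u x * frechet_derivative \<phi> (at x) v) =
       - (LINT x|lebesgue. \<phi> x * (G x \<bullet> v)))"

text \<open>A weak gradient is unique up to null sets, so integrals of it do not depend on the choice.\<close>

definition weak_gradient :: "('a::euclidean_space \<Rightarrow> real) \<Rightarrow> 'a \<Rightarrow> 'a" where
  "weak_gradient u = (SOME G. has_weak_gradient u G)"

text \<open>Members of \<open>L\<^sup>q\<close> are represented by functions rather than by classes modulo null sets;
  all notions below are invariant under changes on null sets.\<close>

definition Lp_space :: "real \<Rightarrow> ('a::euclidean_space \<Rightarrow> 'b::euclidean_space) set" where
  "Lp_space q = {f. f \<in> borel_measurable lebesgue \<and>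
                    integrable lebesgue (\<lambda>x. norm (f x) powr q)}"

definition D12 :: "('a::euclidean_space \<Rightarrow> real) set" where
  "D12 = {u \<in> Lp_space (2 * real DIM('a) / (real DIM('a) - 2)).
            \<exists>G \<in> Lp_space 2. has_weak_gradient u G}"

definition Xp_space :: "real \<Rightarrow> ('a::euclidean_space \<Rightarrow> real) set" where
  "Xp_space p = D12 \<inter> Lp_space p"

section \<open>The energy functional and nonnegative ground states\<close>

definition Q_weight :: "'a set \<Rightarrow> 'a \<Rightarrow> real" where
  "Q_weight \<Omega> x = (if x \<in> \<Omega> then 1 else - 1)"

definition energy :: "real \<Rightarrow> 'a::euclidean_space set \<Rightarrow> ('a \<Rightarrow> real) \<Rightarrow> real" where
  "energy p \<Omega> u = 1 / 2 * (LINT x|lebesgue. (norm (weak_gradient u x))\<^sup>2)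
                 - 1 / p * (LINT x|lebesgue. Q_weight \<Omega> x * \<bar>u x\<bar> powr p)"

text \<open>The infimum is taken in the extended reals, where it is meaningful without knowing
  beforehand that the energy is bounded below.\<close>

definition nonneg_ground_state ::
    "real \<Rightarrow> 'a::euclidean_space set \<Rightarrow> ('a \<Rightarrow> real) \<Rightarrow> bool" where
  "nonneg_ground_state p \<Omega> w \<longleftrightarrow> w \<in> Xp_space p \<and> (AE x in lebesgue. 0 \<le> w x) \<and>
     ereal (energy p \<Omega> w) = (INF u\<in>Xp_space p. ereal (energy p \<Omega> u))"

text \<open>Support of a function determined up to null sets: the complement of the largest open set on
  which it vanishes almost everywhere. For continuous \<open>u\<close> it is the closure of \<open>{x. u x \<noteq> 0}\<close>;
  see \<open>ess_support_continuous\<close> below.\<close>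

definition ess_support :: "('a::euclidean_space \<Rightarrow> real) \<Rightarrow> 'a set" where
  "ess_support u = - \<Union>{U. open U \<and> (AE x in lebesgue. x \<in> U \<longrightarrow> u x = 0)}"

section \<open>Smooth open sets, normals, Lipschitz graphs\<close>

text \<open>The condition \<open>\<not> GDERIV \<rho> y :> 0\<close> says \<open>\<nabla>\<rho>(y) \<noteq> 0\<close>, as \<open>\<rho>\<close> is differentiable on \<open>U\<close>.
  It forces the frontier of \<open>\<Omega>\<close> in \<open>U\<close> to be the level set \<open>{\<rho> = 0}\<close>,
  so that \<open>\<Omega>\<close> lies locally on one side of it.\<close>

definition local_defining_function ::
    "'a::euclidean_space set \<Rightarrow> 'a \<Rightarrow> 'a set \<Rightarrow> ('a \<Rightarrow> real) \<Rightarrow> bool" where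
  "local_defining_function \<Omega> x U \<rho> \<longleftrightarrow> open U \<and> x \<in> U \<and> smooth_on \<rho> U \<and>
     (\<forall>y\<in>U. \<not> GDERIV \<rho> y :> 0) \<and> \<Omega> \<inter> U = {y\<in>U. \<rho> y < 0}"

definition smooth_open_set :: "'a::euclidean_space set \<Rightarrow> bool" where
  "smooth_open_set \<Omega> \<longleftrightarrow> open \<Omega> \<and>
     (\<forall>x\<in>frontier \<Omega>. \<exists>U \<rho>. local_defining_function \<Omega> x U \<rho>)"

text \<open>The normal \<open>\<nabla>\<rho>(x) / \<bar>\<nabla>\<rho>(x)\<bar>\<close>; \<open>smooth_on_gderiv\<close> below provides the gradient and
  \<open>outer_unit_normal_eq\<close> the independence of the choice of \<open>\<rho>\<close>.\<close>

definition outer_unit_normal :: "'a::euclidean_space set \<Rightarrow> 'a \<Rightarrow> 'a" where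
  "outer_unit_normal \<Omega> x = (THE \<nu>. \<exists>U \<rho> D. local_defining_function \<Omega> x U \<rho> \<and>
     (GDERIV \<rho> x :> D) \<and> \<nu> = D /\<^sub>R norm D)"

definition strictly_starshaped :: "'a::euclidean_space set \<Rightarrow> bool" where
  "strictly_starshaped \<Omega> \<longleftrightarrow>
     (\<exists>x0\<in>\<Omega>. \<forall>x\<in>frontier \<Omega>. outer_unit_normal \<Omega> x \<bullet> (x - x0) > 0)"

text \<open>Near each of its points, \<open>S\<close> is the graph, in the direction of a unit vector \<open>e\<close>, of a
  Lipschitz function \<open>\<gamma>\<close> on the hyperplane orthogonal to \<open>e\<close>; the orthogonal projection of \<open>x\<close>
  to that hyperplane is \<open>x - (x \<bullet> e) *\<^sub>R e\<close>.\<close>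

definition locally_Lipschitz_graph :: "'a::euclidean_space set \<Rightarrow> bool" where
  "locally_Lipschitz_graph S \<longleftrightarrow>
     (\<forall>x0\<in>S. \<exists>U e \<gamma> L. open U \<and> x0 \<in> U \<and> norm e = 1 \<and>
        L-lipschitz_on {y. y \<bullet> e = 0} (\<gamma> :: 'a \<Rightarrow> real) \<and>
        S \<inter> U = {x\<in>U. x \<bullet> e = \<gamma> (x - (x \<bullet> e) *\<^sub>R e)})"

section \<open>Well-definedness\<close>

lemma ess_support_continuous:
  fixes u :: "'a::euclidean_space \<Rightarrow> real"
  assumes "continuous_on UNIV u"
  shows "ess_support u = closure {x. u x \<noteq> 0}"
proof -
  have eq: "(AE x in lebesgue. x \<in> U \<longrightarrow> u x = 0) \<longleftrightarrow> U \<inter> {x. u x \<noteq> 0} = {}"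
    if "open U" for U
  proof
    assume ae: "AE x in lebesgue. x \<in> U \<longrightarrow> u x = 0"
    have "open {x. u x \<noteq> 0}"
      using assms by (intro open_Collect_neq) auto
    then have op: "open (U \<inter> {x. u x \<noteq> 0})" using that by auto
    have "negligible (U \<inter> {x. u x \<noteq> 0})"
      using ae by (simp add: negligible_iff_null_sets eventually_ae_filter)
        (metis (no_types, lifting) Int_iff completion.complete2 mem_Collect_eq subset_iff)
    then show "U \<inter> {x. u x \<noteq> 0} = {}"
      using op open_not_negligible by blast
  qed auto
  have "\<Union>{U. open U \<and> U \<inter> {x. u x \<noteq> 0} = {}} = - closure {x. u x \<noteq> 0}"
    by (auto simp: closure_interior interior_def)
  moreover have "{U. open U \<and> (AE x in lebesgue. x \<in> U \<longrightarrow> u x = 0)}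
               = {U. open U \<and> U \<inter> {x. u x \<noteq> 0} = {}}"
    using eq by blast
  ultimately show ?thesis by (simp add: ess_support_def)
qed

lemma smooth_on_gderiv:
  assumes "smooth_on \<rho> U" "x \<in> U"
  obtains D where "GDERIV \<rho> x :> D"
proof -
  have "Ck_on (Suc 0) \<rho> U" using assms unfolding smooth_on_def by blast
  then have "\<rho> differentiable (at x)" using assms by simp
  then obtain f where f: "(\<rho> has_derivative f) (at x)" unfolding differentiable_def by blast
  then have lin: "linear f" by (rule has_derivative_linear)
  have "f = (\<lambda>h. h \<bullet> adjoint f 1)"
    using adjoint_works[OF lin, where y = 1] by (auto simp: fun_eq_iff)
  then have "GDERIV \<rho> x :> adjoint f 1" using f unfolding gderiv_def by simp
  then show ?thesis using that by blast
qed

lemma gderiv_le_of_defining_functions: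
  fixes \<Omega> :: "'a::euclidean_space set"
  assumes x: "x \<in> frontier \<Omega>"
    and 1: "local_defining_function \<Omega> x U \<rho>" "GDERIV \<rho> x :> D"
    and 2: "local_defining_function \<Omega> x V \<sigma>" "GDERIV \<sigma> x :> E"
    and v: "v \<bullet> D < 0"
  shows "v \<bullet> E \<le> 0"
proof (rule ccontr)
  assume "\<not> ?thesis"
  then have E: "v \<bullet> E > 0" by simp
  have zero: "\<tau> x = 0" if "local_defining_function \<Omega> x W \<tau>" "GDERIV \<tau> x :> F" for W \<tau> F
  proof -
    have W: "open W" "x \<in> W" "\<Omega> \<inter> W = {y\<in>W. \<tau> y < 0}"
      using that by (auto simp: local_defining_function_def)
    have "isCont \<tau> x" using that(2) unfolding gderiv_def by (rule has_derivative_continuous)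
    then have lim: "(\<tau> \<longlongrightarrow> \<tau> x) (nhds x)" by (simp add: isCont_def tendsto_at_iff_tendsto_nhds)
    have "\<not> \<tau> x < 0"
    proof
      assume "\<tau> x < 0"
      then have "\<forall>\<^sub>F y in nhds x. \<tau> y < 0" using lim order_tendstoD(2) by blast
      moreover have "\<forall>\<^sub>F y in nhds x. y \<in> W" using W eventually_nhds by blast
      ultimately have "\<forall>\<^sub>F y in nhds x. y \<in> \<Omega>" by eventually_elim (use W in blast)
      then have "x \<in> interior \<Omega>" by (auto simp: eventually_nhds interior_def)
      then show False using x by (simp add: frontier_def)
    qed
    moreover have "\<not> \<tau> x > 0"
    proof
      assume "\<tau> x > 0"
      then have "\<forall>\<^sub>F y in nhds x. \<tau> y > 0" using lim order_tendstoD(1) by blast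
      moreover have "\<forall>\<^sub>F y in nhds x. y \<in> W" using W eventually_nhds by blast
      ultimately have "\<forall>\<^sub>F y in nhds x. y \<notin> \<Omega>" by eventually_elim (use W in force)
      then have "x \<notin> closure \<Omega>" by (auto simp: eventually_nhds closure_def interior_def
            islimpt_def)
      then show False using x by (simp add: frontier_def)
    qed
    ultimately show ?thesis by simp
  qed
  have ray: "((\<lambda>t. \<tau> (x + t *\<^sub>R v)) has_real_derivative v \<bullet> F) (at 0)"
    if "GDERIV \<tau> x :> F" for \<tau> F
  proof -
    have d: "((\<lambda>t. x + t *\<^sub>R v) has_derivative (\<lambda>t. t *\<^sub>R v)) (at 0)"
      by (auto intro!: derivative_eq_intros)
    have "(\<tau> has_derivative (\<lambda>h. h \<bullet> F)) (at (x + 0 *\<^sub>R v))"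
      using that by (simp add: gderiv_def)
    from has_derivative_compose[OF d this]
    moreover have "(*) (v \<bullet> F) = (\<lambda>t. t * (v \<bullet> F))" by (auto simp: mult.commute)
    ultimately show ?thesis by (simp add: has_field_derivative_def)
  qed
  have "((\<lambda>t. x + t *\<^sub>R v) \<longlongrightarrow> x + 0 *\<^sub>R v) (at_right 0)" by (intro tendsto_intros)
  then have lim: "((\<lambda>t. x + t *\<^sub>R v) \<longlongrightarrow> x) (at_right 0)" by simp
  have "\<forall>\<^sub>F t in at_right 0. x + t *\<^sub>R v \<in> U" "\<forall>\<^sub>F t in at_right 0. x + t *\<^sub>R v \<in> V"
    using 1(1) 2(1) by (auto simp: local_defining_function_def intro!: topological_tendstoD[OF lim])
  moreover have "\<forall>\<^sub>F t in at_right 0. \<rho> (x + t *\<^sub>R v) < 0"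
    using DERIV_neg_dec_right[OF ray[OF 1(2)] v] zero[OF 1]
    by (auto simp: eventually_at_right_field)
  moreover have "\<forall>\<^sub>F t in at_right 0. \<sigma> (x + t *\<^sub>R v) > 0"
    using DERIV_pos_inc_right[OF ray[OF 2(2)] E] zero[OF 2]
    by (auto simp: eventually_at_right_field)
  ultimately have "\<forall>\<^sub>F t in at_right (0::real). False"
  proof eventually_elim
    case (elim t)
    have "x + t *\<^sub>R v \<in> \<Omega> \<inter> U" using elim 1(1) by (auto simp: local_defining_function_def)
    then have "x + t *\<^sub>R v \<in> \<Omega> \<inter> V" using elim by auto
    then have "\<sigma> (x + t *\<^sub>R v) < 0" using 2(1) by (auto simp: local_defining_function_def)
    then show False using elim by simp
  qed
  then show False by simp
qed

lemma outer_unit_normal_eq: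
  fixes \<Omega> :: "'a::euclidean_space set"
  assumes x: "x \<in> frontier \<Omega>"
    and 1: "local_defining_function \<Omega> x U \<rho>" "GDERIV \<rho> x :> D"
  shows "outer_unit_normal \<Omega> x = D /\<^sub>R norm D"
  unfolding outer_unit_normal_def
proof (rule the_equality)
  show "\<exists>U \<rho> D'. local_defining_function \<Omega> x U \<rho> \<and> (GDERIV \<rho> x :> D') \<and> D /\<^sub>R norm D = D' /\<^sub>R norm D'"
    using 1 by blast
next
  fix \<nu> assume "\<exists>U \<rho> D. local_defining_function \<Omega> x U \<rho> \<and> (GDERIV \<rho> x :> D) \<and> \<nu> = D /\<^sub>R norm D"
  then obtain V \<sigma> E where 2: "local_defining_function \<Omega> x V \<sigma>" "GDERIV \<sigma> x :> E"
    and \<nu>: "\<nu> = E /\<^sub>R norm E" by blast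
  define a b where "a = D /\<^sub>R norm D" and "b = E /\<^sub>R norm E"
  have nz: "D \<noteq> 0" "E \<noteq> 0" using 1 2 by (auto simp: local_defining_function_def)
  then have na: "a \<bullet> a = 1" "b \<bullet> b = 1"
    by (simp_all add: a_def b_def field_simps dot_square_norm power2_eq_square)
  have le: "v \<bullet> b \<le> 0" if "v \<bullet> a < 0" for v
  proof -
    have "v \<bullet> D < 0" using that nz by (simp add: a_def field_simps zero_less_mult_iff mult_less_0_iff)
    from gderiv_le_of_defining_functions[OF x 1 2 this]
    show ?thesis using nz by (simp add: b_def field_simps mult_le_0_iff)
  qed
  show "\<nu> = D /\<^sub>R norm D"
  proof (rule ccontr)
    assume "\<nu> \<noteq> D /\<^sub>R norm D"
    then have "a \<noteq> b" by (simp add: a_def b_def \<nu>)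
    then have "0 < (a - b) \<bullet> (a - b)" by simp
    then have "a \<bullet> b < 1" using na by (simp add: inner_diff inner_commute)
    then have "(b - a) \<bullet> a < 0" "(b - a) \<bullet> b > 0"
      using na by (simp_all add: inner_diff inner_commute)
    with le show False by fastforce
  qed
qed

end

theory Submission
  imports Defs
begin

text \<open>
  Comparison. Let \<open>u\<close> and \<open>v\<close> be nonnegative minimizers for weights \<open>Q\<^sub>1 \<le> Q\<^sub>2\<close>. On
  \<open>A = {u > v}\<close> replace both of them by \<open>((u\<^sup>p + v\<^sup>p) / 2)\<^bsup>1/p\<^esup>\<close>. The sum of the two potential
  terms does not get worse, because \<open>(Q\<^sub>2 - Q\<^sub>1) (u\<^sup>p - v\<^sup>p) \<ge> 0\<close> on \<open>A\<close>, and by strict concavity of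
  \<open>s \<mapsto> s\<^bsup>2-2/p\<^esup>\<close> (here \<open>p < 2\<close>) the Dirichlet energy strictly decreases unless both gradients vanish
  almost everywhere on \<open>A\<close>. Hence \<open>(u - v)\<^sup>+\<close> has zero weak gradient and lies in \<open>L\<^sup>p\<close>, so it vanishes.

  Scaling. If \<open>\<Omega>\<close> is starshaped with respect to \<open>x\<^sub>0\<close> and \<open>c \<ge> 1\<close>, then
  \<open>c\<^bsup>-2/(2-p)\<^esup> w (x\<^sub>0 + c (x - x\<^sub>0))\<close> is a ground state for a subset of \<open>\<Omega>\<close>, so it lies below \<open>w\<close>:
  zeros of \<open>w\<close> propagate outwards along rays from \<open>x\<^sub>0\<close>, and the support is starshaped with respect
  to \<open>x\<^sub>0\<close>. A strictly starshaped \<open>\<Omega>\<close> is starshaped with respect to every point of a small ball, hence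
  so is the support, whose boundary then has interior and exterior cones at every point.

  Weak derivatives are handled through difference quotients: \<open>g\<close> is the weak derivative of \<open>u\<close> in the
  direction \<open>e\<close> iff the difference quotients of \<open>u\<close> converge to \<open>g\<close> in \<open>L\<^sup>1\<close> on balls. This yields a
  chain rule for Lipschitz functions that have merely one-sided directional derivatives.
\<close>

section \<open>Smooth bumps and the fundamental lemma of the calculus of variations\<close>

text \<open>All information about \<open>w\<close> is drawn from comparing energies. As the weight
  changes sign, the energy is not convex in \<open>u\<close>. In the variable
  \<open>s = u powr p\<close>, however, the potential term is linear and the Dirichlet integrand is,
  up to a constant, \<open>s powr (2/p - 2)\<close> times the squared gradient of \<open>s\<close>,
  which is jointly convex for \<open>1 < p < 2\<close>; the \<open>p\<close>-mean is the midpoint in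
  this variable. Taking means only where \<open>u > v\<close> creates a kink along
  \<open>u = v\<close>, and the mean itself is not differentiable at the origin. The competitors are
  thus Lipschitz but not smooth functions of the pair (u, v), and the kink is harmless because the
  weak gradients of \<open>u\<close> and \<open>v\<close> coincide almost everywhere on
  \<open>u = v\<close>. The exponent \<open>- 2 / (2 - p)\<close> is the one for which a dilation
  multiplies both terms of the energy by the same factor. Comparison alone would admit the zero
  function, whose empty support has no center; a competitor of negative energy excludes it, and
  closedness of the support then places \<open>x0\<close> in it.\<close>

lemma Ck_on_coinduct:
  fixes P :: "('a::euclidean_space \<Rightarrow> real) \<Rightarrow> bool"
  assumes "\<And>f x. P f \<Longrightarrow> f differentiable (at x)"
    and "\<And>f v. P f \<Longrightarrow> P (\<lambda>x. frechet_derivative f (at x) v)"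
    and "P f"
  shows "Ck_on k f UNIV"
  using assms(3)
proof (induction k arbitrary: f)
  case 0
  then have "f differentiable_on UNIV"
    using assms(1) by (simp add: differentiable_on_def)
  then show ?case by (simp add: differentiable_imp_continuous_on)
next
  case (Suc k)
  then show ?case using assms by auto
qed

text \<open>For \<open>n = 0\<close> this is the classical flat function exp(-1/t). The factor
  \<open>1 / t ^ n\<close> makes the family closed under differentiation up to linear combinations,
  so that all orders are treated at once.\<close>

definition exp_inv :: "nat \<Rightarrow> real \<Rightarrow> real" where
  "exp_inv n t = (if t > 0 then exp (- 1 / t) / t ^ n else 0)"

text \<open>This is the difference quotient at the origin, the only delicate point: with
  \<open>y = 1 / h\<close> the limit from the right is that of \<open>y ^ Suc n / exp y\<close> at
  infinity.\<close>

lemma exp_inv_over_tendsto_0: "((\<lambda>h. exp_inv n h / h) \<longlongrightarrow> 0) (at 0)"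
  unfolding filterlim_at_split
proof
  show "((\<lambda>h. exp_inv n h / h) \<longlongrightarrow> 0) (at_left 0)"
    by (rule tendsto_eventually) (auto simp: exp_inv_def eventually_at_left_field intro!: exI[of _ "-1"])
  have "((\<lambda>y. y ^ Suc n / exp y) \<longlongrightarrow> (0::real)) at_top"
    by (rule tendsto_power_div_exp_0)
  then have "((\<lambda>h. (inverse h) ^ Suc n / exp (inverse h)) \<longlongrightarrow> (0::real)) (at_right 0)"
    using filterlim_inverse_at_top_right filterlim_compose by blast
  then show "((\<lambda>h. exp_inv n h / h) \<longlongrightarrow> 0) (at_right 0)"
    by (rule Lim_transform_eventually)
      (auto simp: exp_inv_def eventually_at_right_field field_simps exp_minus intro!: exI[of _ 1])
qed

lemma DERIV_exp_inv:
  "(exp_inv n has_real_derivative exp_inv (n + 2) t - real n * exp_inv (Suc n) t) (at t)"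
proof (cases t "0::real" rule: linorder_cases)
  case less
  have "((\<lambda>_. 0) has_real_derivative 0) (at t)" by simp
  then have "(exp_inv n has_real_derivative 0) (at t)"
    by (rule has_field_derivative_transform_within_open[of _ _ _ "{..<0}"])
      (use less in \<open>auto simp: exp_inv_def\<close>)
  then show ?thesis using less by (simp add: exp_inv_def)
next
  case equal
  then show ?thesis using exp_inv_over_tendsto_0[of n]
    by (simp add: has_field_derivative_iff exp_inv_def)
next
  case greater
  have "((\<lambda>t. exp (- inverse t) * inverse t ^ n) has_real_derivative
      exp (- inverse t) * inverse t ^ 2 * inverse t ^ n
      + exp (- inverse t) * (real n * (- (inverse t ^ 2)) * inverse t ^ (n - 1))) (at t)"
    using greater by (auto intro!: derivative_eq_intros simp: power2_eq_square)
  \<comment> \<open>The truncated exponent \<open>n - 1\<close> is harmless: for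
    \<open>n = 0\<close> its coefficient \<open>real n\<close> is zero, which the case distinction
    on \<open>n\<close> makes visible.\<close>
  moreover have "exp (- inverse t) * inverse t ^ 2 * inverse t ^ n
      + exp (- inverse t) * (real n * (- (inverse t ^ 2)) * inverse t ^ (n - 1))
      = exp_inv (n + 2) t - real n * exp_inv (Suc n) t"
    using greater
    by (cases n) (simp_all add: exp_inv_def divide_inverse power2_eq_square algebra_simps flip: power_inverse)
  ultimately have "((\<lambda>t. exp (- inverse t) * inverse t ^ n) has_real_derivative
      exp_inv (n + 2) t - real n * exp_inv (Suc n) t) (at t)"
    by simp
  then show ?thesis
    by (rule has_field_derivative_transform_within_open[of _ _ _ "{0<..}"])
      (use greater in \<open>auto simp: exp_inv_def divide_inverse power_inverse\<close>)
qed

text \<open>Smoothness is proved for a whole algebra at once: the derivative of a generator is a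
  linear combination of generators with the same affine argument, so the algebra is closed under
  directional derivatives and \<open>Ck_on_coinduct\<close> gives every order.\<close>

inductive exp_inv_alg :: "('a::euclidean_space \<Rightarrow> real) \<Rightarrow> bool" where
  const: "exp_inv_alg (\<lambda>x. c)"
| add: "exp_inv_alg f \<Longrightarrow> exp_inv_alg g \<Longrightarrow> exp_inv_alg (\<lambda>x. f x + g x)"
| mult: "exp_inv_alg f \<Longrightarrow> exp_inv_alg g \<Longrightarrow> exp_inv_alg (\<lambda>x. f x * g x)"
| base: "exp_inv_alg (\<lambda>x. exp_inv n (l \<bullet> x + d))"

lemma exp_inv_alg_derivative:
  assumes "exp_inv_alg f"
  shows "\<exists>f'. (\<forall>x. (f has_derivative (\<lambda>v. f' v x)) (at x)) \<and> (\<forall>v. exp_inv_alg (f' v))"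
  using assms
proof induction
  case (const c)
  show ?case by (rule exI[of _ "\<lambda>v x. 0"]) (auto intro: exp_inv_alg.const)
next
  case (add f g)
  then obtain f' g' where *: "\<And>x. (f has_derivative (\<lambda>v. f' v x)) (at x)" "\<And>v. exp_inv_alg (f' v)"
    "\<And>x. (g has_derivative (\<lambda>v. g' v x)) (at x)" "\<And>v. exp_inv_alg (g' v)" by blast
  have "exp_inv_alg (\<lambda>x. f' v x + g' v x)" for v
    using * by (intro exp_inv_alg.add)
  then show ?case
    by (intro exI[of _ "\<lambda>v x. f' v x + g' v x"] conjI allI has_derivative_add *)
next
  case (mult f g)
  then obtain f' g' where *: "\<And>x. (f has_derivative (\<lambda>v. f' v x)) (at x)" "\<And>v. exp_inv_alg (f' v)"
    "\<And>x. (g has_derivative (\<lambda>v. g' v x)) (at x)" "\<And>v. exp_inv_alg (g' v)" by blast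
  have "exp_inv_alg (\<lambda>x. f x * g' v x + f' v x * g x)" for v
    using * mult.hyps by (intro exp_inv_alg.add exp_inv_alg.mult)
  then show ?case
    by (intro exI[of _ "\<lambda>v x. f x * g' v x + f' v x * g x"] conjI allI has_derivative_mult *)
next
  case (base n l d)
  have "((\<lambda>x. exp_inv n (l \<bullet> x + d)) has_derivative
     (\<lambda>v. (exp_inv (n + 2) (l \<bullet> x + d) + (- real n) * exp_inv (Suc n) (l \<bullet> x + d)) * (l \<bullet> v))) (at x)" for x
  proof -
    have 1: "((\<lambda>x. l \<bullet> x + d) has_derivative (\<lambda>v. l \<bullet> v)) (at x)"
      by (auto intro!: derivative_eq_intros)
    show ?thesis
      using has_derivative_compose[OF 1 DERIV_exp_inv[unfolded has_field_derivative_def]] by simp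
  qed
  moreover have "exp_inv_alg (\<lambda>x. (exp_inv (n + 2) (l \<bullet> x + d) + (- real n) * exp_inv (Suc n) (l \<bullet> x + d)) * (l \<bullet> v))" for v
    by (intro exp_inv_alg.intros)
  ultimately show ?case
    by (intro exI[of _ "\<lambda>v x. (exp_inv (n + 2) (l \<bullet> x + d) + (- real n) * exp_inv (Suc n) (l \<bullet> x + d)) * (l \<bullet> v)"])
      blast
qed

lemma smooth_on_exp_inv_alg:
  assumes "exp_inv_alg f" shows "smooth_on f UNIV"
  unfolding smooth_on_def
proof
  fix k
  show "Ck_on k f UNIV"
  proof (rule Ck_on_coinduct[where P = exp_inv_alg])
    fix f :: "'a \<Rightarrow> real" and x v assume "exp_inv_alg f"
    then obtain f' where f': "\<And>x. (f has_derivative (\<lambda>v. f' v x)) (at x)" "\<And>v. exp_inv_alg (f' v)"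
      using exp_inv_alg_derivative by blast
    show "f differentiable at x" using f'(1) by (rule differentiableI)
    have "frechet_derivative f (at x) v = f' v x" for x
      by (simp add: frechet_derivative_at[OF f'(1), symmetric])
    then show "exp_inv_alg (\<lambda>x. frechet_derivative f (at x) v)" using f'(2) by simp
  qed fact
qed

lemma exp_inv_alg_prod:
  assumes "\<And>i. i \<in> I \<Longrightarrow> exp_inv_alg (f i)"
  shows "exp_inv_alg (\<lambda>x. \<Prod>i\<in>I. f i x)"
  using assms
proof (induction I rule: infinite_finite_induct)
  case (insert i I)
  then have "exp_inv_alg (\<lambda>x. f i x * (\<Prod>i\<in>I. f i x))" by (intro exp_inv_alg.mult) auto
  then show ?case using insert by simp
qed (simp_all add: exp_inv_alg.const)

text \<open>The parameter \<open>k\<close> only steepens the profile: the bumps vanish off the box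
  for every \<open>k > 0\<close>, and they tend to its indicator as \<open>k\<close> grows.\<close>

definition box_bump :: "'a::euclidean_space \<Rightarrow> 'a \<Rightarrow> real \<Rightarrow> 'a \<Rightarrow> real" where
  "box_bump a b k x = (\<Prod>i\<in>Basis. exp_inv 0 (k * (x \<bullet> i - a \<bullet> i)) * exp_inv 0 (k * (b \<bullet> i - x \<bullet> i)))"

lemma exp_inv_0_bounds: "0 \<le> exp_inv 0 t" "exp_inv 0 t \<le> 1"
  by (auto simp: exp_inv_def)

lemma box_bump_pos:
  assumes "k > 0" shows "x \<in> box a b \<Longrightarrow> box_bump a b k x > 0"
  using assms by (auto simp: box_bump_def mem_box exp_inv_def intro!: prod_pos)

lemma box_bump_eq_0:
  assumes "k > 0" "x \<notin> box a b" shows "box_bump a b k x = 0"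
proof -
  obtain i where i: "i \<in> Basis" "x \<bullet> i \<le> a \<bullet> i \<or> b \<bullet> i \<le> x \<bullet> i"
    using assms(2) unfolding mem_box by (meson linorder_not_less)
  then have "exp_inv 0 (k * (x \<bullet> i - a \<bullet> i)) = 0 \<or> exp_inv 0 (k * (b \<bullet> i - x \<bullet> i)) = 0"
    using assms(1) by (auto simp: exp_inv_def zero_less_mult_iff)
  then show ?thesis
    unfolding box_bump_def using i(1) by (intro prod_zero bexI[of _ i]) auto
qed

lemma box_bump_bounds: "0 \<le> box_bump a b k x" "box_bump a b k x \<le> 1"
proof -
  have "0 \<le> exp_inv 0 s * exp_inv 0 t \<and> exp_inv 0 s * exp_inv 0 t \<le> 1" for s t
    using exp_inv_0_bounds by (simp add: mult_le_one)
  then show "0 \<le> box_bump a b k x" "box_bump a b k x \<le> 1"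
    unfolding box_bump_def by (simp add: prod_nonneg, intro prod_le_1, simp)
qed

lemma test_function_box_bump:
  fixes a b :: "'a::euclidean_space"
  assumes "k > 0" shows "test_function (box_bump a b k)"
proof -
  have "exp_inv_alg (\<lambda>x::'a. exp_inv 0 (k * (x \<bullet> i - a \<bullet> i)) * exp_inv 0 (k * (b \<bullet> i - x \<bullet> i)))" for i
  proof -
    have "(\<lambda>x::'a. exp_inv 0 (k * (x \<bullet> i - a \<bullet> i)) * exp_inv 0 (k * (b \<bullet> i - x \<bullet> i))) =
      (\<lambda>x. exp_inv 0 ((k *\<^sub>R i) \<bullet> x + (- k * (a \<bullet> i))) * exp_inv 0 ((- k *\<^sub>R i) \<bullet> x + k * (b \<bullet> i)))"
      by (auto simp: algebra_simps inner_commute)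
    then show ?thesis by (simp only:) (intro exp_inv_alg.intros)
  qed
  then have "smooth_on (box_bump a b k) UNIV"
    unfolding box_bump_def[abs_def] by (intro smooth_on_exp_inv_alg exp_inv_alg_prod)
  moreover have "{x. box_bump a b k x \<noteq> 0} \<subseteq> cbox a b"
    using box_bump_eq_0[OF assms] box_subset_cbox by blast
  then have "compact (closure {x. box_bump a b k x \<noteq> 0})"
    using bounded_subset[OF bounded_cbox] compact_closure by blast
  ultimately show ?thesis by (simp add: test_function_def)
qed

lemma box_bump_tendsto_indicator:
  fixes x :: "'a::euclidean_space"
  shows "(\<lambda>n. box_bump a b (real (Suc n)) x) \<longlonglongrightarrow> indicator (box a b) x"
proof (cases "x \<in> box a b")
  case True
  have 1: "(\<lambda>n. exp_inv 0 (real (Suc n) * c)) \<longlonglongrightarrow> 1" if "c > 0" for c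
  proof -
    have "(\<lambda>n. exp (- (inverse (real (Suc n)) / c))) \<longlonglongrightarrow> exp (- (0 / c))"
      using that by (intro tendsto_intros LIMSEQ_inverse_real_of_nat) auto
    moreover have "exp (- (inverse (real (Suc n)) / c)) = exp_inv 0 (real (Suc n) * c)" for n
      using that by (simp add: exp_inv_def divide_inverse del: of_nat_Suc)
    ultimately show ?thesis by simp
  qed
  have 2: "(\<lambda>n. exp_inv 0 (real (Suc n) * (x \<bullet> i - a \<bullet> i)) * exp_inv 0 (real (Suc n) * (b \<bullet> i - x \<bullet> i))) \<longlonglongrightarrow> 1 * 1"
    if "i \<in> Basis" for i
    using True that by (intro tendsto_mult 1) (auto simp: mem_box)
  have "(\<lambda>n. box_bump a b (real (Suc n)) x) \<longlonglongrightarrow> (\<Prod>i\<in>(Basis :: 'a set). 1 * 1)"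
    unfolding box_bump_def by (rule Limits.tendsto_prod) (rule 2)
  then show ?thesis using True by simp
next
  case False
  then show ?thesis by (simp add: box_bump_eq_0)
qed

lemma test_function_derivative:
  assumes "test_function \<phi>" shows "(\<phi> has_derivative frechet_derivative \<phi> (at x)) (at x)"
proof -
  have "Ck_on (Suc 0) \<phi> UNIV" using assms unfolding test_function_def smooth_on_def by blast
  then show ?thesis by (simp add: frechet_derivative_works[symmetric])
qed

lemma test_function_continuous:
  assumes "test_function \<phi>"
  shows "continuous_on UNIV \<phi>" "continuous_on UNIV (\<lambda>x. frechet_derivative \<phi> (at x) e)"
proof -
  have "Ck_on (Suc 0) \<phi> UNIV" "Ck_on 0 \<phi> UNIV"
    using assms unfolding test_function_def smooth_on_def by blast+
  then show "continuous_on UNIV \<phi>" "continuous_on UNIV (\<lambda>x. frechet_derivative \<phi> (at x) e)"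
    by auto
qed

lemma test_function_bounds:
  fixes \<phi> :: "'a::euclidean_space \<Rightarrow> real"
  assumes "test_function \<phi>"
  shows "\<exists>R C. R > 0 \<and> C > 0 \<and> (\<forall>x. norm x > R \<longrightarrow> \<phi> x = 0 \<and> frechet_derivative \<phi> (at x) e = 0) \<and>
    (\<forall>x. \<bar>\<phi> x\<bar> \<le> C \<and> \<bar>frechet_derivative \<phi> (at x) e\<bar> \<le> C)"
proof -
  have "bounded (closure {x. \<phi> x \<noteq> 0})"
    using assms compact_imp_bounded by (auto simp: test_function_def)
  then obtain R where R: "R > 0" "\<And>x. x \<in> closure {x. \<phi> x \<noteq> 0} \<Longrightarrow> norm x \<le> R"
    by (auto simp: bounded_pos)
  have z: "\<phi> x = 0" if "norm x > R" for x
    using R(2)[of x] that closure_subset by force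
  have z': "frechet_derivative \<phi> (at x) e = 0" if "norm x > R" for x
  proof -
    have op: "open {x::'a. norm x > R}" by (intro open_Collect_less continuous_intros)
    have "((\<lambda>_. 0) has_derivative (\<lambda>_. 0)) (at x)" by simp
    then have "(\<phi> has_derivative (\<lambda>_. 0)) (at x)"
      by (rule has_derivative_transform_within_open[OF _ op]) (use that z in auto)
    from frechet_derivative_at[OF this, symmetric] show ?thesis by simp
  qed
  have bd: "\<exists>C. \<forall>x. \<bar>f x\<bar> \<le> C" if "continuous_on UNIV f" "\<And>x. norm x > R \<Longrightarrow> f x = 0" for f :: "'a \<Rightarrow> real"
  proof -
    have "compact (f ` cball 0 R)"
      by (intro compact_continuous_image continuous_on_subset[OF that(1)]) auto
    then have "bounded (f ` cball 0 R)" by (rule compact_imp_bounded)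
    then obtain C where "\<forall>y\<in>f ` cball 0 R. norm y \<le> C" unfolding bounded_iff by blast
    then have C: "\<And>x. norm x \<le> R \<Longrightarrow> \<bar>f x\<bar> \<le> C" by simp
    have "\<bar>f x\<bar> \<le> \<bar>C\<bar>" for x using C[of x] that(2)[of x] by (cases "norm x \<le> R") auto
    then show ?thesis by blast
  qed
  obtain C1 where C1: "\<forall>x. \<bar>\<phi> x\<bar> \<le> C1"
    using bd[OF test_function_continuous(1)[OF assms] z] by presburger
  obtain C2 where C2: "\<forall>x. \<bar>frechet_derivative \<phi> (at x) e\<bar> \<le> C2"
    using bd[OF test_function_continuous(2)[OF assms] z'] by presburger
  have "\<bar>\<phi> x\<bar> \<le> \<bar>C1\<bar> + \<bar>C2\<bar> + 1" "\<bar>frechet_derivative \<phi> (at x) e\<bar> \<le> \<bar>C1\<bar> + \<bar>C2\<bar> + 1" for x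
    using C1[rule_format, of x] C2[rule_format, of x] by linarith+
  then show ?thesis
    using R(1) z z' by (intro exI[of _ R] exI[of _ "\<bar>C1\<bar> + \<bar>C2\<bar> + 1"] conjI allI impI) auto
qed

text \<open>Local integrability in the Borel setting, where Fubini and affine substitutions apply
  directly. \<open>locally_integrable_iff_locint\<close> connects it with the notion used in the
  statement.\<close>

definition locint :: "('a::euclidean_space \<Rightarrow> real) \<Rightarrow> bool" where
  "locint f \<longleftrightarrow> f \<in> borel_measurable borel \<and> (\<forall>r. set_integrable lborel (cball 0 r) f)"

lemma locint_measurable: "locint f \<Longrightarrow> f \<in> borel_measurable borel"
  by (simp add: locint_def)

lemma locint_integrable_bounded_support:
  assumes f: "locint f" and m: "g \<in> borel_measurable borel"
    and b: "\<And>x. \<bar>g x\<bar> \<le> C" and z: "\<And>x. norm x > R \<Longrightarrow> g x = 0"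
  shows "integrable lborel (\<lambda>x. f x * g x)"
proof -
  have i: "integrable lborel (\<lambda>x. C * (indicator (cball 0 R) x *\<^sub>R f x))"
    using f by (intro integrable_mult_right) (simp add: locint_def set_integrable_def)
  show ?thesis
  proof (rule Bochner_Integration.integrable_bound[OF i])
    show "(\<lambda>x. f x * g x) \<in> borel_measurable lborel" using locint_measurable[OF f] m by simp
    have "\<bar>f x * g x\<bar> \<le> \<bar>C * (indicator (cball 0 R) x *\<^sub>R f x)\<bar>" for x
    proof (cases "norm x \<le> R")
      case True
      have "\<bar>g x\<bar> \<le> \<bar>C\<bar>" using b[of x] by linarith
      then show ?thesis using True by (simp add: abs_mult mult.commute[of "\<bar>C\<bar>"] mult_left_mono)
    qed (use z in auto)
    then show "AE x in lborel. norm (f x * g x) \<le> norm (C * (indicator (cball 0 R) x *\<^sub>R f x))" by simp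
  qed
qed

text \<open>The positive and the negative part of \<open>f\<close>, read as densities, define two
  measures that agree on boxes. Boxes are stable under intersection and generate the Borel sets, so
  the measures and hence the densities coincide; the two parts of one function can agree only where
  both vanish.\<close>

lemma AE_zero_if_box_integrals_zero:
  fixes f :: "'a::euclidean_space \<Rightarrow> real"
  assumes f: "locint f" and z: "\<And>a b. (LINT x|lborel. indicator (box a b) x * f x) = 0"
  shows "AE x in lborel. f x = 0"
proof -
  have fm[measurable]: "f \<in> borel_measurable borel" using f by (rule locint_measurable)
  define p q where "p = (\<lambda>x. ennreal (f x))" and "q = (\<lambda>x. ennreal (- f x))"
  have pqm[measurable]: "p \<in> borel_measurable borel" "q \<in> borel_measurable borel"
    unfolding p_def q_def by measurable
  have i: "integrable lborel (\<lambda>x. indicator (box a b) x * f x)" for a b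
  proof -
    obtain R where "box a b \<subseteq> ball 0 R"
      using bounded_subset_ballD[OF bounded_box[of a b], of 0] by blast
    then have R: "box a b \<subseteq> cball 0 R" using ball_subset_cball[of 0 R] by (rule subset_trans)
    have "integrable lborel (\<lambda>x. f x * indicator (box a b) x)"
      by (rule locint_integrable_bounded_support[OF f, of _ 1 R])
        (use R in \<open>auto simp: indicator_def\<close>)
    then show ?thesis by (simp add: mult.commute)
  qed
  have eq: "(\<integral>\<^sup>+x. p x * indicator (box a b) x \<partial>lborel) = (\<integral>\<^sup>+x. q x * indicator (box a b) x \<partial>lborel)"
    and fin: "(\<integral>\<^sup>+x. p x * indicator (box a b) x \<partial>lborel) < \<infinity>" for a b
  proof -
    have p: "(\<integral>\<^sup>+x. p x * indicator (box a b) x \<partial>lborel) = (\<integral>\<^sup>+x. ennreal (indicator (box a b) x * f x) \<partial>lborel)"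
      by (rule nn_integral_cong) (auto simp: p_def indicator_def)
    have q: "(\<integral>\<^sup>+x. q x * indicator (box a b) x \<partial>lborel) = (\<integral>\<^sup>+x. ennreal (- (indicator (box a b) x * f x)) \<partial>lborel)"
      by (rule nn_integral_cong) (auto simp: q_def indicator_def)
    have fp: "(\<integral>\<^sup>+x. ennreal (indicator (box a b) x * f x) \<partial>lborel) < \<infinity>"
     and fq: "(\<integral>\<^sup>+x. ennreal (- (indicator (box a b) x * f x)) \<partial>lborel) < \<infinity>"
      using i[of a b] by (auto simp: real_integrable_def less_top)
    show "(\<integral>\<^sup>+x. p x * indicator (box a b) x \<partial>lborel) < \<infinity>" using p fp by simp
    have e: "enn2real (\<integral>\<^sup>+x. ennreal (indicator (box a b) x * f x) \<partial>lborel) =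
      enn2real (\<integral>\<^sup>+x. ennreal (- (indicator (box a b) x * f x)) \<partial>lborel)"
      using z[of a b] real_lebesgue_integral_def[OF i[of a b]] by simp
    show "(\<integral>\<^sup>+x. p x * indicator (box a b) x \<partial>lborel) = (\<integral>\<^sup>+x. q x * indicator (box a b) x \<partial>lborel)"
      unfolding p q using e fp fq by (metis ennreal_enn2real infinity_ennreal_def)
  qed
  have "density lborel p = density lborel q"
  proof (rule measure_eqI_generator_eq[where E = "range (\<lambda>(a,b). box a b)" and \<Omega> = UNIV
        and A = "\<lambda>n. box (- real n *\<^sub>R One) (real n *\<^sub>R One :: 'a)"])
    show "Int_stable (range (\<lambda>(a, b). box a b :: 'a set))"
      by (auto simp: Int_stable_def box_Int_box)
    show "sets (density lborel p) = sigma_sets UNIV (range (\<lambda>(a, b). box a b))"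
      by (simp add: borel_eq_box)
    show "sets (density lborel q) = sigma_sets UNIV (range (\<lambda>(a, b). box a b))"
      by (simp add: borel_eq_box)
    show "(\<Union>i. box (- real i *\<^sub>R One) (real i *\<^sub>R One :: 'a)) = UNIV"
      using UN_box_eq_UNIV by simp
    show "emeasure (density lborel p) X = emeasure (density lborel q) X"
      if "X \<in> range (\<lambda>(a, b). box a b)" for X
    proof -
      obtain a b where X: "X = box a b" using \<open>X \<in> _\<close> by force
      show ?thesis unfolding X by (simp add: emeasure_density eq)
    qed
    show "emeasure (density lborel p) (box (- real i *\<^sub>R One) (real i *\<^sub>R One)) \<noteq> \<infinity>" for i
      using fin[of "- real i *\<^sub>R One" "real i *\<^sub>R One"] by (simp add: emeasure_density less_top)
  qed blast+
  then have "AE x in lborel. p x = q x"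
    by (intro sigma_finite_measure.density_unique[OF sigma_finite_lborel]) auto
  then show ?thesis
  proof eventually_elim
    case (elim x)
    then show ?case
      unfolding p_def q_def by (cases "f x \<ge> 0") (simp_all add: ennreal_neg)
  qed
qed

text \<open>The bumps \<open>box_bump a b (real (Suc n))\<close> converge boundedly to the indicator
  of the box, so dominated convergence reduces the claim to integrals over boxes.\<close>

lemma AE_zero_if_test_integrals_zero:
  fixes f :: "'a::euclidean_space \<Rightarrow> real"
  assumes f: "locint f" and z: "\<And>\<phi>. test_function \<phi> \<Longrightarrow> (LINT x|lborel. f x * \<phi> x) = 0"
  shows "AE x in lborel. f x = 0"
proof (rule AE_zero_if_box_integrals_zero[OF f])
  fix a b :: 'a
  obtain R where "box a b \<subseteq> ball 0 R"
    using bounded_subset_ballD[OF bounded_box[of a b], of 0] by blast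
  then have R: "box a b \<subseteq> cball 0 R" using ball_subset_cball[of 0 R] by (rule subset_trans)
  have fm[measurable]: "f \<in> borel_measurable borel" using f by (rule locint_measurable)
  have bm: "box_bump a b k \<in> borel_measurable borel" if "k > 0" for k
    using test_function_continuous(1)[OF test_function_box_bump[OF that]]
    by (rule borel_measurable_continuous_onI)
  have "(\<lambda>n. LINT x|lborel. f x * box_bump a b (real (Suc n)) x) \<longlonglongrightarrow>
      (LINT x|lborel. indicator (box a b) x * f x)"
  proof (rule integral_dominated_convergence[where w = "\<lambda>x. \<bar>f x * indicator (box a b) x\<bar>"])
    show "integrable lborel (\<lambda>x. \<bar>f x * indicator (box a b) x\<bar>)"
      by (intro integrable_abs locint_integrable_bounded_support[OF f, of _ 1 R])
        (use R in \<open>auto simp: indicator_def\<close>)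
    have "(\<lambda>n. f x * box_bump a b (real (Suc n)) x) \<longlonglongrightarrow> f x * indicator (box a b) x" for x
      by (rule tendsto_mult[OF tendsto_const box_bump_tendsto_indicator])
    then show "AE x in lborel. (\<lambda>n. f x * box_bump a b (real (Suc n)) x) \<longlonglongrightarrow> indicator (box a b) x * f x"
      by (simp add: mult.commute)
    show "(\<lambda>x. indicator (box a b) x * f x) \<in> borel_measurable lborel" by measurable
    fix n
    show "(\<lambda>x. f x * box_bump a b (real (Suc n)) x) \<in> borel_measurable lborel"
      using bm[of "real (Suc n)"] by (intro borel_measurable_times) auto
    have "\<bar>f x * box_bump a b (real (Suc n)) x\<bar> \<le> \<bar>f x * indicator (box a b) x\<bar>" for x
      using box_bump_bounds[of a b "real (Suc n)" x] box_bump_eq_0[of "real (Suc n)" x a b]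
      by (cases "x \<in> box a b") (auto simp: abs_mult mult_left_le)
    then show "AE x in lborel. norm (f x * box_bump a b (real (Suc n)) x) \<le> \<bar>f x * indicator (box a b) x\<bar>"
      by simp
  qed
  moreover have "(LINT x|lborel. f x * box_bump a b (real (Suc n)) x) = 0" for n
    by (rule z[OF test_function_box_bump]) auto
  ultimately show "(LINT x|lborel. indicator (box a b) x * f x) = 0"
    by (simp add: LIMSEQ_const_iff)
qed

section \<open>Continuity of translations in \<open>L\<^sup>1\<close>\<close>

lemma lborel_affine_real:
  fixes t :: "'a::euclidean_space"
  assumes "c \<noteq> 0"
  shows "lborel = density (distr lborel borel (\<lambda>x. t + c *\<^sub>R x)) (\<lambda>_. ennreal (\<bar>c\<bar> ^ DIM('a)))"
  using lborel_affine[OF assms, of t] by (simp add: ennreal_power)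

lemma nn_integral_lborel_affine:
  fixes f :: "'a::euclidean_space \<Rightarrow> ennreal"
  assumes [measurable]: "f \<in> borel_measurable borel" and "c \<noteq> 0"
  shows "(\<integral>\<^sup>+x. f x \<partial>lborel) = ennreal (\<bar>c\<bar> ^ DIM('a)) * (\<integral>\<^sup>+x. f (t + c *\<^sub>R x) \<partial>lborel)"
  by (subst lborel_affine_real[OF \<open>c \<noteq> 0\<close>, of t])
    (simp add: nn_integral_density nn_integral_distr nn_integral_cmult)

lemma integrable_lborel_affine_iff:
  fixes f :: "'a::euclidean_space \<Rightarrow> real"
  assumes [measurable]: "f \<in> borel_measurable borel" and "c \<noteq> 0"
  shows "integrable lborel (\<lambda>x. f (t + c *\<^sub>R x)) \<longleftrightarrow> integrable lborel f"
proof -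
  have "integrable lborel f \<longleftrightarrow>
      integrable (density (distr lborel borel (\<lambda>x. t + c *\<^sub>R x)) (\<lambda>_. ennreal (\<bar>c\<bar> ^ DIM('a)))) f"
    using lborel_affine_real[OF \<open>c \<noteq> 0\<close>, of t] by simp
  also have "\<dots> \<longleftrightarrow> integrable lborel (\<lambda>x. \<bar>c\<bar> ^ DIM('a) * f (t + c *\<^sub>R x))"
    by (subst integrable_density) (simp_all add: integrable_distr_eq)
  finally show ?thesis using \<open>c \<noteq> 0\<close> by simp
qed

lemma integral_lborel_affine:
  fixes f :: "'a::euclidean_space \<Rightarrow> real"
  assumes [measurable]: "f \<in> borel_measurable borel" and "c \<noteq> 0"
  shows "(LINT x|lborel. f x) = \<bar>c\<bar> ^ DIM('a) * (LINT x|lborel. f (t + c *\<^sub>R x))"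
proof -
  have "(LINT x|lborel. f x) =
      integral\<^sup>L (density (distr lborel borel (\<lambda>x. t + c *\<^sub>R x)) (\<lambda>_. ennreal (\<bar>c\<bar> ^ DIM('a)))) f"
    using lborel_affine_real[OF \<open>c \<noteq> 0\<close>, of t] by simp
  also have "\<dots> = (LINT x|lborel. \<bar>c\<bar> ^ DIM('a) * f (t + c *\<^sub>R x))"
    by (subst integral_density) (simp_all add: integral_distr)
  finally show ?thesis by simp
qed

lemma AE_lborel_affine:
  fixes P :: "'a::euclidean_space \<Rightarrow> bool"
  assumes "AE x in lborel. P x" and "c \<noteq> 0"
  shows "AE x in lborel. P (t + c *\<^sub>R x)"
proof -
  obtain N where N: "N \<in> null_sets lborel" "{x. \<not> P x} \<subseteq> N"
    using assms(1) by (auto simp: eventually_ae_filter)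
  then have [measurable]: "N \<in> sets borel" by (auto simp: null_sets_def)
  have "AE x in lborel. x \<notin> N" using N(1) by (rule AE_not_in)
  then have "AE x in density (distr lborel borel (\<lambda>x. t + c *\<^sub>R x)) (\<lambda>_. ennreal (\<bar>c\<bar> ^ DIM('a))). x \<notin> N"
    by (simp only: lborel_affine_real[OF \<open>c \<noteq> 0\<close>, of t, symmetric])
  then have "AE x in distr lborel borel (\<lambda>x. t + c *\<^sub>R x). x \<notin> N"
    using \<open>c \<noteq> 0\<close> by (simp add: AE_density)
  then have "AE x in lborel. t + c *\<^sub>R x \<notin> N"
    by (subst (asm) AE_distr_iff) (simp_all add: pred_def)
  then show ?thesis by eventually_elim (use N(2) in auto)
qed

section \<open>Translates of integrable functions\<close>

definition L1_translation_continuous :: "('a::euclidean_space \<Rightarrow> real) \<Rightarrow> bool" where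
  "L1_translation_continuous f \<longleftrightarrow>
     (\<forall>h. h \<longlonglongrightarrow> 0 \<longrightarrow> (\<lambda>n. LINT x|lborel. \<bar>f (h n + x) - f x\<bar>) \<longlonglongrightarrow> 0)"

lemma integrable_translate:
  fixes f :: "'a::euclidean_space \<Rightarrow> real"
  assumes "integrable lborel f" shows "integrable lborel (\<lambda>x. f (h + x))"
  using integrable_lborel_affine_iff[of f 1 h] assms borel_measurable_integrable[OF assms] by simp

lemma integral_translate:
  fixes f :: "'a::euclidean_space \<Rightarrow> real"
  assumes "f \<in> borel_measurable borel" shows "(LINT x|lborel. f (h + x)) = (LINT x|lborel. f x)"
  using integral_lborel_affine[of f 1 h] assms by simp

text \<open>Translations preserve the L^1 norm, so the approximation error enters twice, for
  \<open>f\<close> and for its translate, uniformly in the shift; the remaining third of the error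
  is spent on \<open>g\<close>.\<close>

lemma L1_translation_continuous_approx:
  fixes f :: "'a::euclidean_space \<Rightarrow> real"
  assumes f: "integrable lborel f"
    and g: "\<And>\<epsilon>. \<epsilon> > 0 \<Longrightarrow> \<exists>g. integrable lborel g \<and> L1_translation_continuous g \<and> (LINT x|lborel. \<bar>f x - g x\<bar>) < \<epsilon>"
  shows "L1_translation_continuous f"
  unfolding L1_translation_continuous_def
proof (intro allI impI LIMSEQ_I)
  fix h :: "nat \<Rightarrow> 'a" and r :: real assume h: "h \<longlonglongrightarrow> 0" and r: "0 < r"
  have "0 < r / 3" using r by simp
  from g[OF this] obtain g where g: "integrable lborel g" "L1_translation_continuous g"
    "(LINT x|lborel. \<bar>f x - g x\<bar>) < r / 3" by (elim exE conjE)
  have "(\<lambda>n. LINT x|lborel. \<bar>g (h n + x) - g x\<bar>) \<longlonglongrightarrow> 0"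
    using g(2) h by (simp add: L1_translation_continuous_def)
  then have "\<forall>\<^sub>F n in sequentially. (LINT x|lborel. \<bar>g (h n + x) - g x\<bar>) < r / 3"
    using r by (intro order_tendstoD(2)[of _ 0]) auto
  then obtain N where N: "\<And>n. n \<ge> N \<Longrightarrow> (LINT x|lborel. \<bar>g (h n + x) - g x\<bar>) < r / 3"
    by (auto simp: eventually_sequentially)
  have "(LINT x|lborel. \<bar>f (h n + x) - f x\<bar>) < r" if "n \<ge> N" for n
  proof -
    have i: "integrable lborel (\<lambda>x. \<bar>f (h n + x) - g (h n + x)\<bar>)" "integrable lborel (\<lambda>x. \<bar>f x - g x\<bar>)"
      "integrable lborel (\<lambda>x. \<bar>g (h n + x) - g x\<bar>)" "integrable lborel (\<lambda>x. \<bar>f (h n + x) - f x\<bar>)"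
      by (intro integrable_abs Bochner_Integration.integrable_diff integrable_translate f g(1))+
    have "(LINT x|lborel. \<bar>f (h n + x) - f x\<bar>) \<le>
      (LINT x|lborel. \<bar>f (h n + x) - g (h n + x)\<bar> + \<bar>f x - g x\<bar> + \<bar>g (h n + x) - g x\<bar>)"
      using i by (intro integral_mono Bochner_Integration.integrable_add) auto
    also have "\<dots> = (LINT x|lborel. \<bar>f (h n + x) - g (h n + x)\<bar>) + (LINT x|lborel. \<bar>f x - g x\<bar>) + (LINT x|lborel. \<bar>g (h n + x) - g x\<bar>)"
      using i by simp
    also have "(LINT x|lborel. \<bar>f (h n + x) - g (h n + x)\<bar>) = (LINT x|lborel. \<bar>f x - g x\<bar>)"
      using borel_measurable_integrable[OF f] borel_measurable_integrable[OF g(1)]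
      by (intro integral_translate) simp
    finally show ?thesis using g(3) N[OF that] by linarith
  qed
  then have "\<forall>n\<ge>N. norm ((LINT x|lborel. \<bar>f (h n + x) - f x\<bar>) - 0) < r" by auto
  then show "\<exists>N. \<forall>n\<ge>N. norm ((LINT x|lborel. \<bar>f (h n + x) - f x\<bar>) - 0) < r" by (rule exI)
qed

text \<open>The translates of an open set have equal measure, so it suffices that the negative part of the
  difference of indicators tends to zero, which dominated convergence gives.\<close>
lemma L1_translation_continuous_open:
  fixes U :: "'a::euclidean_space set"
  assumes U: "open U" "emeasure lborel U < \<infinity>"
  shows "L1_translation_continuous (\<lambda>x. c * indicator U x)"
  unfolding L1_translation_continuous_def
proof (intro allI impI)
  fix h :: "nat \<Rightarrow> 'a" assume h: "h \<longlonglongrightarrow> 0"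
  have [measurable]: "U \<in> sets borel" using U(1) by simp
  define I where "I = (indicator U :: 'a \<Rightarrow> real)"
  have Im[measurable]: "I \<in> borel_measurable borel" unfolding I_def by measurable
  have i: "integrable lborel I" unfolding I_def using U by (intro integrable_real_indicator) auto
  have ih: "integrable lborel (\<lambda>x. I (h n + x))" for n by (rule integrable_translate[OF i])
  have "(\<lambda>n. LINT x|lborel. max 0 (I x - I (h n + x))) \<longlonglongrightarrow> (LINT x|(lborel :: 'a measure). 0)"
  proof (rule integral_dominated_convergence[where w = I])
    show "integrable lborel I" by (rule i)
    have "(\<lambda>n. max 0 (I x - I (h n + x))) \<longlonglongrightarrow> 0" for x
    proof (cases "x \<in> U")
      case True
      have "(\<lambda>n. h n + x) \<longlonglongrightarrow> x" using tendsto_add[OF h tendsto_const[of x]] by simp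
      then have "\<forall>\<^sub>F n in sequentially. h n + x \<in> U" using U(1) True by (rule topological_tendstoD)
      then have "\<forall>\<^sub>F n in sequentially. max 0 (I x - I (h n + x)) = 0"
        by eventually_elim (use True in \<open>simp add: I_def\<close>)
      then show ?thesis by (rule tendsto_eventually)
    qed (simp add: I_def)
    then show "AE x in lborel. (\<lambda>n. max 0 (I x - I (h n + x))) \<longlonglongrightarrow> 0" by simp
    show "AE x in lborel. norm (max 0 (I x - I (h n + x))) \<le> I x" for n
      by (simp add: I_def indicator_def)
    show "(\<lambda>x. max 0 (I x - I (h n + x))) \<in> borel_measurable lborel" for n by measurable
  qed simp
  then have "(\<lambda>n. \<bar>c\<bar> * (2 * (LINT x|lborel. max 0 (I x - I (h n + x))))) \<longlonglongrightarrow> \<bar>c\<bar> * (2 * 0)"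
    by (intro tendsto_mult tendsto_const) simp
  moreover have "(LINT x|lborel. \<bar>c * I (h n + x) - c * I x\<bar>) = \<bar>c\<bar> * (2 * (LINT x|lborel. max 0 (I x - I (h n + x))))" for n
  proof -
    have im: "integrable lborel (\<lambda>x. max 0 (I x - I (h n + x)))"
      by (intro integrable_max Bochner_Integration.integrable_diff i ih) simp
    have "(LINT x|lborel. \<bar>I (h n + x) - I x\<bar>) = (LINT x|lborel. 2 * max 0 (I x - I (h n + x)) + (I (h n + x) - I x))"
      by (intro Bochner_Integration.integral_cong) (auto simp: max_def)
    also have "\<dots> = (LINT x|lborel. 2 * max 0 (I x - I (h n + x))) + ((LINT x|lborel. I (h n + x)) - (LINT x|lborel. I x))"
      using im i ih by simp
    also have "\<dots> = 2 * (LINT x|lborel. max 0 (I x - I (h n + x)))"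
      using integral_translate[OF Im] by simp
    finally have *: "(LINT x|lborel. \<bar>I (h n + x) - I x\<bar>) = 2 * (LINT x|lborel. max 0 (I x - I (h n + x)))" .
    have "(LINT x|lborel. \<bar>c * I (h n + x) - c * I x\<bar>) = (LINT x|lborel. \<bar>c\<bar> * \<bar>I (h n + x) - I x\<bar>)"
      by (simp only: right_diff_distrib[symmetric] abs_mult)
    then show ?thesis using * by simp
  qed
  ultimately show "(\<lambda>n. LINT x|lborel. \<bar>c * indicator U (h n + x) - c * indicator U x\<bar>) \<longlonglongrightarrow> 0"
    unfolding I_def by simp
qed

text \<open>Outer regularity passes from open sets to Borel sets of finite measure; sums and
  dominated limits then reach all integrable functions.\<close>

lemma L1_translation_continuous_integrable:
  fixes f :: "'a::euclidean_space \<Rightarrow> real"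
  assumes "integrable lborel f" shows "L1_translation_continuous f"
  using assms
proof (induction rule: integrable_induct)
  case (base A c)
  have A[measurable]: "A \<in> sets borel" using base by simp
  have ia: "integrable lborel (\<lambda>x. indicator A x *\<^sub>R c)"
    using base by simp
  show ?case
  proof (rule L1_translation_continuous_approx[OF ia])
    fix \<epsilon> :: real assume e: "\<epsilon> > 0"
    \<comment> \<open>The summand 1 covers \<open>c = 0\<close> and makes the final inequality
      strict.\<close>
    define d where "d = \<epsilon> / (\<bar>c\<bar> + 1)"
    have d: "d > 0" using e by (simp add: d_def)
    obtain U where U: "open U" "A \<subseteq> U" "emeasure lborel (U - A) < ennreal d"
      using outer_regular_lborel[OF A, of d] d by blast
    have [measurable]: "U \<in> sets borel" using U(1) by simp
    have "emeasure lborel U = emeasure lborel A + emeasure lborel (U - A)"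
      using U(2) A by (subst plus_emeasure) (auto simp: Un_absorb1)
    also have "\<dots> < \<infinity>"
      using base(2) U(3) by simp (meson ennreal_less_top order_less_trans)
    finally have Ufin: "emeasure lborel U < \<infinity>" .
    have fin: "emeasure lborel (U - A) < \<infinity>" using U(3) by (simp add: less_top) (meson ennreal_less_top order_less_trans less_top)
    have "(LINT x|lborel. \<bar>indicator A x *\<^sub>R c - c * indicator U x\<bar>) = (LINT x|lborel. \<bar>c\<bar> * indicator (U - A) x)"
      using U(2) by (intro Bochner_Integration.integral_cong) (auto simp: indicator_def)
    also have "\<dots> = \<bar>c\<bar> * measure lborel (U - A)" using fin by simp
    also have "\<dots> \<le> \<bar>c\<bar> * d"
      using U(3) d by (intro mult_left_mono) (auto simp: measure_def intro!: enn2real_leI)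
    also have "\<dots> < \<epsilon>" using e by (simp add: d_def field_simps)
    finally show "\<exists>g. integrable lborel g \<and> L1_translation_continuous g \<and> (LINT x|lborel. \<bar>indicator A x *\<^sub>R c - g x\<bar>) < \<epsilon>"
      using L1_translation_continuous_open[OF U(1) Ufin, of c] Ufin
      by (intro exI[of _ "\<lambda>x. c * indicator U x"]) simp
  qed
next
  case (add f g)
  show ?case
    unfolding L1_translation_continuous_def
  proof (intro allI impI)
    fix h :: "nat \<Rightarrow> 'a" assume h: "h \<longlonglongrightarrow> 0"
    have "(\<lambda>n. (LINT x|lborel. \<bar>f (h n + x) - f x\<bar>) + (LINT x|lborel. \<bar>g (h n + x) - g x\<bar>)) \<longlonglongrightarrow> 0 + 0"
      using add.IH h by (intro tendsto_add) (auto simp: L1_translation_continuous_def)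
    then have lim: "(\<lambda>n. (LINT x|lborel. \<bar>f (h n + x) - f x\<bar>) + (LINT x|lborel. \<bar>g (h n + x) - g x\<bar>)) \<longlonglongrightarrow> 0" by simp
    show "(\<lambda>n. LINT x|lborel. \<bar>(f (h n + x) + g (h n + x)) - (f x + g x)\<bar>) \<longlonglongrightarrow> 0"
    proof (rule tendsto_sandwich[OF _ _ tendsto_const lim])
      show "\<forall>\<^sub>F n in sequentially. (LINT x|lborel. \<bar>(f (h n + x) + g (h n + x)) - (f x + g x)\<bar>) \<le>
         (LINT x|lborel. \<bar>f (h n + x) - f x\<bar>) + (LINT x|lborel. \<bar>g (h n + x) - g x\<bar>)"
      proof (rule always_eventually, rule allI)
        fix n
        have i: "integrable lborel (\<lambda>x. f (h n + x) - f x)" "integrable lborel (\<lambda>x. g (h n + x) - g x)"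
          using add.hyps by (auto intro: integrable_translate)
        have "(LINT x|lborel. \<bar>(f (h n + x) + g (h n + x)) - (f x + g x)\<bar>) \<le> (LINT x|lborel. \<bar>f (h n + x) - f x\<bar> + \<bar>g (h n + x) - g x\<bar>)"
          using add.hyps i by (intro integral_mono integrable_abs Bochner_Integration.integrable_add
             Bochner_Integration.integrable_diff integrable_translate) auto
        also have "\<dots> = (LINT x|lborel. \<bar>f (h n + x) - f x\<bar>) + (LINT x|lborel. \<bar>g (h n + x) - g x\<bar>)"
          using i by (intro Bochner_Integration.integral_add integrable_abs)
        finally show "(LINT x|lborel. \<bar>(f (h n + x) + g (h n + x)) - (f x + g x)\<bar>) \<le>
           (LINT x|lborel. \<bar>f (h n + x) - f x\<bar>) + (LINT x|lborel. \<bar>g (h n + x) - g x\<bar>)" .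
      qed
    qed simp
  qed
next
  case (lim f s)
  show ?case
  proof (rule L1_translation_continuous_approx[OF lim.hyps(4)])
    fix \<epsilon> :: real assume e: "\<epsilon> > 0"
    have "(\<lambda>i. LINT x|lborel. \<bar>f x - s i x\<bar>) \<longlonglongrightarrow> (LINT x|(lborel :: 'a measure). 0)"
    \<comment> \<open>In the limit case the approximants are bounded by twice the absolute value of
      \<open>f\<close>, which gives the factor 3 for the difference.\<close>
    proof (rule integral_dominated_convergence[where w = "\<lambda>x. 3 * \<bar>f x\<bar>"])
      show "integrable lborel (\<lambda>x. 3 * \<bar>f x\<bar>)" using lim.hyps(4) by simp
      have "(\<lambda>i. \<bar>f x - s i x\<bar>) \<longlonglongrightarrow> 0" for x
        using tendsto_rabs[OF tendsto_diff[OF tendsto_const[of "f x"] lim.hyps(2)[of x]]] by simp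
      then show "AE x in lborel. (\<lambda>i. \<bar>f x - s i x\<bar>) \<longlonglongrightarrow> 0" by simp
      show "AE x in lborel. norm \<bar>f x - s i x\<bar> \<le> 3 * \<bar>f x\<bar>" for i
        using lim.hyps(3)[of _ i] by (intro AE_I2) (fastforce)
      show "(\<lambda>x. \<bar>f x - s i x\<bar>) \<in> borel_measurable lborel" for i
        using lim.hyps(1)[of i] lim.hyps(4) by (intro borel_measurable_abs borel_measurable_diff) auto
    qed simp
    then have "\<forall>\<^sub>F i in sequentially. (LINT x|lborel. \<bar>f x - s i x\<bar>) < \<epsilon>"
      using e by (intro order_tendstoD(2)[of _ 0]) auto
    then obtain i where "(LINT x|lborel. \<bar>f x - s i x\<bar>) < \<epsilon>"
      by (auto simp: eventually_sequentially)
    then show "\<exists>g. integrable lborel g \<and> L1_translation_continuous g \<and> (LINT x|lborel. \<bar>f x - g x\<bar>) < \<epsilon>"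
      using lim.hyps(1) lim.IH by (intro exI[of _ "s i"]) simp
  qed
qed

section \<open>Weak directional derivatives and difference quotients\<close>

lemma test_function_affine:
  fixes \<phi> :: "'a::euclidean_space \<Rightarrow> real"
  assumes \<phi>: "test_function \<phi>" and c: "c \<noteq> 0"
  shows "test_function (\<lambda>x. \<phi> (h + c *\<^sub>R x))"
    and "frechet_derivative (\<lambda>x. \<phi> (h + c *\<^sub>R x)) (at x) v = c * frechet_derivative \<phi> (at (h + c *\<^sub>R x)) v"
proof -
  have aff: "((\<lambda>x. h + c *\<^sub>R x) has_derivative (\<lambda>v. c *\<^sub>R v)) (at x)" for x :: 'a
    by (auto intro!: derivative_eq_intros)
  have der: "((\<lambda>x. f (h + c *\<^sub>R x)) has_derivative (\<lambda>v. f' (c *\<^sub>R v))) (at x)"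
    if "(f has_derivative f') (at (h + c *\<^sub>R x))" for f :: "'a \<Rightarrow> real" and f' x
    using has_derivative_compose[OF aff that] .
  have fr: "frechet_derivative (\<lambda>x. f (h + c *\<^sub>R x)) (at x) v = c * frechet_derivative f (at (h + c *\<^sub>R x)) v"
    if "f differentiable at (h + c *\<^sub>R x)" for f :: "'a \<Rightarrow> real" and x v
  proof -
    have *: "(f has_derivative frechet_derivative f (at (h + c *\<^sub>R x))) (at (h + c *\<^sub>R x))"
      using that by (simp add: frechet_derivative_works)
    have "frechet_derivative (\<lambda>x. f (h + c *\<^sub>R x)) (at x) v = frechet_derivative f (at (h + c *\<^sub>R x)) (c *\<^sub>R v)"
      using frechet_derivative_at[OF der[OF *]] by metis
    also have "\<dots> = c * frechet_derivative f (at (h + c *\<^sub>R x)) v"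
      using linear_cmul[OF has_derivative_linear[OF *]] by simp
    finally show ?thesis .
  qed
  \<comment> \<open>Each differentiation produces a factor \<open>c\<close>; the free prefactor
    \<open>r\<close> absorbs it, so that the induction on the order closes.\<close>
  have Ck: "Ck_on k (\<lambda>x. r * f (h + c *\<^sub>R x)) UNIV" if "Ck_on k f UNIV" for k f r
    using that
  proof (induction k arbitrary: f r)
    case 0
    then have "continuous_on UNIV f" by simp
    then have "continuous_on UNIV (\<lambda>x. f (h + c *\<^sub>R x))"
      by (rule continuous_on_compose2[where t = UNIV]) (auto intro!: continuous_intros)
    then show ?case by (auto intro!: continuous_intros)
  next
    case (Suc k)
    have d: "f differentiable at x" for x using Suc.prems by simp
    then have d': "(\<lambda>x. f (h + c *\<^sub>R x)) differentiable at x" for x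
      using der by (metis differentiable_def)
    have "frechet_derivative (\<lambda>x. r * f (h + c *\<^sub>R x)) (at x) v =
        (r * c) * frechet_derivative f (at (h + c *\<^sub>R x)) v" for x v
    proof -
      have "((\<lambda>x. r * f (h + c *\<^sub>R x)) has_derivative
          (\<lambda>v. r * frechet_derivative (\<lambda>x. f (h + c *\<^sub>R x)) (at x) v)) (at x)"
        using d' by (intro has_derivative_mult_right) (simp add: frechet_derivative_works[symmetric])
      from frechet_derivative_at[OF this]
      have "frechet_derivative (\<lambda>x. r * f (h + c *\<^sub>R x)) (at x) v
        = r * frechet_derivative (\<lambda>x. f (h + c *\<^sub>R x)) (at x) v" by metis
      then show ?thesis using fr[OF d] by simp
    qed
    moreover have "Ck_on k (\<lambda>x. (r * c) * frechet_derivative f (at (h + c *\<^sub>R x)) v) UNIV" for v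
      by (rule Suc.IH) (use Suc.prems in simp)
    moreover have "(\<lambda>x. r * f (h + c *\<^sub>R x)) differentiable at x" for x
      using d' by (intro differentiable_mult) simp_all
    ultimately show ?case by simp
  qed
  have "smooth_on (\<lambda>x. \<phi> (h + c *\<^sub>R x)) UNIV"
    unfolding smooth_on_def
  proof
    fix k show "Ck_on k (\<lambda>x. \<phi> (h + c *\<^sub>R x)) UNIV"
      using Ck[of k \<phi> 1] \<phi> by (simp add: test_function_def smooth_on_def)
  qed
  moreover have "compact (closure {x. \<phi> (h + c *\<^sub>R x) \<noteq> 0})"
  proof -
    obtain R where R: "\<forall>x. norm x > R \<longrightarrow> \<phi> x = 0"
      using test_function_bounds[OF \<phi>, of 0] by metis
    have *: "norm (h + c *\<^sub>R x) \<le> R" if "\<phi> (h + c *\<^sub>R x) \<noteq> 0" for x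
      using that R[rule_format, of "h + c *\<^sub>R x"] by linarith
    have "norm x \<le> (R + norm h) / \<bar>c\<bar>" if "\<phi> (h + c *\<^sub>R x) \<noteq> 0" for x
    proof -
      have "norm (c *\<^sub>R x) \<le> norm (h + c *\<^sub>R x) + norm h"
        using norm_triangle_ineq4[of "h + c *\<^sub>R x" h] by simp
      then show ?thesis using *[OF that] c by (simp add: field_simps)
    qed
    then have "bounded {x. \<phi> (h + c *\<^sub>R x) \<noteq> 0}" unfolding bounded_iff by auto
    then show ?thesis by (simp add: compact_closure)
  qed
  ultimately show "test_function (\<lambda>x. \<phi> (h + c *\<^sub>R x))" by (simp add: test_function_def)
  show "frechet_derivative (\<lambda>x. \<phi> (h + c *\<^sub>R x)) (at x) v = c * frechet_derivative \<phi> (at (h + c *\<^sub>R x)) v"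
    using test_function_derivative[OF \<phi>] by (intro fr) (auto simp: differentiable_def)
qed

lemma locint_integrable_cball: "locint f \<Longrightarrow> integrable lborel (\<lambda>x. indicator (cball 0 r) x * f x)"
  by (simp add: locint_def set_integrable_def)

lemma locintI:
  assumes "f \<in> borel_measurable borel" "\<And>r. integrable lborel (\<lambda>x. indicator (cball 0 r) x * f x)"
  shows "locint f"
  using assms by (simp add: locint_def set_integrable_def)

lemma locint_bound_AE:
  fixes f g :: "'a::euclidean_space \<Rightarrow> real"
  assumes g: "locint g" and f: "f \<in> borel_measurable borel" and le: "AE x in lborel. \<bar>f x\<bar> \<le> \<bar>g x\<bar>"
  shows "locint f"
proof (rule locintI[OF f])
  fix r
  have [measurable]: "cball 0 r \<in> sets (borel :: 'a measure)" by simp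
  note f[measurable]
  show "integrable lborel (\<lambda>x. indicator (cball 0 r) x * f x)"
  proof (rule Bochner_Integration.integrable_bound[OF locint_integrable_cball[OF g, of r]])
    show "AE x in lborel. norm (indicator (cball 0 r) x * f x) \<le> norm (indicator (cball 0 r) x * g x)"
      using le by eventually_elim (auto simp: indicator_def)
    show "(\<lambda>x. indicator (cball 0 r) x * f x) \<in> borel_measurable lborel" by measurable
  qed
qed

lemma locint_bound:
  assumes "locint g" "f \<in> borel_measurable borel" "\<And>x. \<bar>f x\<bar> \<le> \<bar>g x\<bar>"
  shows "locint f"
  by (rule locint_bound_AE[OF assms(1,2)]) (simp add: assms(3))

lemma locint_add: "locint f \<Longrightarrow> locint g \<Longrightarrow> locint (\<lambda>x. f x + g x)"
  and locint_diff: "locint f \<Longrightarrow> locint g \<Longrightarrow> locint (\<lambda>x. f x - g x)"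
  and locint_cmult: "locint f \<Longrightarrow> locint (\<lambda>x. c * f x)"
  and locint_abs: "locint f \<Longrightarrow> locint (\<lambda>x. \<bar>f x\<bar>)"
proof -
  assume f: "locint f"
  note fm = locint_measurable[OF f] and fi = locint_integrable_cball[OF f]
  show "locint (\<lambda>x. c * f x)"
  proof (rule locintI)
    show "integrable lborel (\<lambda>x. indicator (cball 0 r) x * (c * f x))" for r
      using integrable_mult_right[OF fi[of r], of c] by (simp add: mult.left_commute)
  qed (use fm in simp)
  show "locint (\<lambda>x. \<bar>f x\<bar>)"
    by (rule locint_bound[OF f]) (use fm in auto)
  assume g: "locint g"
  note gm = locint_measurable[OF g] and gi = locint_integrable_cball[OF g]
  show "locint (\<lambda>x. f x + g x)"
    by (rule locintI) (use fm gm fi gi in \<open>auto simp: distrib_left\<close>)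
  show "locint (\<lambda>x. f x - g x)"
    by (rule locintI) (use fm gm fi gi in \<open>auto simp: right_diff_distrib\<close>)
qed

lemma locint_affine:
  fixes f :: "'a::euclidean_space \<Rightarrow> real"
  assumes f: "locint f" and c: "c \<noteq> 0"
  shows "locint (\<lambda>x. f (h + c *\<^sub>R x))"
proof (rule locintI)
  note fm[measurable] = locint_measurable[OF f]
  show "(\<lambda>x. f (h + c *\<^sub>R x)) \<in> borel_measurable borel" by measurable
  fix r
  define R where "R = norm h + \<bar>c\<bar> * r"
  have i: "integrable lborel (\<lambda>x. indicator (cball 0 R) (h + c *\<^sub>R x) * f (h + c *\<^sub>R x))"
    using integrable_lborel_affine_iff[of "\<lambda>x. indicator (cball 0 R) x * f x" c h] c
      locint_integrable_cball[OF f] by simp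
  have "norm (h + c *\<^sub>R x) \<le> R" if "norm x \<le> r" for x
  proof -
    have "norm (h + c *\<^sub>R x) \<le> norm h + \<bar>c\<bar> * norm x" using norm_triangle_ineq[of h "c *\<^sub>R x"] by simp
    also have "\<dots> \<le> R" unfolding R_def using that by (intro add_left_mono mult_left_mono) auto
    finally show ?thesis .
  qed
  then show "integrable lborel (\<lambda>x. indicator (cball 0 r) x * f (h + c *\<^sub>R x))"
    by (intro Bochner_Integration.integrable_bound[OF i]) (auto simp: indicator_def)
qed

text \<open>One direction at a time, which turns weak gradients into scalar statements about
  difference quotients along \<open>e\<close>. The full gradient is reassembled over
  \<open>Basis\<close>.\<close>

definition weak_dderiv :: "'a::euclidean_space \<Rightarrow> ('a \<Rightarrow> real) \<Rightarrow> ('a \<Rightarrow> real) \<Rightarrow> bool" where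
  "weak_dderiv e u g \<longleftrightarrow> locint u \<and> locint g \<and>
     (\<forall>\<phi>. test_function \<phi> \<longrightarrow>
       (LINT x|lborel. u x * frechet_derivative \<phi> (at x) e) = - (LINT x|lborel. g x * \<phi> x))"

lemma test_function_integrable:
  assumes "locint f" "test_function \<phi>"
  shows "integrable lborel (\<lambda>x. f x * \<phi> x)"
    and "integrable lborel (\<lambda>x. f x * frechet_derivative \<phi> (at x) e)"
proof -
  obtain R C where **: "\<forall>x. norm x > R \<longrightarrow> \<phi> x = 0 \<and> frechet_derivative \<phi> (at x) e = 0"
    "\<forall>x. \<bar>\<phi> x\<bar> \<le> C \<and> \<bar>frechet_derivative \<phi> (at x) e\<bar> \<le> C"
    using test_function_bounds[OF assms(2), of e] by (elim exE conjE)
  then have *: "\<And>x. norm x > R \<Longrightarrow> \<phi> x = 0" "\<And>x. norm x > R \<Longrightarrow> frechet_derivative \<phi> (at x) e = 0"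
    "\<And>x. \<bar>\<phi> x\<bar> \<le> C" "\<And>x. \<bar>frechet_derivative \<phi> (at x) e\<bar> \<le> C"
    by simp_all
  show "integrable lborel (\<lambda>x. f x * \<phi> x)"
    by (rule locint_integrable_bounded_support[OF assms(1) _ *(3) *(1)])
      (use test_function_continuous(1)[OF assms(2)] in \<open>simp add: borel_measurable_continuous_onI\<close>)
  show "integrable lborel (\<lambda>x. f x * frechet_derivative \<phi> (at x) e)"
    by (rule locint_integrable_bounded_support[OF assms(1) _ *(4) *(2)])
      (use test_function_continuous(2)[OF assms(2), of e] in \<open>simp add: borel_measurable_continuous_onI\<close>)
qed

lemma weak_dderiv_unique:
  assumes "weak_dderiv e u g" "weak_dderiv e u g'"
  shows "AE x in lborel. g x = g' x"
proof -
  have l: "locint g" "locint g'" using assms by (auto simp: weak_dderiv_def)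
  have "AE x in lborel. g x - g' x = 0"
  proof (rule AE_zero_if_test_integrals_zero[OF locint_diff[OF l]])
    fix \<phi> :: "'a \<Rightarrow> real" assume \<phi>: "test_function \<phi>"
    have "(LINT x|lborel. g x * \<phi> x) = (LINT x|lborel. g' x * \<phi> x)"
      using assms \<phi> unfolding weak_dderiv_def by (metis neg_equal_iff_equal)
    then show "(LINT x|lborel. (g x - g' x) * \<phi> x) = 0"
      using test_function_integrable(1)[OF l(1) \<phi>] test_function_integrable(1)[OF l(2) \<phi>]
      by (simp add: left_diff_distrib)
  qed
  then show ?thesis by simp
qed

lemma weak_dderiv_affine:
  fixes u g :: "'a::euclidean_space \<Rightarrow> real"
  assumes w: "weak_dderiv e u g" and c: "c \<noteq> 0"
  shows "weak_dderiv e (\<lambda>x. a * u (h + c *\<^sub>R x)) (\<lambda>x. a * c * g (h + c *\<^sub>R x))"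
proof -
  have lu: "locint u" and lg: "locint g" using w by (auto simp: weak_dderiv_def)
  note [measurable] = locint_measurable[OF lu] locint_measurable[OF lg]
  show ?thesis
    unfolding weak_dderiv_def
  proof (intro conjI allI impI)
    show "locint (\<lambda>x. a * u (h + c *\<^sub>R x))" "locint (\<lambda>x. a * c * g (h + c *\<^sub>R x))"
      by (intro locint_cmult locint_affine lu lg c)+
    fix \<phi> :: "'a \<Rightarrow> real" assume \<phi>: "test_function \<phi>"
    \<comment> \<open>Pulling the test function back by the inverse affine map gives
      \<open>\<psi> (h + c *\<^sub>R x) = \<phi> x\<close>. The same Jacobian then appears on both
      sides and cancels, while the derivative contributes \<open>1 / c\<close>.\<close>
    define \<psi> where "\<psi> = (\<lambda>y. \<phi> ((- (1 / c) *\<^sub>R h) + (1 / c) *\<^sub>R y))"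
    have \<psi>: "test_function \<psi>" unfolding \<psi>_def by (rule test_function_affine(1)[OF \<phi>]) (use c in simp)
    have inv: "(- (1 / c) *\<^sub>R h) + (1 / c) *\<^sub>R (h + c *\<^sub>R x) = x" for x
      using c by (simp add: algebra_simps)
    have \<psi>1: "\<psi> (h + c *\<^sub>R x) = \<phi> x" for x unfolding \<psi>_def inv ..
    have \<psi>2: "frechet_derivative \<psi> (at (h + c *\<^sub>R x)) e = (1 / c) * frechet_derivative \<phi> (at x) e" for x
      unfolding \<psi>_def by (subst test_function_affine(2)[OF \<phi>]) (use c in \<open>simp_all only: inv, simp\<close>)
    have cont: "\<psi> \<in> borel_measurable borel" "(\<lambda>x. frechet_derivative \<psi> (at x) e) \<in> borel_measurable borel"
      using test_function_continuous[OF \<psi>] by (auto intro: borel_measurable_continuous_onI)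
    have "(LINT y|lborel. u y * frechet_derivative \<psi> (at y) e) = \<bar>c\<bar> ^ DIM('a) * (LINT x|lborel. u (h + c *\<^sub>R x) * ((1 / c) * frechet_derivative \<phi> (at x) e))"
      using integral_lborel_affine[of "\<lambda>y. u y * frechet_derivative \<psi> (at y) e" c h] cont c by (simp add: \<psi>2)
    moreover have "(LINT y|lborel. g y * \<psi> y) = \<bar>c\<bar> ^ DIM('a) * (LINT x|lborel. g (h + c *\<^sub>R x) * \<phi> x)"
      using integral_lborel_affine[of "\<lambda>y. g y * \<psi> y" c h] cont c by (simp add: \<psi>1)
    moreover have "(LINT y|lborel. u y * frechet_derivative \<psi> (at y) e) = - (LINT y|lborel. g y * \<psi> y)"
      using w \<psi> by (simp add: weak_dderiv_def)
    ultimately have "\<bar>c\<bar> ^ DIM('a) * ((LINT x|lborel. u (h + c *\<^sub>R x) * ((1 / c) * frechet_derivative \<phi> (at x) e)))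
       = \<bar>c\<bar> ^ DIM('a) * (- (LINT x|lborel. g (h + c *\<^sub>R x) * \<phi> x))" by simp
    moreover have "\<bar>c\<bar> ^ DIM('a) \<noteq> 0" using c by simp
    ultimately have "(LINT x|lborel. u (h + c *\<^sub>R x) * ((1 / c) * frechet_derivative \<phi> (at x) e)) = - (LINT x|lborel. g (h + c *\<^sub>R x) * \<phi> x)"
      by (rule mult_left_cancel[THEN iffD1, rotated])
    then have eq: "(1 / c) * (LINT x|lborel. u (h + c *\<^sub>R x) * frechet_derivative \<phi> (at x) e) = - (LINT x|lborel. g (h + c *\<^sub>R x) * \<phi> x)"
      by (simp add: mult.left_commute)
    have "(LINT x|lborel. a * u (h + c *\<^sub>R x) * frechet_derivative \<phi> (at x) e) = a * c * ((1 / c) * (LINT x|lborel. u (h + c *\<^sub>R x) * frechet_derivative \<phi> (at x) e))"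
      using c by (simp add: mult.assoc)
    also have "\<dots> = - (LINT x|lborel. a * c * g (h + c *\<^sub>R x) * \<phi> x)"
      unfolding eq by (simp add: mult.assoc)
    finally show "(LINT x|lborel. a * u (h + c *\<^sub>R x) * frechet_derivative \<phi> (at x) e) = - (LINT x|lborel. a * c * g (h + c *\<^sub>R x) * \<phi> x)" .
  qed
qed

text \<open>Prepares Fubini for averages of \<open>g\<close> over segments. For \<open>s\<close> in
  the unit interval and \<open>norm x \<le> R\<close> the shifted argument stays in the ball of
  radius \<open>R'\<close>, and by translation invariance the integral over \<open>x\<close> has a
  bound independent of \<open>s\<close>.\<close>

lemma integrable_shear_product:
  fixes g :: "'a::euclidean_space \<Rightarrow> real" and k :: "real \<Rightarrow> 'a \<Rightarrow> real"
  assumes g: "locint g"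
    and km[measurable]: "case_prod k \<in> borel_measurable (borel \<Otimes>\<^sub>M borel)"
    and kb: "\<And>s x. \<bar>k s x\<bar> \<le> C * indicator {0..1} s" and kz: "\<And>s x. norm x > R \<Longrightarrow> k s x = 0"
  shows "integrable (lborel \<Otimes>\<^sub>M lborel) (\<lambda>(s, x). g ((s * t) *\<^sub>R e + x) * k s x)"
proof (rule integrableI_bounded)
  note gm[measurable] = locint_measurable[OF g]
  have C: "C \<ge> 0" using kb[of 0 0] by simp
  define R' where "R' = R + \<bar>t\<bar> * norm e"
  have [measurable]: "cball 0 R' \<in> sets (borel :: 'a measure)" by simp
  define G where "G = (\<integral>\<^sup>+x. ennreal \<bar>indicator (cball 0 R') x * g x\<bar> \<partial>lborel)"
  have Gfin: "G < \<infinity>"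
    using locint_integrable_cball[OF g, of R'] unfolding G_def integrable_iff_bounded by simp
  show m: "(\<lambda>(s, x). g ((s * t) *\<^sub>R e + x) * k s x) \<in> borel_measurable (lborel \<Otimes>\<^sub>M lborel)"
    by measurable
  have b: "\<bar>g ((s * t) *\<^sub>R e + x) * k s x\<bar> \<le>
      C * indicator {0..1} s * \<bar>indicator (cball 0 R') ((s * t) *\<^sub>R e + x) * g ((s * t) *\<^sub>R e + x)\<bar>" for s x
  proof (cases "norm x \<le> R \<and> s \<in> {0..1}")
    case True
    have "norm ((s * t) *\<^sub>R e + x) \<le> \<bar>s * t\<bar> * norm e + norm x"
      using norm_triangle_ineq[of "(s * t) *\<^sub>R e" x] by simp
    also have "\<bar>s * t\<bar> * norm e \<le> \<bar>t\<bar> * norm e"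
      using True by (intro mult_right_mono) (auto simp: abs_mult mult_left_le_one_le)
    finally have "norm ((s * t) *\<^sub>R e + x) \<le> R'" using True by (simp add: R'_def)
    then have eq: "\<bar>indicator (cball 0 R') ((s * t) *\<^sub>R e + x) * g ((s * t) *\<^sub>R e + x)\<bar> = \<bar>g ((s * t) *\<^sub>R e + x)\<bar>"
      by simp
    show ?thesis
      unfolding eq using mult_right_mono[OF kb[of s x], of "\<bar>g ((s * t) *\<^sub>R e + x)\<bar>"]
      by (simp add: abs_mult mult.commute)
  next
    case False
    then have "k s x = 0" using kz[of x s] kb[of s x] by (auto split: split_indicator_asm)
    then show ?thesis using C by simp
  qed
  have "(\<integral>\<^sup>+p. ennreal (norm (case p of (s, x) \<Rightarrow> g ((s * t) *\<^sub>R e + x) * k s x)) \<partial>(lborel \<Otimes>\<^sub>M lborel)) =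
    (\<integral>\<^sup>+s. \<integral>\<^sup>+x. ennreal \<bar>g ((s * t) *\<^sub>R e + x) * k s x\<bar> \<partial>lborel \<partial>lborel)"
    by (subst lborel.nn_integral_fst[symmetric]) simp_all
  also have "\<dots> \<le> (\<integral>\<^sup>+s. ennreal C * indicator {0..1} s * G \<partial>(lborel :: real measure))"
  proof (rule nn_integral_mono)
    fix s :: real
    have "(\<integral>\<^sup>+x. ennreal \<bar>g ((s * t) *\<^sub>R e + x) * k s x\<bar> \<partial>lborel) \<le>
      (\<integral>\<^sup>+x. ennreal C * indicator {0..1} s * ennreal \<bar>indicator (cball 0 R') ((s * t) *\<^sub>R e + x) * g ((s * t) *\<^sub>R e + x)\<bar> \<partial>lborel)"
    proof (rule nn_integral_mono)
      fix x
      have "ennreal C * indicator {0..1} s * ennreal \<bar>indicator (cball 0 R') ((s * t) *\<^sub>R e + x) * g ((s * t) *\<^sub>R e + x)\<bar>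
        = ennreal (C * indicator {0..1} s * \<bar>indicator (cball 0 R') ((s * t) *\<^sub>R e + x) * g ((s * t) *\<^sub>R e + x)\<bar>)"
        using C by (cases "s \<in> {0..1}") (simp_all add: ennreal_mult)
      then show "ennreal \<bar>g ((s * t) *\<^sub>R e + x) * k s x\<bar> \<le>
        ennreal C * indicator {0..1} s * ennreal \<bar>indicator (cball 0 R') ((s * t) *\<^sub>R e + x) * g ((s * t) *\<^sub>R e + x)\<bar>"
        using ennreal_leI[OF b[of s x]] by simp
    qed
    also have "\<dots> = ennreal C * indicator {0..1} s * (\<integral>\<^sup>+x. ennreal \<bar>indicator (cball 0 R') ((s * t) *\<^sub>R e + x) * g ((s * t) *\<^sub>R e + x)\<bar> \<partial>lborel)"
      by (rule nn_integral_cmult) simp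
    also have "(\<integral>\<^sup>+x. ennreal \<bar>indicator (cball 0 R') ((s * t) *\<^sub>R e + x) * g ((s * t) *\<^sub>R e + x)\<bar> \<partial>lborel) = G"
      unfolding G_def
      by (subst nn_integral_lborel_affine[of "\<lambda>x. ennreal \<bar>indicator (cball 0 R') x * g x\<bar>" 1 "(s * t) *\<^sub>R e"]) simp_all
    finally show "(\<integral>\<^sup>+x. ennreal \<bar>g ((s * t) *\<^sub>R e + x) * k s x\<bar> \<partial>lborel) \<le> ennreal C * indicator {0..1} s * G" .
  qed
  also have "\<dots> = ennreal C * G"
    by (simp add: nn_integral_multc nn_integral_cmult)
  also have "\<dots> < \<infinity>" using Gfin by (simp add: ennreal_mult_less_top)
  finally show "(\<integral>\<^sup>+p. ennreal (norm (case p of (s, x) \<Rightarrow> g ((s * t) *\<^sub>R e + x) * k s x)) \<partial>(lborel \<Otimes>\<^sub>M lborel)) < \<infinity>" .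
qed

lemma test_function_ray_derivative:
  assumes "test_function \<phi>"
  shows "((\<lambda>s. \<phi> (y + s *\<^sub>R e)) has_real_derivative frechet_derivative \<phi> (at (y + s *\<^sub>R e)) e) (at s)"
proof -
  have 1: "((\<lambda>s. y + s *\<^sub>R e) has_derivative (\<lambda>s. s *\<^sub>R e)) (at s)"
    by (auto intro!: derivative_eq_intros)
  have "((\<lambda>s. \<phi> (y + s *\<^sub>R e)) has_derivative (\<lambda>r. frechet_derivative \<phi> (at (y + s *\<^sub>R e)) (r *\<^sub>R e))) (at s)"
    by (rule has_derivative_compose[OF 1 test_function_derivative[OF assms]])
  moreover have "frechet_derivative \<phi> (at (y + s *\<^sub>R e)) (r *\<^sub>R e) = frechet_derivative \<phi> (at (y + s *\<^sub>R e)) e * r" for r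
    using linear_cmul[OF has_derivative_linear[OF test_function_derivative[OF assms]]] by (simp add: mult.commute)
  ultimately show ?thesis by (simp add: has_field_derivative_def)
qed

text \<open>The fundamental theorem of calculus along the segment from \<open>y\<close> back to
  \<open>y - t e\<close>. It runs backwards because a shift of \<open>u\<close> by
  \<open>t e\<close> becomes, after substitution, a shift of the test function by
  \<open>- t e\<close>.\<close>

lemma test_function_increment:
  assumes "test_function \<phi>"
  shows "t * (LINT s|lborel. indicator {0..1} s * frechet_derivative \<phi> (at ((s * t) *\<^sub>R (- e) + y)) e) = \<phi> y - \<phi> (t *\<^sub>R (- e) + y)"
proof -
  define F where "F s = - \<phi> (y + (s * t) *\<^sub>R (- e))" for s
  define f where "f s = t * frechet_derivative \<phi> (at (y + (s * t) *\<^sub>R (- e))) e" for s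
  have "(F has_real_derivative f s) (at s)" for s
  proof -
    have "((\<lambda>s. \<phi> (y + s *\<^sub>R ((- t) *\<^sub>R e))) has_real_derivative frechet_derivative \<phi> (at (y + s *\<^sub>R ((- t) *\<^sub>R e))) ((- t) *\<^sub>R e)) (at s)"
      by (rule test_function_ray_derivative[OF assms])
    moreover have "frechet_derivative \<phi> (at x) ((- t) *\<^sub>R e) = - t * frechet_derivative \<phi> (at x) e" for x
      using linear_cmul[OF has_derivative_linear[OF test_function_derivative[OF assms]], of _ "- t" e] by simp
    ultimately have "((\<lambda>s. \<phi> (y + (s * t) *\<^sub>R (- e))) has_real_derivative - f s) (at s)"
      by (simp add: f_def)
    from DERIV_minus[OF this] show ?thesis unfolding F_def by simp
  qed
  moreover have "continuous_on UNIV f"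
    unfolding f_def
    by (intro continuous_intros continuous_on_compose2[OF test_function_continuous(2)[OF assms]]) auto
  ultimately have "(LINT s|lborel. f s * indicator {0..1} s) = F 1 - F 0"
    by (intro integral_FTC_Icc_real) (auto simp: continuous_on_eq_continuous_at)
  then have "(LINT s|lborel. t * (indicator {0..1} s * frechet_derivative \<phi> (at ((s * t) *\<^sub>R (- e) + y)) e)) = \<phi> y - \<phi> (t *\<^sub>R (- e) + y)"
    by (simp add: f_def F_def ac_simps)
  then show ?thesis by simp
qed

text \<open>Both sides have the same integral against every test function: Fubini and the definition
  of the weak derivative move the averaged shift from \<open>g\<close> to \<open>\<phi>\<close>,
  where the fundamental theorem of calculus is classical.\<close>

lemma weak_dderiv_line_integral:
  fixes u g :: "'a::euclidean_space \<Rightarrow> real"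
  assumes w: "weak_dderiv e u g"
  shows "AE x in lborel. u (t *\<^sub>R e + x) - u x = t * (LINT s|lborel. indicator {0..1} s * g ((s * t) *\<^sub>R e + x))"
proof -
  have lu: "locint u" and lg: "locint g" using w by (auto simp: weak_dderiv_def)
  note [measurable] = locint_measurable[OF lu] locint_measurable[OF lg]
  define B where "B x = (LINT s|lborel. indicator {0..1} s * g ((s * t) *\<^sub>R e + x))" for x
  have Bm: "B \<in> borel_measurable borel" unfolding B_def by measurable
  have lB: "locint B"
  proof (rule locintI[OF Bm])
    fix r
    have [measurable]: "cball 0 r \<in> sets (borel :: 'a measure)" by simp
    have "integrable (lborel \<Otimes>\<^sub>M lborel) (\<lambda>(s, x). g ((s * t) *\<^sub>R e + x) * (indicator {0..1} s * indicator (cball 0 r) x))"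
      by (rule integrable_shear_product[OF lg, of _ 1 r]) (measurable, auto split: split_indicator)
    from lborel_pair.integrable_snd[OF this]
    show "integrable lborel (\<lambda>x. indicator (cball 0 r) x * B x)"
      unfolding B_def by (simp add: ac_simps flip: integral_mult_right_zero)
  qed
  have lu': "locint (\<lambda>x. u (t *\<^sub>R e + x))" using locint_affine[OF lu, of 1 "t *\<^sub>R e"] by simp
  have "AE x in lborel. u (t *\<^sub>R e + x) - u x - t * B x = 0"
  proof (rule AE_zero_if_test_integrals_zero)
    show "locint (\<lambda>x. u (t *\<^sub>R e + x) - u x - t * B x)"
      by (intro locint_diff lu' lu locint_cmult lB)
    fix \<phi> :: "'a \<Rightarrow> real" assume \<phi>: "test_function \<phi>"
    note c = test_function_continuous(1)[OF \<phi>] test_function_continuous(2)[OF \<phi>, of e]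
    have pm[measurable]: "\<phi> \<in> borel_measurable borel" "(\<lambda>x. frechet_derivative \<phi> (at x) e) \<in> borel_measurable borel"
      using c by (auto intro: borel_measurable_continuous_onI)
    have pm2[measurable]: "(\<lambda>p. frechet_derivative \<phi> (at ((fst p * t) *\<^sub>R (- e) + snd p)) e) \<in> borel_measurable (borel \<Otimes>\<^sub>M borel)"
      by (rule measurable_compose[OF _ pm(2)]) measurable
    obtain R C where RC: "C > 0" "\<forall>x. norm x > R \<longrightarrow> \<phi> x = 0 \<and> frechet_derivative \<phi> (at x) e = 0"
      "\<forall>x. \<bar>\<phi> x\<bar> \<le> C \<and> \<bar>frechet_derivative \<phi> (at x) e\<bar> \<le> C"
      using test_function_bounds[OF \<phi>, of e] by (elim exE conjE)
    have translate: "(LINT x|lborel. g (h + x) * \<phi> x) = - (LINT y|lborel. u y * frechet_derivative \<phi> (at (- h + y)) e)" for h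
    proof -
      have t: "test_function (\<lambda>y. \<phi> (- h + y))" "frechet_derivative (\<lambda>y. \<phi> (- h + y)) (at y) e = frechet_derivative \<phi> (at (- h + y)) e" for y
        using test_function_affine[OF \<phi>, of 1 "- h"] by simp_all
      have "(LINT x|lborel. g (h + x) * \<phi> x) = (LINT y|lborel. g y * \<phi> (- h + y))"
        using integral_translate[of "\<lambda>y. g y * \<phi> (- h + y)" h] by simp
      also have "\<dots> = - (LINT y|lborel. u y * frechet_derivative \<phi> (at (- h + y)) e)"
        using w t unfolding weak_dderiv_def by (metis (no_types, lifting) Bochner_Integration.integral_cong minus_minus)
      finally show ?thesis .
    qed
    have i1: "integrable (lborel \<Otimes>\<^sub>M lborel) (\<lambda>(s, x). g ((s * t) *\<^sub>R e + x) * (indicator {0..1} s * \<phi> x))"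
      by (rule integrable_shear_product[OF lg, of _ C R]) (use RC in \<open>auto split: split_indicator\<close>)
    \<comment> \<open>The shear lemma with \<open>t\<close> replaced by 0: here \<open>u\<close>
      stays in place and the shift sits in the kernel, whose support grows by at most
      \<open>\<bar>t\<bar> * norm e\<close>.\<close>
    have i2: "integrable (lborel \<Otimes>\<^sub>M lborel) (\<lambda>(s, x). u ((s * 0) *\<^sub>R e + x) * (indicator {0..1} s * frechet_derivative \<phi> (at ((s * t) *\<^sub>R (- e) + x)) e))"
    proof (rule integrable_shear_product[OF lu, of _ C "R + \<bar>t\<bar> * norm e"])
      fix s :: real and x :: 'a
      show "\<bar>indicator {0..1} s * frechet_derivative \<phi> (at ((s * t) *\<^sub>R (- e) + x)) e\<bar> \<le> C * indicator {0..1} s"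
        using RC by (auto split: split_indicator)
      assume x: "norm x > R + \<bar>t\<bar> * norm e"
      show "indicator {0..1} s * frechet_derivative \<phi> (at ((s * t) *\<^sub>R (- e) + x)) e = 0"
      proof (cases "s \<in> {0..1}")
        case True
        have "norm x \<le> norm ((s * t) *\<^sub>R (- e) + x) + norm ((s * t) *\<^sub>R e)"
          using norm_triangle_ineq[of "(s * t) *\<^sub>R (- e) + x" "(s * t) *\<^sub>R e"] by simp
        also have "norm ((s * t) *\<^sub>R e) \<le> \<bar>t\<bar> * norm e"
          using True by (simp add: abs_mult mult_left_le_one_le mult_right_mono)
        finally have "norm ((s * t) *\<^sub>R (- e) + x) > R" using x by simp
        then show ?thesis using RC(2) by simp
      qed simp
    qed (use pm2 in \<open>simp add: split_beta'\<close>)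
    have "(LINT x|lborel. B x * \<phi> x) = (LINT x|lborel. LINT s|lborel. g ((s * t) *\<^sub>R e + x) * (indicator {0..1} s * \<phi> x))"
      unfolding B_def by (simp add: ac_simps flip: integral_mult_right_zero)
    also have "\<dots> = (LINT s|lborel. LINT x|lborel. g ((s * t) *\<^sub>R e + x) * (indicator {0..1} s * \<phi> x))"
      by (rule lborel_pair.Fubini_integral[OF i1])
    also have "\<dots> = (LINT s|lborel. indicator {0..1} s * (LINT x|lborel. g ((s * t) *\<^sub>R e + x) * \<phi> x))"
      by (simp add: ac_simps flip: integral_mult_right_zero)
    also have "\<dots> = (LINT s|lborel. indicator {0..1} s * - (LINT y|lborel. u y * frechet_derivative \<phi> (at ((s * t) *\<^sub>R (- e) + y)) e))"
      by (simp add: translate)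
    also have "\<dots> = - (LINT s|lborel. LINT y|lborel. u y * (indicator {0..1} s * frechet_derivative \<phi> (at ((s * t) *\<^sub>R (- e) + y)) e))"
      by (simp add: ac_simps flip: integral_mult_right_zero)
    also have "(LINT s|lborel. LINT y|lborel. u y * (indicator {0..1} s * frechet_derivative \<phi> (at ((s * t) *\<^sub>R (- e) + y)) e))
      = (LINT y|lborel. LINT s|lborel. u y * (indicator {0..1} s * frechet_derivative \<phi> (at ((s * t) *\<^sub>R (- e) + y)) e))"
      using lborel_pair.Fubini_integral[OF i2] by simp
    finally have "t * (LINT x|lborel. B x * \<phi> x) =
      - (LINT y|lborel. u y * (t * (LINT s|lborel. indicator {0..1} s * frechet_derivative \<phi> (at ((s * t) *\<^sub>R (- e) + y)) e)))"
      by (simp add: mult.left_commute)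
    then have tB: "t * (LINT x|lborel. B x * \<phi> x) = - (LINT y|lborel. u y * (\<phi> y - \<phi> (t *\<^sub>R (- e) + y)))"
      by (simp only: test_function_increment[OF \<phi>])
    have tp: "test_function (\<lambda>y. \<phi> (t *\<^sub>R (- e) + y))" using test_function_affine(1)[OF \<phi>, of 1 "t *\<^sub>R (- e)"] by simp
    have ui: "integrable lborel (\<lambda>y. u y * \<phi> y)" "integrable lborel (\<lambda>y. u y * \<phi> (t *\<^sub>R (- e) + y))"
      "integrable lborel (\<lambda>y. u (t *\<^sub>R e + y) * \<phi> y)" "integrable lborel (\<lambda>y. B y * \<phi> y)"
      by (rule test_function_integrable(1)[OF lu \<phi>] test_function_integrable(1)[OF lu tp]
          test_function_integrable(1)[OF lu' \<phi>] test_function_integrable(1)[OF lB \<phi>])+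
    have "(LINT x|lborel. u (t *\<^sub>R e + x) * \<phi> x) = (LINT y|lborel. u y * \<phi> (t *\<^sub>R (- e) + y))"
      using integral_translate[of "\<lambda>y. u y * \<phi> (t *\<^sub>R (- e) + y)" "t *\<^sub>R e"] by simp
    moreover have "(LINT y|lborel. u y * (\<phi> y - \<phi> (t *\<^sub>R (- e) + y))) = (LINT y|lborel. u y * \<phi> y) - (LINT y|lborel. u y * \<phi> (t *\<^sub>R (- e) + y))"
      using ui by (simp add: right_diff_distrib)
    moreover have "(LINT x|lborel. (u (t *\<^sub>R e + x) - u x - t * B x) * \<phi> x) =
      (LINT x|lborel. u (t *\<^sub>R e + x) * \<phi> x) - (LINT x|lborel. u x * \<phi> x) - t * (LINT x|lborel. B x * \<phi> x)"
      using ui by (simp add: left_diff_distrib mult.assoc)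
    ultimately show "(LINT x|lborel. (u (t *\<^sub>R e + x) - u x - t * B x) * \<phi> x) = 0" using tB by simp
  qed
  then show ?thesis by (simp add: B_def)
qed

section \<open>Convergence of difference quotients\<close>

definition diff_quot :: "'a::euclidean_space \<Rightarrow> ('a \<Rightarrow> real) \<Rightarrow> real \<Rightarrow> 'a \<Rightarrow> real" where
  "diff_quot e u t x = (u (t *\<^sub>R e + x) - u x) / t"

text \<open>The nonnegative integral lets convergence be stated without carrying integrability of
  the differences along.\<close>

definition L1loc_tendsto :: "(nat \<Rightarrow> 'a::euclidean_space \<Rightarrow> real) \<Rightarrow> ('a \<Rightarrow> real) \<Rightarrow> bool" where
  "L1loc_tendsto F g \<longleftrightarrow>
     (\<forall>r. (\<lambda>n. \<integral>\<^sup>+x. ennreal \<bar>F n x - g x\<bar> * indicator (cball 0 r) x \<partial>lborel) \<longlonglongrightarrow> 0)"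

text \<open>By the line integral formula the error is the mean over \<open>s\<close> of
  \<open>g\<close> shifted by \<open>s t e\<close> minus \<open>g\<close>. For
  \<open>norm x \<le> r\<close> the shifted points stay in the ball of radius \<open>R\<close>, so
  \<open>g\<close> may be replaced by its cutoff \<open>f\<close>.\<close>

lemma diff_quot_L1_bound:
  fixes u g :: "'a::euclidean_space \<Rightarrow> real"
  assumes w: "weak_dderiv e u g" and t: "t \<noteq> 0" "r + \<bar>t\<bar> * norm e \<le> R"
  defines "f \<equiv> \<lambda>x. indicator (cball 0 R) x * g x"
  shows "(\<integral>\<^sup>+x. ennreal \<bar>diff_quot e u t x - g x\<bar> * indicator (cball 0 r) x \<partial>lborel) \<le>
    (\<integral>\<^sup>+s. indicator {0..1} s * (\<integral>\<^sup>+x. ennreal \<bar>f ((s * t) *\<^sub>R e + x) - f x\<bar> \<partial>lborel) \<partial>lborel)"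
proof -
  have lu: "locint u" and lg: "locint g" using w by (auto simp: weak_dderiv_def)
  note [measurable] = locint_measurable[OF lu] locint_measurable[OF lg]
  have cm[measurable]: "cball 0 R \<in> sets (borel :: 'a measure)" "cball 0 r \<in> sets (borel :: 'a measure)" by simp_all
  have fm[measurable]: "f \<in> borel_measurable borel" unfolding f_def by measurable
  have "integrable (lborel \<Otimes>\<^sub>M lborel) (\<lambda>(s, x). g ((s * t) *\<^sub>R e + x) * (indicator {0..1} s * indicator (cball 0 r) x))"
    by (rule integrable_shear_product[OF lg, of _ 1 r]) (measurable, auto split: split_indicator)
  then have AE1: "AE x in lborel. integrable lborel (\<lambda>s. g ((s * t) *\<^sub>R e + x) * (indicator {0..1} s * indicator (cball 0 r) x))"
    by (rule lborel_pair.AE_integrable_snd)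
  have "(\<integral>\<^sup>+x. ennreal \<bar>diff_quot e u t x - g x\<bar> * indicator (cball 0 r) x \<partial>lborel) \<le>
    (\<integral>\<^sup>+x. \<integral>\<^sup>+s. indicator {0..1} s * ennreal \<bar>f ((s * t) *\<^sub>R e + x) - f x\<bar> \<partial>lborel \<partial>lborel)"
  proof (rule nn_integral_mono_AE)
    show "AE x in lborel. ennreal \<bar>diff_quot e u t x - g x\<bar> * indicator (cball 0 r) x \<le>
      (\<integral>\<^sup>+s. indicator {0..1} s * ennreal \<bar>f ((s * t) *\<^sub>R e + x) - f x\<bar> \<partial>lborel)"
      using AE1 weak_dderiv_line_integral[OF w, of t]
    proof eventually_elim
      case (elim x)
      show ?case
      proof (cases "x \<in> cball 0 r")
        case True
        have i: "integrable lborel (\<lambda>s. indicator {0..1} s * g ((s * t) *\<^sub>R e + x))"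
          using elim(1) True by (simp add: mult.commute)
        have i2: "integrable lborel (\<lambda>s::real. indicator {0..1} s * g x)" by simp
        have feq: "f ((s * t) *\<^sub>R e + x) = g ((s * t) *\<^sub>R e + x)" if "s \<in> {0..1}" for s
        proof -
          have "norm ((s * t) *\<^sub>R e + x) \<le> \<bar>s * t\<bar> * norm e + norm x"
            using norm_triangle_ineq[of "(s * t) *\<^sub>R e" x] by simp
          also have "\<bar>s * t\<bar> * norm e \<le> \<bar>t\<bar> * norm e"
            using that by (intro mult_right_mono) (auto simp: abs_mult mult_left_le_one_le)
          finally show ?thesis using True t(2) by (simp add: f_def)
        qed
        have "diff_quot e u t x - g x = (LINT s|lborel. indicator {0..1} s * g ((s * t) *\<^sub>R e + x)) - (LINT s|lborel. indicator {0..1::real} s * g x)"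
          using elim(2) t(1) by (simp add: diff_quot_def)
        also have "\<dots> = (LINT s|lborel. indicator {0..1} s * g ((s * t) *\<^sub>R e + x) - indicator {0..1} s * g x)"
          using i i2 by simp
        finally have "ennreal \<bar>diff_quot e u t x - g x\<bar> \<le>
          (\<integral>\<^sup>+s. ennreal (norm (indicator {0..1} s * g ((s * t) *\<^sub>R e + x) - indicator {0..1} s * g x)) \<partial>lborel)"
          using integral_norm_bound_ennreal[OF Bochner_Integration.integrable_diff[OF i i2]] by simp
        also have "\<dots> = (\<integral>\<^sup>+s. indicator {0..1} s * ennreal \<bar>f ((s * t) *\<^sub>R e + x) - f x\<bar> \<partial>lborel)"
        proof (rule nn_integral_cong)
          fix s :: real
          show "ennreal (norm (indicator {0..1} s * g ((s * t) *\<^sub>R e + x) - indicator {0..1} s * g x)) =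
            indicator {0..1} s * ennreal \<bar>f ((s * t) *\<^sub>R e + x) - f x\<bar>"
            using feq[of s] feq[of 0] by (cases "s \<in> {0..1}") simp_all
        qed
        finally show ?thesis using True by simp
      qed simp
    qed
  qed
  also have "\<dots> = (\<integral>\<^sup>+s. \<integral>\<^sup>+x. indicator {0..1} s * ennreal \<bar>f ((s * t) *\<^sub>R e + x) - f x\<bar> \<partial>lborel \<partial>lborel)"
    by (rule lborel_pair.Fubini') measurable
  also have "\<dots> = (\<integral>\<^sup>+s. indicator {0..1} s * (\<integral>\<^sup>+x. ennreal \<bar>f ((s * t) *\<^sub>R e + x) - f x\<bar> \<partial>lborel) \<partial>lborel)"
    by (intro nn_integral_cong nn_integral_cmult) measurable
  finally show ?thesis .
qed

lemma weak_dderiv_diff_quot_tendsto: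
  fixes u g :: "'a::euclidean_space \<Rightarrow> real"
  assumes w: "weak_dderiv e u g" and t: "t \<longlonglongrightarrow> 0" "\<And>n. t n \<noteq> 0"
  shows "L1loc_tendsto (\<lambda>n. diff_quot e u (t n)) g"
  unfolding L1loc_tendsto_def
proof
  fix r
  have lg: "locint g" using w by (auto simp: weak_dderiv_def)
  have "Bseq t" using t(1) by (intro convergent_imp_Bseq convergentI)
  then obtain T where T: "\<And>n. \<bar>t n\<bar> \<le> T" by (auto simp: Bseq_def)
  define R where "R = r + T * norm e"
  define f where "f x = indicator (cball 0 R) x * g x" for x
  have cm[measurable]: "cball 0 R \<in> sets (borel :: 'a measure)" by simp
  note [measurable] = locint_measurable[OF lg]
  have fm[measurable]: "f \<in> borel_measurable borel" unfolding f_def[abs_def] by measurable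
  have fi: "integrable lborel f" using locint_integrable_cball[OF lg, of R] by (simp add: f_def[abs_def])
  define W where "W n s = (LINT x|lborel. \<bar>f ((s * t n) *\<^sub>R e + x) - f x\<bar>)" for n and s :: real
  have Wm[measurable]: "W n \<in> borel_measurable borel" for n unfolding W_def[abs_def] by measurable
  have fti: "integrable lborel (\<lambda>x. f ((s * t n) *\<^sub>R e + x))" for s n by (rule integrable_translate[OF fi])
  \<comment> \<open>Twice the L^1 norm of the cutoff bounds every translation error; together with
    convergence for each \<open>s\<close> this is what dominated convergence over the unit interval
    needs.\<close>
  define K where "K = 2 * (LINT x|lborel. \<bar>f x\<bar>)"
  have Wb: "0 \<le> W n s \<and> W n s \<le> K" for n s
  proof -
    have "W n s \<le> (LINT x|lborel. \<bar>f ((s * t n) *\<^sub>R e + x)\<bar> + \<bar>f x\<bar>)"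
      unfolding W_def by (intro integral_mono) (use fi fti in auto)
    also have "\<dots> = K"
      using fi fti integral_translate[of "\<lambda>x. \<bar>f x\<bar>" "(s * t n) *\<^sub>R e"] by (simp add: K_def)
    finally show ?thesis by (simp add: W_def)
  qed
  have Wlim: "(\<lambda>n. W n s) \<longlonglongrightarrow> 0" for s
  proof -
    have "(\<lambda>n. (s * t n) *\<^sub>R e) \<longlonglongrightarrow> (s * 0) *\<^sub>R e" by (intro tendsto_intros t)
    then show ?thesis
      using L1_translation_continuous_integrable[OF fi] by (simp add: L1_translation_continuous_def W_def)
  qed
  have lim: "(\<lambda>n. LINT s|lborel. indicator {0..1} s * W n s) \<longlonglongrightarrow> (LINT s|(lborel::real measure). 0)"
  proof (rule integral_dominated_convergence[where w = "\<lambda>s. indicator {0..1} s * K"])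
    have "(\<lambda>n. indicator {0..1} s * W n s) \<longlonglongrightarrow> indicator {0..1} s * 0" for s
      by (intro tendsto_mult tendsto_const Wlim)
    then show "AE s in lborel. (\<lambda>n. indicator {0..1} s * W n s) \<longlonglongrightarrow> 0" by simp
    show "AE s in lborel. norm (indicator {0..1} s * W n s) \<le> indicator {0..1} s * K" for n
      using Wb[of n] by (auto split: split_indicator)
    show "(\<lambda>s. indicator {0..1} s * W n s) \<in> borel_measurable lborel" for n by measurable
  qed simp_all
  have Wint: "integrable lborel (\<lambda>s. indicator {0..1} s * W n s)" for n
    by (rule Bochner_Integration.integrable_bound[of _ "\<lambda>s. indicator {0..1} s * K"])
      (use Wb[of n] order_trans[OF _ abs_ge_self] in \<open>auto split: split_indicator intro!: AE_I2\<close>)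
  have le: "(\<integral>\<^sup>+x. ennreal \<bar>diff_quot e u (t n) x - g x\<bar> * indicator (cball 0 r) x \<partial>lborel) \<le>
      ennreal (LINT s|lborel. indicator {0..1} s * W n s)" for n
  proof -
    have "(\<integral>\<^sup>+x. ennreal \<bar>diff_quot e u (t n) x - g x\<bar> * indicator (cball 0 r) x \<partial>lborel) \<le>
      (\<integral>\<^sup>+s. indicator {0..1} s * (\<integral>\<^sup>+x. ennreal \<bar>f ((s * t n) *\<^sub>R e + x) - f x\<bar> \<partial>lborel) \<partial>lborel)"
      unfolding f_def
      by (rule diff_quot_L1_bound[OF w t(2)]) (use T[of n] in \<open>simp add: R_def mult_right_mono\<close>)
    also have "\<dots> = (\<integral>\<^sup>+s. ennreal (indicator {0..1} s * W n s) \<partial>lborel)"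
    proof (rule nn_integral_cong)
      fix s :: real
      have "(\<integral>\<^sup>+x. ennreal \<bar>f ((s * t n) *\<^sub>R e + x) - f x\<bar> \<partial>lborel) = ennreal (W n s)"
        unfolding W_def by (rule nn_integral_eq_integral) (use fi fti in auto)
      then show "indicator {0..1} s * (\<integral>\<^sup>+x. ennreal \<bar>f ((s * t n) *\<^sub>R e + x) - f x\<bar> \<partial>lborel) = ennreal (indicator {0..1} s * W n s)"
        by (cases "s \<in> {0..1}") simp_all
    qed
    also have "\<dots> = ennreal (LINT s|lborel. indicator {0..1} s * W n s)"
      by (rule nn_integral_eq_integral[OF Wint]) (use Wb[of n] in auto)
    finally show ?thesis .
  qed
  have "(\<lambda>n. ennreal (LINT s|lborel. indicator {0..1} s * W n s)) \<longlonglongrightarrow> ennreal 0"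
    using lim by (intro tendsto_ennrealI) simp
  then have lim': "(\<lambda>n. ennreal (LINT s|lborel. indicator {0..1} s * W n s)) \<longlonglongrightarrow> 0" by simp
  show "(\<lambda>n. \<integral>\<^sup>+x. ennreal \<bar>diff_quot e u (t n) x - g x\<bar> * indicator (cball 0 r) x \<partial>lborel) \<longlonglongrightarrow> 0"
    by (rule tendsto_sandwich[OF _ _ tendsto_const lim']) (use le in auto)
qed

lemma test_function_lipschitz_ray:
  assumes "test_function \<phi>" "\<And>x. \<bar>frechet_derivative \<phi> (at x) e\<bar> \<le> C"
  shows "\<bar>\<phi> (y + s *\<^sub>R e) - \<phi> y\<bar> \<le> C * \<bar>s\<bar>"
  using field_differentiable_bound[of UNIV "\<lambda>s. \<phi> (y + s *\<^sub>R e)" "\<lambda>s. frechet_derivative \<phi> (at (y + s *\<^sub>R e)) e" C s 0]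
    test_function_ray_derivative[OF assms(1), of y e] assms(2)
  by simp

text \<open>Discrete integration by parts: a translation moves the difference quotient from
  \<open>u\<close> to \<open>\<phi>\<close>, where it converges boundedly to minus the classical
  derivative. Convergence along a single sequence is enough, so sequences may be selected freely
  later on.\<close>

lemma weak_dderivI:
  fixes u g :: "'a::euclidean_space \<Rightarrow> real"
  assumes lu: "locint u" and lg: "locint g" and t: "t \<longlonglongrightarrow> 0" "\<And>n. t n \<noteq> 0"
    and L: "L1loc_tendsto (\<lambda>n. diff_quot e u (t n)) g"
  shows "weak_dderiv e u g"
  unfolding weak_dderiv_def
proof (intro conjI allI impI lu lg)
  note [measurable] = locint_measurable[OF lu] locint_measurable[OF lg]
  fix \<phi> :: "'a \<Rightarrow> real" assume \<phi>: "test_function \<phi>"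
  note c = test_function_continuous(1)[OF \<phi>] test_function_continuous(2)[OF \<phi>, of e]
  have pm[measurable]: "\<phi> \<in> borel_measurable borel" "(\<lambda>x. frechet_derivative \<phi> (at x) e) \<in> borel_measurable borel"
    using c by (auto intro: borel_measurable_continuous_onI)
  obtain R C where RC: "C > 0" "\<forall>x. norm x > R \<longrightarrow> \<phi> x = 0 \<and> frechet_derivative \<phi> (at x) e = 0"
    "\<forall>x. \<bar>\<phi> x\<bar> \<le> C \<and> \<bar>frechet_derivative \<phi> (at x) e\<bar> \<le> C"
    using test_function_bounds[OF \<phi>, of e] by (elim exE conjE)
  have cm[measurable]: "cball 0 R \<in> sets (borel :: 'a measure)" by simp
  have ldq: "locint (diff_quot e u (t n))" for n
  proof -
    have "locint (\<lambda>x. (1 / t n) * (u (t n *\<^sub>R e + x) - u x))"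
      using locint_affine[OF lu, of 1 "t n *\<^sub>R e"] by (intro locint_cmult locint_diff lu) simp
    then show ?thesis by (simp add: diff_quot_def[abs_def])
  qed
  note [measurable] = locint_measurable[OF ldq]
  have lim1: "(\<lambda>n. LINT x|lborel. diff_quot e u (t n) x * \<phi> x) \<longlonglongrightarrow> (LINT x|lborel. g x * \<phi> x)"
  proof -
    have b: "ennreal \<bar>(LINT x|lborel. diff_quot e u (t n) x * \<phi> x) - (LINT x|lborel. g x * \<phi> x)\<bar> \<le>
        ennreal C * (\<integral>\<^sup>+x. ennreal \<bar>diff_quot e u (t n) x - g x\<bar> * indicator (cball 0 R) x \<partial>lborel)" for n
    proof -
      have i: "integrable lborel (\<lambda>x. diff_quot e u (t n) x * \<phi> x)" "integrable lborel (\<lambda>x. g x * \<phi> x)"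
        by (rule test_function_integrable(1)[OF ldq \<phi>] test_function_integrable(1)[OF lg \<phi>])+
      have "ennreal \<bar>(LINT x|lborel. diff_quot e u (t n) x * \<phi> x) - (LINT x|lborel. g x * \<phi> x)\<bar>
        = ennreal (norm (LINT x|lborel. diff_quot e u (t n) x * \<phi> x - g x * \<phi> x))"
        using i by simp
      also have "\<dots> \<le> (\<integral>\<^sup>+x. ennreal (norm (diff_quot e u (t n) x * \<phi> x - g x * \<phi> x)) \<partial>lborel)"
        using i by (intro integral_norm_bound_ennreal) simp
      also have "\<dots> \<le> (\<integral>\<^sup>+x. ennreal C * (ennreal \<bar>diff_quot e u (t n) x - g x\<bar> * indicator (cball 0 R) x) \<partial>lborel)"
      proof (rule nn_integral_mono)
        fix x
        show "ennreal (norm (diff_quot e u (t n) x * \<phi> x - g x * \<phi> x)) \<le> ennreal C * (ennreal \<bar>diff_quot e u (t n) x - g x\<bar> * indicator (cball 0 R) x)"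
        proof (cases "norm x \<le> R")
          case True
          have "norm (diff_quot e u (t n) x * \<phi> x - g x * \<phi> x) = \<bar>\<phi> x\<bar> * \<bar>diff_quot e u (t n) x - g x\<bar>"
            by (simp add: abs_mult[symmetric] algebra_simps)
          also have "\<dots> \<le> C * \<bar>diff_quot e u (t n) x - g x\<bar>" using RC(3) by (intro mult_right_mono) auto
          finally show ?thesis using True RC(1) by (simp add: ennreal_mult[symmetric] ennreal_leI)
        qed (use RC(2) in auto)
      qed
      also have "\<dots> = ennreal C * (\<integral>\<^sup>+x. ennreal \<bar>diff_quot e u (t n) x - g x\<bar> * indicator (cball 0 R) x \<partial>lborel)"
        by (rule nn_integral_cmult) measurable
      finally show ?thesis .
    qed
    have "(\<lambda>n. ennreal C * (\<integral>\<^sup>+x. ennreal \<bar>diff_quot e u (t n) x - g x\<bar> * indicator (cball 0 R) x \<partial>lborel)) \<longlonglongrightarrow> ennreal C * 0"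
      using L by (intro ennreal_tendsto_cmult) (auto simp: L1loc_tendsto_def)
    then have l: "(\<lambda>n. ennreal C * (\<integral>\<^sup>+x. ennreal \<bar>diff_quot e u (t n) x - g x\<bar> * indicator (cball 0 R) x \<partial>lborel)) \<longlonglongrightarrow> 0" by simp
    have "(\<lambda>n. ennreal \<bar>(LINT x|lborel. diff_quot e u (t n) x * \<phi> x) - (LINT x|lborel. g x * \<phi> x)\<bar>) \<longlonglongrightarrow> 0"
      by (rule tendsto_sandwich[OF _ _ tendsto_const l]) (use b in auto)
    then have "(\<lambda>n. \<bar>(LINT x|lborel. diff_quot e u (t n) x * \<phi> x) - (LINT x|lborel. g x * \<phi> x)\<bar>) \<longlonglongrightarrow> 0"
      by (simp add: tendsto_ennreal_iff flip: ennreal_0)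
    then show ?thesis by (simp add: tendsto_rabs_zero_iff LIM_zero_iff)
  qed
  have "Bseq t" using t(1) by (intro convergent_imp_Bseq convergentI)
  then obtain T where T: "T > 0" "\<And>n. \<bar>t n\<bar> \<le> T" by (auto simp: Bseq_def)
  \<comment> \<open>Outside this ball both \<open>\<phi> y\<close> and its shifted values vanish,
    because no shift is longer than \<open>T * norm e\<close>.\<close>
  define R' where "R' = R + T * norm e"
  have dqeq: "(LINT x|lborel. diff_quot e u (t n) x * \<phi> x) = (LINT y|lborel. u y * ((\<phi> (y + (- t n) *\<^sub>R e) - \<phi> y) / t n))" for n
  proof -
    have tp: "test_function (\<lambda>y. \<phi> (y + (- t n) *\<^sub>R e))"
      using test_function_affine(1)[OF \<phi>, of 1 "(- t n) *\<^sub>R e"] by (simp add: add.commute)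
    have lu': "locint (\<lambda>x. u (t n *\<^sub>R e + x))" using locint_affine[OF lu, of 1 "t n *\<^sub>R e"] by simp
    have i: "integrable lborel (\<lambda>x. u (t n *\<^sub>R e + x) * \<phi> x)" "integrable lborel (\<lambda>x. u x * \<phi> x)"
      "integrable lborel (\<lambda>y. u y * \<phi> (y + (- t n) *\<^sub>R e))"
      by (rule test_function_integrable(1)[OF lu' \<phi>] test_function_integrable(1)[OF lu \<phi>] test_function_integrable(1)[OF lu tp])+
    have "(LINT x|lborel. diff_quot e u (t n) x * \<phi> x) = (LINT x|lborel. (u (t n *\<^sub>R e + x) * \<phi> x - u x * \<phi> x) / t n)"
      by (simp add: diff_quot_def algebra_simps)
    also have "\<dots> = ((LINT x|lborel. u (t n *\<^sub>R e + x) * \<phi> x) - (LINT x|lborel. u x * \<phi> x)) / t n"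
      using i by simp
    also have "(LINT x|lborel. u (t n *\<^sub>R e + x) * \<phi> x) = (LINT y|lborel. u y * \<phi> (y + (- t n) *\<^sub>R e))"
      using integral_translate[of "\<lambda>y. u y * \<phi> (y + (- t n) *\<^sub>R e)" "t n *\<^sub>R e"] by simp
    also have "((LINT y|lborel. u y * \<phi> (y + (- t n) *\<^sub>R e)) - (LINT x|lborel. u x * \<phi> x)) / t n
      = (LINT y|lborel. (u y * \<phi> (y + (- t n) *\<^sub>R e) - u y * \<phi> y) / t n)"
      using i by simp
    finally show ?thesis by (simp add: right_diff_distrib)
  qed
  have lim2: "(\<lambda>n. LINT y|lborel. u y * ((\<phi> (y + (- t n) *\<^sub>R e) - \<phi> y) / t n)) \<longlonglongrightarrow> (LINT y|lborel. u y * - frechet_derivative \<phi> (at y) e)"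
  proof (rule integral_dominated_convergence[where w = "\<lambda>y. C * \<bar>indicator (cball 0 R') y * u y\<bar>"])
    show "integrable lborel (\<lambda>y. C * \<bar>indicator (cball 0 R') y * u y\<bar>)"
      by (intro integrable_mult_right integrable_abs locint_integrable_cball lu)
    have "(\<lambda>n. u y * ((\<phi> (y + (- t n) *\<^sub>R e) - \<phi> y) / t n)) \<longlonglongrightarrow> u y * - frechet_derivative \<phi> (at y) e" for y
    proof -
      have "((\<lambda>s. (\<phi> (y + s *\<^sub>R e) - \<phi> y) / s) \<longlongrightarrow> frechet_derivative \<phi> (at y) e) (at 0)"
        using test_function_ray_derivative[OF \<phi>, of y e 0] by (simp add: has_field_derivative_iff)
      moreover have "filterlim (\<lambda>n. - t n) (at 0) sequentially"
        using t tendsto_minus[OF t(1)] by (intro filterlim_atI) auto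
      ultimately have "(\<lambda>n. (\<phi> (y + (- t n) *\<^sub>R e) - \<phi> y) / (- t n)) \<longlonglongrightarrow> frechet_derivative \<phi> (at y) e"
        by (rule filterlim_compose)
      from tendsto_minus[OF this] have "(\<lambda>n. (\<phi> (y + (- t n) *\<^sub>R e) - \<phi> y) / t n) \<longlonglongrightarrow> - frechet_derivative \<phi> (at y) e"
        by simp
      then show ?thesis by (intro tendsto_mult tendsto_const)
    qed
    then show "AE y in lborel. (\<lambda>n. u y * ((\<phi> (y + (- t n) *\<^sub>R e) - \<phi> y) / t n)) \<longlonglongrightarrow> u y * - frechet_derivative \<phi> (at y) e"
      by simp
    show "AE y in lborel. norm (u y * ((\<phi> (y + (- t n) *\<^sub>R e) - \<phi> y) / t n)) \<le> C * \<bar>indicator (cball 0 R') y * u y\<bar>" for n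
    proof (rule AE_I2)
      fix y
      show "norm (u y * ((\<phi> (y + (- t n) *\<^sub>R e) - \<phi> y) / t n)) \<le> C * \<bar>indicator (cball 0 R') y * u y\<bar>"
      proof (cases "norm y \<le> R'")
        case True
        have "\<bar>\<phi> (y + (- t n) *\<^sub>R e) - \<phi> y\<bar> \<le> C * \<bar>- t n\<bar>"
          using RC(3) by (intro test_function_lipschitz_ray[OF \<phi>]) auto
        then have "\<bar>(\<phi> (y + (- t n) *\<^sub>R e) - \<phi> y) / t n\<bar> \<le> C"
          using t(2)[of n] by (simp add: field_simps)
        then have "\<bar>u y\<bar> * \<bar>(\<phi> (y + (- t n) *\<^sub>R e) - \<phi> y) / t n\<bar> \<le> \<bar>u y\<bar> * C"
          by (intro mult_left_mono) auto
        then show ?thesis using True by (simp add: abs_mult mult.commute)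
      next
        case False
        have "norm y \<le> norm (y + (- t n) *\<^sub>R e) + norm (t n *\<^sub>R e)"
          using norm_triangle_ineq[of "y + (- t n) *\<^sub>R e" "t n *\<^sub>R e"] by simp
        also have "norm (t n *\<^sub>R e) \<le> T * norm e" using T(2)[of n] by (simp add: mult_right_mono)
        finally have "norm (y + (- t n) *\<^sub>R e) > R" using False by (simp add: R'_def)
        moreover have "norm y > R" using False T(1) by (smt (verit) R'_def mult_nonneg_nonneg norm_ge_zero)
        ultimately show ?thesis using RC(1,2) by simp
      qed
    qed
  qed measurable
  have "(LINT y|lborel. u y * - frechet_derivative \<phi> (at y) e) = (LINT x|lborel. g x * \<phi> x)"
    using lim1 lim2 unfolding dqeq by (rule LIMSEQ_unique[rotated])
  then show "(LINT x|lborel. u x * frechet_derivative \<phi> (at x) e) = - (LINT x|lborel. g x * \<phi> x)"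
    by simp
qed

section \<open>A chain rule for Lipschitz functions\<close>

text \<open>The series of the integrals converges, so almost everywhere the series of the integrands
  is finite and its terms tend to zero. The balls may grow with \<open>n\<close>, since every point
  lies in all but finitely many of them.\<close>

lemma AE_tendsto_0_if_summable_L1loc:
  fixes F :: "nat \<Rightarrow> 'a::euclidean_space \<Rightarrow> real"
  assumes m[measurable]: "\<And>n. F n \<in> borel_measurable borel"
    and b: "\<And>n. (\<integral>\<^sup>+x. ennreal \<bar>F n x\<bar> * indicator (cball 0 (real n)) x \<partial>lborel) \<le> ennreal ((1/2) ^ n)"
  shows "AE x in lborel. (\<lambda>n. F n x) \<longlonglongrightarrow> 0"
proof -
  have [measurable]: "cball 0 (real n) \<in> sets (borel :: 'a measure)" for n by simp
  have "(\<integral>\<^sup>+x. (\<Sum>n. ennreal (\<bar>F n x\<bar> * indicator (cball 0 (real n)) x)) \<partial>lborel) =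
     (\<Sum>n. \<integral>\<^sup>+x. ennreal (\<bar>F n x\<bar> * indicator (cball 0 (real n)) x) \<partial>lborel)"
    by (rule nn_integral_suminf) measurable
  also have "\<dots> \<le> (\<Sum>n. ennreal ((1/2) ^ n))"
  proof (rule suminf_le)
    fix n
    have "(\<integral>\<^sup>+x. ennreal (\<bar>F n x\<bar> * indicator (cball 0 (real n)) x) \<partial>lborel) =
      (\<integral>\<^sup>+x. ennreal \<bar>F n x\<bar> * indicator (cball 0 (real n)) x \<partial>lborel)"
      by (rule nn_integral_cong) (auto split: split_indicator)
    then show "(\<integral>\<^sup>+x. ennreal (\<bar>F n x\<bar> * indicator (cball 0 (real n)) x) \<partial>lborel) \<le> ennreal ((1/2) ^ n)"
      using b[of n] by simp
  qed auto
  also have "\<dots> = ennreal (\<Sum>n. (1/2) ^ n)"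
    by (rule suminf_ennreal2) (auto intro: summable_geometric)
  also have "\<dots> < \<infinity>" by simp
  finally have "AE x in lborel. (\<Sum>n. ennreal (\<bar>F n x\<bar> * indicator (cball 0 (real n)) x)) \<noteq> \<infinity>"
    by (intro nn_integral_PInf_AE) auto
  then show ?thesis
  proof eventually_elim
    case (elim x)
    then have "summable (\<lambda>n. \<bar>F n x\<bar> * indicator (cball 0 (real n)) x)"
      by (intro summable_suminf_not_top) auto
    then have lim: "(\<lambda>n. \<bar>F n x\<bar> * indicator (cball 0 (real n)) x) \<longlonglongrightarrow> 0"
      by (rule summable_LIMSEQ_zero)
    obtain N where N: "norm x \<le> real N" using real_arch_simple by blast
    have "\<forall>\<^sub>F n in sequentially. \<bar>F n x\<bar> * indicator (cball 0 (real n)) x = \<bar>F n x\<bar>"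
      unfolding eventually_sequentially
      by (rule exI[of _ N]) (use N in auto)
    then have "(\<lambda>n. \<bar>F n x\<bar>) \<longlonglongrightarrow> 0" by (rule Lim_transform_eventually[OF lim])
    then show ?case by (simp add: tendsto_rabs_zero_iff)
  qed
qed

text \<open>The \<open>n\<close>-th index is taken so large that the L^1 errors of both quotients on
  the ball of radius \<open>n\<close> are at most \<open>(1/2) ^ n\<close>. One sequence serves
  \<open>u\<close> and \<open>v\<close>, and its sign is that of \<open>\<sigma>\<close>, so
  one-sided limits can be selected.\<close>

lemma weak_dderiv_AE_sequence:
  fixes u v :: "'a::euclidean_space \<Rightarrow> real"
  assumes u: "weak_dderiv e u g" and v: "weak_dderiv e v h" and s: "\<sigma> \<noteq> 0"
  shows "\<exists>t. t \<longlonglongrightarrow> 0 \<and> (\<forall>n. 0 < \<sigma> * t n) \<and>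
    (AE x in lborel. (\<lambda>n. diff_quot e u (t n) x) \<longlonglongrightarrow> g x) \<and> (AE x in lborel. (\<lambda>n. diff_quot e v (t n) x) \<longlonglongrightarrow> h x)"
proof -
  have l: "locint u" "locint g" "locint v" "locint h" using u v by (auto simp: weak_dderiv_def)
  note [measurable] = l[THEN locint_measurable]
  have [measurable]: "diff_quot e f t \<in> borel_measurable borel" if "f \<in> borel_measurable borel" for f t
    unfolding diff_quot_def[abs_def] using that by measurable
  define \<tau> where "\<tau> n = \<sigma> / real (Suc n)" for n
  have \<tau>: "\<tau> \<longlonglongrightarrow> 0"
    using tendsto_mult[OF tendsto_const[of \<sigma>] LIMSEQ_inverse_real_of_nat] by (simp add: \<tau>_def[abs_def] divide_inverse)
  have \<tau>0: "\<tau> n \<noteq> 0" for n using s by (simp add: \<tau>_def)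
  have \<tau>s: "0 < \<sigma> * \<tau> n" for n
  proof -
    have "0 < \<sigma> * \<sigma> / real (Suc n)" using s by (intro divide_pos_pos) (auto simp: zero_less_mult_iff linorder_neq_iff)
    then show ?thesis by (simp add: \<tau>_def)
  qed
  have ex: "\<exists>k\<ge>n. (\<integral>\<^sup>+x. ennreal \<bar>diff_quot e u (\<tau> k) x - g x\<bar> * indicator (cball 0 (real n)) x \<partial>lborel) \<le> ennreal ((1/2) ^ n)
     \<and> (\<integral>\<^sup>+x. ennreal \<bar>diff_quot e v (\<tau> k) x - h x\<bar> * indicator (cball 0 (real n)) x \<partial>lborel) \<le> ennreal ((1/2) ^ n)" for n
  proof -
    have p: "(0::ennreal) < ennreal ((1/2) ^ n)" by simp
    have "\<forall>\<^sub>F k in sequentially. (\<integral>\<^sup>+x. ennreal \<bar>diff_quot e u (\<tau> k) x - g x\<bar> * indicator (cball 0 (real n)) x \<partial>lborel) < ennreal ((1/2) ^ n)"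
      by (rule order_tendstoD(2)[OF _ p])
        (use weak_dderiv_diff_quot_tendsto[OF u \<tau> \<tau>0] in \<open>simp add: L1loc_tendsto_def\<close>)
    moreover have "\<forall>\<^sub>F k in sequentially. (\<integral>\<^sup>+x. ennreal \<bar>diff_quot e v (\<tau> k) x - h x\<bar> * indicator (cball 0 (real n)) x \<partial>lborel) < ennreal ((1/2) ^ n)"
      by (rule order_tendstoD(2)[OF _ p])
        (use weak_dderiv_diff_quot_tendsto[OF v \<tau> \<tau>0] in \<open>simp add: L1loc_tendsto_def\<close>)
    moreover have "\<forall>\<^sub>F k in sequentially. k \<ge> n" by (rule eventually_ge_at_top)
    ultimately have "\<forall>\<^sub>F k in sequentially. k \<ge> n \<and> (\<integral>\<^sup>+x. ennreal \<bar>diff_quot e u (\<tau> k) x - g x\<bar> * indicator (cball 0 (real n)) x \<partial>lborel) \<le> ennreal ((1/2) ^ n)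
     \<and> (\<integral>\<^sup>+x. ennreal \<bar>diff_quot e v (\<tau> k) x - h x\<bar> * indicator (cball 0 (real n)) x \<partial>lborel) \<le> ennreal ((1/2) ^ n)"
      by eventually_elim (simp add: less_imp_le)
    from eventually_happens[OF this] show ?thesis by simp
  qed
  have "\<forall>n. \<exists>k. k \<ge> n \<and> (\<integral>\<^sup>+x. ennreal \<bar>diff_quot e u (\<tau> k) x - g x\<bar> * indicator (cball 0 (real n)) x \<partial>lborel) \<le> ennreal ((1/2) ^ n)
     \<and> (\<integral>\<^sup>+x. ennreal \<bar>diff_quot e v (\<tau> k) x - h x\<bar> * indicator (cball 0 (real n)) x \<partial>lborel) \<le> ennreal ((1/2) ^ n)"
    by (intro allI ex)
  from choice[OF this] obtain k where k: "\<forall>n. k n \<ge> n \<and> (\<integral>\<^sup>+x. ennreal \<bar>diff_quot e u (\<tau> (k n)) x - g x\<bar> * indicator (cball 0 (real n)) x \<partial>lborel) \<le> ennreal ((1/2) ^ n)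
     \<and> (\<integral>\<^sup>+x. ennreal \<bar>diff_quot e v (\<tau> (k n)) x - h x\<bar> * indicator (cball 0 (real n)) x \<partial>lborel) \<le> ennreal ((1/2) ^ n)"
    by (elim exE)
  have "filterlim k at_top sequentially"
    by (rule filterlim_at_top_mono[OF filterlim_ident]) (use k in auto)
  then have "(\<lambda>n. \<tau> (k n)) \<longlonglongrightarrow> 0" by (rule filterlim_compose[OF \<tau>])
  moreover have "AE x in lborel. (\<lambda>n. diff_quot e u (\<tau> (k n)) x - g x) \<longlonglongrightarrow> 0"
    by (rule AE_tendsto_0_if_summable_L1loc) (use k in \<open>measurable, auto\<close>)
  then have "AE x in lborel. (\<lambda>n. diff_quot e u (\<tau> (k n)) x) \<longlonglongrightarrow> g x"
    by (simp add: LIM_zero_iff)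
  moreover have "AE x in lborel. (\<lambda>n. diff_quot e v (\<tau> (k n)) x - h x) \<longlonglongrightarrow> 0"
    by (rule AE_tendsto_0_if_summable_L1loc) (use k in \<open>measurable, auto\<close>)
  then have "AE x in lborel. (\<lambda>n. diff_quot e v (\<tau> (k n)) x) \<longlonglongrightarrow> h x"
    by (simp add: LIM_zero_iff)
  ultimately show ?thesis using \<tau>s by (intro exI[of _ "\<lambda>n. \<tau> (k n)"]) simp
qed

text \<open>No differentiability of \<open>F\<close> is required: only the existence of the limit of the difference
  quotients along one-sided sequences, as selected by the sign of \<open>\<sigma>\<close>. Domination in \<open>L\<^sup>1\<close> comes
  from the Lipschitz bound.\<close>
lemma weak_dderiv_chain:
  fixes u v :: "'a::euclidean_space \<Rightarrow> real" and F :: "real \<Rightarrow> real \<Rightarrow> real"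
  assumes u: "weak_dderiv e u g" and v: "weak_dderiv e v h" and s: "\<sigma> \<noteq> 0"
    and S: "\<And>x. (u x, v x) \<in> S"
    and lF: "locint (\<lambda>x. F (u x) (v x))"
    and Lip: "\<And>a b a' b'. (a, b) \<in> S \<Longrightarrow> (a', b') \<in> S \<Longrightarrow> \<bar>F a b - F a' b'\<bar> \<le> L * (\<bar>a - a'\<bar> + \<bar>b - b'\<bar>)"
    and L: "L \<ge> 0"
    and Hm: "H \<in> borel_measurable borel"
    and lim: "AE x in lborel. \<forall>t X Y. t \<longlonglongrightarrow> 0 \<longrightarrow> (\<forall>n. 0 < \<sigma> * t n) \<longrightarrow> (\<forall>n. (X n, Y n) \<in> S) \<longrightarrow>
        (\<lambda>n. (X n - u x) / t n) \<longlonglongrightarrow> g x \<longrightarrow> (\<lambda>n. (Y n - v x) / t n) \<longlonglongrightarrow> h x \<longrightarrow>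
        (\<lambda>n. (F (X n) (Y n) - F (u x) (v x)) / t n) \<longlonglongrightarrow> H x"
  shows "weak_dderiv e (\<lambda>x. F (u x) (v x)) H"
proof -
  define f where "f x = F (u x) (v x)" for x
  have l: "locint u" "locint g" "locint v" "locint h" using u v by (auto simp: weak_dderiv_def)
  have lf: "locint f" using lF by (simp add: f_def[abs_def])
  note m[measurable] = l[THEN locint_measurable] locint_measurable[OF lf] Hm
  have dm[measurable]: "diff_quot e f t \<in> borel_measurable borel" if "f \<in> borel_measurable borel" for f t
    unfolding diff_quot_def[abs_def] using that by measurable
  obtain t where t: "t \<longlonglongrightarrow> 0" "\<forall>n. 0 < \<sigma> * t n"
    "AE x in lborel. (\<lambda>n. diff_quot e u (t n) x) \<longlonglongrightarrow> g x" "AE x in lborel. (\<lambda>n. diff_quot e v (t n) x) \<longlonglongrightarrow> h x"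
    using weak_dderiv_AE_sequence[OF u v s] by (elim exE conjE)
  have t0: "t n \<noteq> 0" for n using t(2)[rule_format, of n] by auto
  define G where "G x = L * (\<bar>g x\<bar> + \<bar>h x\<bar>)" for x
  have lG: "locint G" unfolding G_def[abs_def] by (intro locint_cmult locint_add locint_abs l)
  note lG[THEN locint_measurable, measurable]
  have G0: "G x \<ge> 0" for x using L by (simp add: G_def)
  have fb: "\<bar>diff_quot e f (t n) x\<bar> \<le> L * (\<bar>diff_quot e u (t n) x\<bar> + \<bar>diff_quot e v (t n) x\<bar>)" for n x
  proof -
    have "\<bar>f (t n *\<^sub>R e + x) - f x\<bar> / \<bar>t n\<bar> \<le> L * (\<bar>u (t n *\<^sub>R e + x) - u x\<bar> + \<bar>v (t n *\<^sub>R e + x) - v x\<bar>) / \<bar>t n\<bar>"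
      unfolding f_def by (intro divide_right_mono Lip S) simp
    then show ?thesis by (simp add: diff_quot_def add_divide_distrib distrib_left)
  qed
  have fl: "AE x in lborel. (\<lambda>n. diff_quot e f (t n) x) \<longlonglongrightarrow> H x"
    using lim t(3,4)
  proof eventually_elim
    case (elim x)
    have "(\<lambda>n. (F (u (t n *\<^sub>R e + x)) (v (t n *\<^sub>R e + x)) - F (u x) (v x)) / t n) \<longlonglongrightarrow> H x"
      using elim t(1,2) S by (simp add: diff_quot_def)
    then show ?case by (simp add: diff_quot_def f_def)
  qed
  have HG: "AE x in lborel. \<bar>H x\<bar> \<le> G x"
    using fl t(3,4)
  proof eventually_elim
    case (elim x)
    have "(\<lambda>n. L * (\<bar>diff_quot e u (t n) x\<bar> + \<bar>diff_quot e v (t n) x\<bar>)) \<longlonglongrightarrow> L * (\<bar>g x\<bar> + \<bar>h x\<bar>)"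
      by (intro tendsto_intros elim)
    moreover have "(\<lambda>n. \<bar>diff_quot e f (t n) x\<bar>) \<longlonglongrightarrow> \<bar>H x\<bar>" by (intro tendsto_intros elim)
    ultimately show ?case unfolding G_def using fb by (intro LIMSEQ_le) auto
  qed
  have lH: "locint H"
    by (rule locint_bound_AE[OF lG Hm]) (use HG G0 in auto)
  have "L1loc_tendsto (\<lambda>n. diff_quot e f (t n)) H"
    unfolding L1loc_tendsto_def
  proof
    fix r
    have cm[measurable]: "cball 0 r \<in> sets (borel :: 'a measure)" by simp
    define I where "I = (indicator (cball 0 r) :: 'a \<Rightarrow> ennreal)"
    have [measurable]: "I \<in> borel_measurable borel" unfolding I_def by measurable
    \<comment> \<open>Generalized dominated convergence: truncated at \<open>2 * G\<close>, the
      error is dominated and tends to zero. What exceeds the truncation is at most \<open>L\<close>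
      times the errors of the quotients of \<open>u\<close> and \<open>v\<close>, which are small in
      L^1.\<close>
    define D where "D n x = min \<bar>diff_quot e f (t n) x - H x\<bar> (2 * G x)" for n x
    have [measurable]: "D n \<in> borel_measurable borel" for n unfolding D_def[abs_def] by measurable
    have fin: "(\<integral>\<^sup>+x. ennreal (2 * G x) * I x \<partial>lborel) < \<infinity>"
    proof -
      have "(\<integral>\<^sup>+x. ennreal (2 * G x) * I x \<partial>lborel) = (\<integral>\<^sup>+x. ennreal (norm (indicator (cball 0 r) x * (2 * G x))) \<partial>lborel)"
        unfolding I_def using G0 by (intro nn_integral_cong) (auto split: split_indicator)
      then show ?thesis
        using locint_integrable_cball[OF locint_cmult[OF lG, of 2], of r] by (simp add: integrable_iff_bounded)
    qed
    have limD: "(\<lambda>n. \<integral>\<^sup>+x. ennreal (D n x) * I x \<partial>lborel) \<longlonglongrightarrow> (\<integral>\<^sup>+x. 0 \<partial>(lborel :: 'a measure))"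
    proof (rule nn_integral_dominated_convergence[where w = "\<lambda>x. ennreal (2 * G x) * I x"])
      show "AE x in lborel. (\<lambda>n. ennreal (D n x) * I x) \<longlonglongrightarrow> 0"
        using fl
      proof eventually_elim
        case (elim x)
        have "(\<lambda>n. D n x) \<longlonglongrightarrow> min \<bar>H x - H x\<bar> (2 * G x)" unfolding D_def by (intro tendsto_intros elim)
        then have "(\<lambda>n. ennreal (D n x)) \<longlonglongrightarrow> ennreal 0" using G0[of x] by (intro tendsto_ennrealI) simp
        then show ?case by (cases "x \<in> cball 0 r") (simp_all add: I_def)
      qed
      show "AE x in lborel. ennreal (D n x) * I x \<le> ennreal (2 * G x) * I x" for n
        by (intro AE_I2 mult_right_mono ennreal_leI) (auto simp: D_def)
    qed (use fin in auto)
    have limu: "(\<lambda>n. \<integral>\<^sup>+x. ennreal \<bar>diff_quot e u (t n) x - g x\<bar> * I x \<partial>lborel) \<longlonglongrightarrow> 0"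
      "(\<lambda>n. \<integral>\<^sup>+x. ennreal \<bar>diff_quot e v (t n) x - h x\<bar> * I x \<partial>lborel) \<longlonglongrightarrow> 0"
      using weak_dderiv_diff_quot_tendsto[OF u t(1) t0] weak_dderiv_diff_quot_tendsto[OF v t(1) t0]
      by (simp_all add: L1loc_tendsto_def I_def)
    have "(\<lambda>n. ennreal L * ((\<integral>\<^sup>+x. ennreal \<bar>diff_quot e u (t n) x - g x\<bar> * I x \<partial>lborel) +
        (\<integral>\<^sup>+x. ennreal \<bar>diff_quot e v (t n) x - h x\<bar> * I x \<partial>lborel)) + (\<integral>\<^sup>+x. ennreal (D n x) * I x \<partial>lborel)) \<longlonglongrightarrow> ennreal L * (0 + 0) + 0"
      using limD by (intro tendsto_add ennreal_tendsto_cmult limu) simp_all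
    then have lim0: "(\<lambda>n. ennreal L * ((\<integral>\<^sup>+x. ennreal \<bar>diff_quot e u (t n) x - g x\<bar> * I x \<partial>lborel) +
        (\<integral>\<^sup>+x. ennreal \<bar>diff_quot e v (t n) x - h x\<bar> * I x \<partial>lborel)) + (\<integral>\<^sup>+x. ennreal (D n x) * I x \<partial>lborel)) \<longlonglongrightarrow> 0"
      by simp
    have le: "(\<integral>\<^sup>+x. ennreal \<bar>diff_quot e f (t n) x - H x\<bar> * I x \<partial>lborel) \<le>
        ennreal L * ((\<integral>\<^sup>+x. ennreal \<bar>diff_quot e u (t n) x - g x\<bar> * I x \<partial>lborel) +
        (\<integral>\<^sup>+x. ennreal \<bar>diff_quot e v (t n) x - h x\<bar> * I x \<partial>lborel)) + (\<integral>\<^sup>+x. ennreal (D n x) * I x \<partial>lborel)" for n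
    proof -
      have "(\<integral>\<^sup>+x. ennreal \<bar>diff_quot e f (t n) x - H x\<bar> * I x \<partial>lborel) \<le>
        (\<integral>\<^sup>+x. ennreal L * (ennreal \<bar>diff_quot e u (t n) x - g x\<bar> * I x + ennreal \<bar>diff_quot e v (t n) x - h x\<bar> * I x) + ennreal (D n x) * I x \<partial>lborel)"
      proof (rule nn_integral_mono_AE)
        show "AE x in lborel. ennreal \<bar>diff_quot e f (t n) x - H x\<bar> * I x \<le>
          ennreal L * (ennreal \<bar>diff_quot e u (t n) x - g x\<bar> * I x + ennreal \<bar>diff_quot e v (t n) x - h x\<bar> * I x) + ennreal (D n x) * I x"
          using HG
        proof eventually_elim
          case (elim x)
          define p q where "p = \<bar>diff_quot e u (t n) x - g x\<bar>" and "q = \<bar>diff_quot e v (t n) x - h x\<bar>"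
          have pq: "\<bar>diff_quot e u (t n) x\<bar> \<le> p + \<bar>g x\<bar>" "\<bar>diff_quot e v (t n) x\<bar> \<le> q + \<bar>h x\<bar>"
            by (auto simp: p_def q_def)
          have "\<bar>diff_quot e f (t n) x - H x\<bar> \<le> L * (\<bar>diff_quot e u (t n) x\<bar> + \<bar>diff_quot e v (t n) x\<bar>) + G x"
            using fb[of n x] elim by linarith
          also have "\<dots> \<le> L * ((p + \<bar>g x\<bar>) + (q + \<bar>h x\<bar>)) + G x"
            using pq L by (intro add_right_mono mult_left_mono) auto
          also have "\<dots> = L * (p + q) + 2 * G x" by (simp add: G_def algebra_simps)
          finally have "\<bar>diff_quot e f (t n) x - H x\<bar> \<le> L * (p + q) + D n x"
            using L by (auto simp: D_def min_def p_def q_def)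
          then have "ennreal \<bar>diff_quot e f (t n) x - H x\<bar> \<le> ennreal (L * (p + q) + D n x)" by (rule ennreal_leI)
          also have "\<dots> = ennreal L * (ennreal p + ennreal q) + ennreal (D n x)"
            using L G0[of x] by (simp add: p_def q_def D_def ennreal_mult ennreal_plus)
          finally show ?case by (cases "x \<in> cball 0 r") (simp_all add: I_def p_def q_def)
        qed
      qed
      also have "\<dots> = ennreal L * ((\<integral>\<^sup>+x. ennreal \<bar>diff_quot e u (t n) x - g x\<bar> * I x \<partial>lborel) +
        (\<integral>\<^sup>+x. ennreal \<bar>diff_quot e v (t n) x - h x\<bar> * I x \<partial>lborel)) + (\<integral>\<^sup>+x. ennreal (D n x) * I x \<partial>lborel)"
        by (subst nn_integral_add, measurable, subst nn_integral_cmult, measurable, subst nn_integral_add, measurable)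
      finally show ?thesis .
    qed
    show "(\<lambda>n. \<integral>\<^sup>+x. ennreal \<bar>diff_quot e f (t n) x - H x\<bar> * indicator (cball 0 r) x \<partial>lborel) \<longlonglongrightarrow> 0"
      by (rule tendsto_sandwich[OF _ _ tendsto_const lim0]) (use le in \<open>auto simp: I_def\<close>)
  qed
  from weak_dderivI[OF lf lH t(1) t0 this] show ?thesis by (simp add: f_def[abs_def])
qed

section \<open>Weak derivatives of differences and absolute values\<close>

lemma tendsto_of_quotient_tendsto:
  fixes t X :: "nat \<Rightarrow> real"
  assumes "t \<longlonglongrightarrow> 0" "\<And>n. t n \<noteq> 0" "(\<lambda>n. (X n - a) / t n) \<longlonglongrightarrow> q"
  shows "X \<longlonglongrightarrow> a"
proof -
  have "(\<lambda>n. t n * ((X n - a) / t n)) \<longlonglongrightarrow> 0 * q" by (intro tendsto_mult assms)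
  then have "(\<lambda>n. X n - a) \<longlonglongrightarrow> 0" using assms(2) by simp
  then show ?thesis by (simp add: LIM_zero_iff)
qed

lemma weak_dderiv_diff:
  assumes u: "weak_dderiv e u g" and v: "weak_dderiv e v h"
  shows "weak_dderiv e (\<lambda>x. u x - v x) (\<lambda>x. g x - h x)"
proof -
  have l: "locint u" "locint g" "locint v" "locint h" using u v by (auto simp: weak_dderiv_def)
  note [measurable] = l[THEN locint_measurable]
  have lim: "(\<lambda>n. (X n - Y n - (a - b)) / t n) \<longlonglongrightarrow> q - r"
    if "(\<lambda>n. (X n - a) / t n) \<longlonglongrightarrow> q" "(\<lambda>n. (Y n - b) / t n) \<longlonglongrightarrow> r"
    for X Y t :: "nat \<Rightarrow> real" and a b q r
  proof -
    have "(\<lambda>n. (X n - a) / t n - (Y n - b) / t n) = (\<lambda>n. (X n - Y n - (a - b)) / t n)"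
      by (rule ext) (simp only: diff_divide_distrib[symmetric], simp add: algebra_simps)
    with tendsto_diff[OF that] show ?thesis by simp
  qed
  show ?thesis
  proof (rule weak_dderiv_chain[OF u v, of 1 UNIV "\<lambda>a b. a - b" 1])
    show "locint (\<lambda>x. u x - v x)" by (rule locint_diff[OF l(1,3)])
    show "(\<lambda>x. g x - h x) \<in> borel_measurable borel" by measurable
    show "AE x in lborel. \<forall>t X Y. t \<longlonglongrightarrow> 0 \<longrightarrow> (\<forall>n. 0 < 1 * t n) \<longrightarrow> (\<forall>n. (X n, Y n) \<in> UNIV) \<longrightarrow>
      (\<lambda>n. (X n - u x) / t n) \<longlonglongrightarrow> g x \<longrightarrow> (\<lambda>n. (Y n - v x) / t n) \<longlonglongrightarrow> h x \<longrightarrow>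
      (\<lambda>n. (X n - Y n - (u x - v x)) / t n) \<longlonglongrightarrow> g x - h x"
      by (intro AE_I2 allI impI lim)
  qed auto
qed

text \<open>At \<open>a = 0\<close> the quotient is \<open>\<bar>X n\<bar> / t n\<close>, whose sign
  is that of \<open>t n\<close>; this is where the side from which the shifts approach zero enters
  the limit.\<close>

lemma abs_quotient_tendsto:
  fixes t X :: "nat \<Rightarrow> real"
  assumes t: "t \<longlonglongrightarrow> 0" "\<And>n. 0 < \<sigma> * t n" and X: "(\<lambda>n. (X n - a) / t n) \<longlonglongrightarrow> q"
  shows "(\<lambda>n. (\<bar>X n\<bar> - \<bar>a\<bar>) / t n) \<longlonglongrightarrow> (if a > 0 then q else if a < 0 then - q else sgn \<sigma> * \<bar>q\<bar>)"
proof -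
  have t0: "t n \<noteq> 0" for n using t(2)[of n] by auto
  have Xa: "X \<longlonglongrightarrow> a" by (rule tendsto_of_quotient_tendsto[OF t(1) t0 X])
  consider "a > 0" | "a < 0" | "a = 0" by linarith
  then show ?thesis
  proof cases
    case 1
    have "\<forall>\<^sub>F n in sequentially. X n > 0" using Xa 1 by (rule order_tendstoD)
    then have "\<forall>\<^sub>F n in sequentially. (X n - a) / t n = (\<bar>X n\<bar> - \<bar>a\<bar>) / t n"
      by eventually_elim (use 1 in simp)
    from Lim_transform_eventually[OF X this] show ?thesis using 1 by simp
  next
    case 2
    have "\<forall>\<^sub>F n in sequentially. X n < 0" using Xa 2 by (rule order_tendstoD)
    then have "\<forall>\<^sub>F n in sequentially. - ((X n - a) / t n) = (\<bar>X n\<bar> - \<bar>a\<bar>) / t n"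
      by eventually_elim (use 2 in \<open>simp add: minus_divide_left\<close>)
    from Lim_transform_eventually[OF tendsto_minus[OF X] this] show ?thesis using 2 by simp
  next
    case 3
    have "(\<lambda>n. sgn \<sigma> * \<bar>(X n - a) / t n\<bar>) \<longlonglongrightarrow> sgn \<sigma> * \<bar>q\<bar>" by (intro tendsto_intros X)
    moreover have "sgn \<sigma> * \<bar>(X n - a) / t n\<bar> = (\<bar>X n\<bar> - \<bar>a\<bar>) / t n" for n
    proof -
      have "sgn \<sigma> = sgn (t n)" using t(2)[of n] by (auto simp: zero_less_mult_iff)
      then show ?thesis using 3 by (cases "t n" "0::real" rule: linorder_cases) (auto simp: abs_divide)
    qed
    ultimately show ?thesis using 3 by simp
  qed
qed

text \<open>One-sided difference quotients of \<open>\<bar>u\<bar>\<close> from the right and from the left both give its weak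
  derivative; on \<open>{u = 0}\<close> they are \<open>\<bar>g\<bar>\<close> and \<open>- \<bar>g\<bar>\<close>.\<close>
lemma weak_dderiv_eq_0_on_zero_set:
  assumes u: "weak_dderiv e u g"
  shows "AE x in lborel. u x = 0 \<longrightarrow> g x = 0"
proof -
  have l: "locint u" "locint g" using u by (auto simp: weak_dderiv_def)
  note [measurable] = l[THEN locint_measurable]
  have w: "weak_dderiv e (\<lambda>x. \<bar>u x\<bar>) (\<lambda>x. if u x > 0 then g x else if u x < 0 then - g x else sgn \<sigma> * \<bar>g x\<bar>)"
    if "\<sigma> \<noteq> 0" for \<sigma> :: real
  proof (rule weak_dderiv_chain[OF u u that, of UNIV "\<lambda>a b. \<bar>a\<bar>" 1])
    show "locint (\<lambda>x. \<bar>u x\<bar>)" by (rule locint_abs[OF l(1)])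
    show "(\<lambda>x. if u x > 0 then g x else if u x < 0 then - g x else sgn \<sigma> * \<bar>g x\<bar>) \<in> borel_measurable borel"
      by measurable
    show "AE x in lborel. \<forall>t X Y. t \<longlonglongrightarrow> 0 \<longrightarrow> (\<forall>n. 0 < \<sigma> * t n) \<longrightarrow> (\<forall>n. (X n, Y n) \<in> UNIV) \<longrightarrow>
      (\<lambda>n. (X n - u x) / t n) \<longlonglongrightarrow> g x \<longrightarrow> (\<lambda>n. (Y n - u x) / t n) \<longlonglongrightarrow> g x \<longrightarrow>
      (\<lambda>n. (\<bar>X n\<bar> - \<bar>u x\<bar>) / t n) \<longlonglongrightarrow> (if u x > 0 then g x else if u x < 0 then - g x else sgn \<sigma> * \<bar>g x\<bar>)"
      by (intro AE_I2 allI impI abs_quotient_tendsto) blast+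
  qed auto
  have "AE x in lborel. (if u x > 0 then g x else if u x < 0 then - g x else sgn 1 * \<bar>g x\<bar>) =
     (if u x > 0 then g x else if u x < 0 then - g x else sgn (-1) * \<bar>g x\<bar>)"
    by (rule weak_dderiv_unique[OF w w]) simp_all
  then show ?thesis by eventually_elim auto
qed

section \<open>The power mean competitor\<close>

text \<open>Caratheodory's form of the derivative avoids dividing by \<open>X n - a\<close>, which
  may be zero for infinitely many \<open>n\<close>.\<close>

lemma DERIV_quotient_tendsto:
  fixes f :: "real \<Rightarrow> real"
  assumes f: "(f has_real_derivative d) (at a)" and t: "t \<longlonglongrightarrow> 0" "\<And>n. t n \<noteq> 0"
    and X: "(\<lambda>n. (X n - a) / t n) \<longlonglongrightarrow> q"
  shows "(\<lambda>n. (f (X n) - f a) / t n) \<longlonglongrightarrow> d * q"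
proof -
  obtain g where g: "\<forall>z. f z - f a = g z * (z - a)" "isCont g a" "g a = d"
    using f unfolding CARAT_DERIV by blast
  have "X \<longlonglongrightarrow> a" by (rule tendsto_of_quotient_tendsto[OF t X])
  then have "(\<lambda>n. g (X n)) \<longlonglongrightarrow> d" using isCont_tendsto_compose[OF g(2)] g(3) by simp
  from tendsto_mult[OF this X] show ?thesis using g(1) by simp
qed

lemma powr_quotient_tendsto:
  fixes p :: real
  assumes p: "p > 1" and a: "a \<ge> 0" and t: "t \<longlonglongrightarrow> 0" "\<And>n. t n \<noteq> 0"
    and X: "(\<lambda>n. (X n - a) / t n) \<longlonglongrightarrow> q" "\<And>n. X n \<ge> 0"
  shows "(\<lambda>n. (X n powr p - a powr p) / t n) \<longlonglongrightarrow> p * a powr (p - 1) * q"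
proof (cases "a = 0")
  case False
  then have "((\<lambda>x. x powr p) has_real_derivative p * a powr (p - 1)) (at a)"
    using a by (intro has_real_derivative_powr) auto
  from DERIV_quotient_tendsto[OF this t X(1)] show ?thesis .
next
  case True
  \<comment> \<open>At \<open>a = 0\<close> one factor is split off: the quotient is
    \<open>X n powr (p - 1)\<close> times \<open>X n / t n\<close>, and the first factor tends to
    zero since \<open>p > 1\<close>.\<close>
  have "X \<longlonglongrightarrow> 0" using tendsto_of_quotient_tendsto[OF t X(1)] True by simp
  then have "(\<lambda>n. X n powr (p - 1)) \<longlonglongrightarrow> 0 powr (p - 1)"
    using p X(2) by (intro tendsto_powr') auto
  from tendsto_mult[OF this X(1)] have "(\<lambda>n. X n powr (p - 1) * (X n / t n)) \<longlonglongrightarrow> 0" using True p by simp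
  moreover have "X n powr (p - 1) * (X n / t n) = X n powr p / t n" for n
    using X(2)[of n] by (cases "X n = 0") (auto simp: powr_diff)
  ultimately have "(\<lambda>n. X n powr p / t n) \<longlonglongrightarrow> 0" by (simp only:)
  then show ?thesis using True p by simp
qed

definition power_mean :: "real \<Rightarrow> real \<Rightarrow> real \<Rightarrow> real" where
  "power_mean p a b = ((a powr p + b powr p) / 2) powr (1 / p)"

text \<open>The directional derivative of \<open>power_mean p\<close> at the point
  \<open>(a, b)\<close> in the direction \<open>(q, r)\<close>; the chain rule is applied with the
  derivatives of the two functions as \<open>q\<close> and \<open>r\<close>.\<close>

definition power_mean_deriv :: "real \<Rightarrow> real \<Rightarrow> real \<Rightarrow> real \<Rightarrow> real \<Rightarrow> real" where
  "power_mean_deriv p a b q r =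
     ((a powr p + b powr p) / 2) powr (1 / p - 1) * (a powr (p - 1) * q + b powr (p - 1) * r) / 2"

lemma power_mean_nonneg: "power_mean p a b \<ge> 0"
  by (simp add: power_mean_def)

lemma power_mean_commute: "power_mean p a b = power_mean p b a"
  by (simp add: power_mean_def add.commute)

lemma power_mean_powr:
  assumes "p > 0" shows "power_mean p a b powr p = (a powr p + b powr p) / 2"
  using assms by (simp add: power_mean_def powr_powr)

lemma power_mean_same:
  assumes "p > 0" "a \<ge> 0" shows "power_mean p a a = a"
  using assms by (simp add: power_mean_def powr_powr)

lemma power_mean_le_max:
  assumes "p > 0" "a \<ge> 0" "b \<ge> 0" shows "power_mean p a b \<le> max a b"
proof -
  have "(a powr p + b powr p) / 2 \<le> max a b powr p"
    using assms powr_mono2[of p a "max a b"] powr_mono2[of p b "max a b"] by simp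
  then have "power_mean p a b \<le> (max a b powr p) powr (1 / p)"
    unfolding power_mean_def using assms by (intro powr_mono2) auto
  also have "\<dots> = max a b" using assms by (simp add: powr_powr max_def)
  finally show ?thesis .
qed

text \<open>The partial derivative is at most one: under the negative exponent
  \<open>1 / p - 1\<close> the term \<open>b powr p\<close> may be dropped, which leaves
  \<open>2 powr (1 - 1 / p) / 2\<close>. The mean value theorem extends the bound up to the origin,
  where the mean is not differentiable.\<close>

lemma power_mean_increment:
  assumes p: "p > 1" and a: "0 \<le> a" "a \<le> a'"
  shows "0 \<le> power_mean p a' b - power_mean p a b" "power_mean p a' b - power_mean p a b \<le> a' - a"
proof -
  have "a powr p \<le> a' powr p" using a p by (intro powr_mono2) auto
  then show "0 \<le> power_mean p a' b - power_mean p a b"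
    unfolding power_mean_def using p by (simp add: powr_mono2 add_nonneg_nonneg)
  show "power_mean p a' b - power_mean p a b \<le> a' - a"
  proof (cases "a = a'")
    case False
    then have lt: "a < a'" using a by simp
    have der: "((\<lambda>x. power_mean p x b) has_real_derivative power_mean_deriv p x b 1 0) (at x)" if "x > 0" for x
      unfolding power_mean_def power_mean_deriv_def
      using p that by (auto intro!: derivative_eq_intros simp: add_pos_nonneg add_nonneg_pos field_simps)
    have df: "(\<lambda>x. power_mean p x b) differentiable (at x)" if "x > 0" for x
      unfolding real_differentiable_def by (rule exI, rule der[OF that])
    have cont: "continuous_on {a..a'} (\<lambda>x. power_mean p x b)"
      unfolding power_mean_def
      using p a by (intro continuous_on_powr' continuous_intros) auto
    have "\<exists>l z. a < z \<and> z < a' \<and> ((\<lambda>x. power_mean p x b) has_real_derivative l) (at z) \<and>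
       power_mean p a' b - power_mean p a b = (a' - a) * l"
      by (rule MVT[OF lt cont]) (rule df, use a in simp)
    then obtain l z where z: "a < z" "z < a'" "((\<lambda>x. power_mean p x b) has_real_derivative l) (at z)"
      "power_mean p a' b - power_mean p a b = (a' - a) * l" by (elim exE conjE)
    have z0: "z > 0" using z(1) a by simp
    have l: "l = power_mean_deriv p z b 1 0" by (rule DERIV_unique[OF z(3) der[OF z0]])
    have "((z powr p + b powr p) / 2) powr (1 / p - 1) \<le> (z powr p / 2) powr (1 / p - 1)"
      using p z0 by (intro powr_mono2') auto
    also have "\<dots> = z powr (1 - p) * 2 powr (1 - 1 / p)"
    proof -
      have "(z powr p / 2) powr (1 / p - 1) = (z powr p) powr (1 / p - 1) / 2 powr (1 / p - 1)"
        by (rule powr_divide)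
      also have "(z powr p) powr (1 / p - 1) = z powr (1 - p)"
      proof -
        have "p * (1 / p - 1) = 1 - p" using p by (simp add: field_simps)
        then show ?thesis by (simp only: powr_powr)
      qed
      also have "z powr (1 - p) / 2 powr (1 / p - 1) = z powr (1 - p) * 2 powr (1 - 1 / p)"
      proof -
        have "2 powr (1 - 1 / p) = inverse (2 powr (1 / p - 1) :: real)"
          using powr_minus[of 2 "1 / p - 1"] by simp
        then show ?thesis by (simp only: divide_inverse)
      qed
      finally show ?thesis .
    qed
    finally have "l \<le> z powr (1 - p) * 2 powr (1 - 1 / p) * z powr (p - 1) / 2"
      unfolding l power_mean_deriv_def by (simp add: divide_right_mono mult_right_mono)
    also have "\<dots> = 2 powr (1 - 1 / p) / 2"
      using z0 by (simp add: powr_add[symmetric] mult.commute mult.left_commute)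
    also have "\<dots> \<le> 2 powr 1 / 2" using p by (intro divide_right_mono powr_mono) auto
    finally have "l \<le> 1" by simp
    then show ?thesis using z(4) lt by (simp add: mult_left_le)
  qed simp
qed

lemma power_mean_lipschitz:
  assumes p: "p > 1" and "0 \<le> a" "0 \<le> a'" "0 \<le> b" "0 \<le> b'"
  shows "\<bar>power_mean p a b - power_mean p a' b'\<bar> \<le> \<bar>a - a'\<bar> + \<bar>b - b'\<bar>"
proof -
  have 1: "\<bar>power_mean p x y - power_mean p x' y\<bar> \<le> \<bar>x - x'\<bar>" if "0 \<le> x" "0 \<le> x'" for x x' y
    using power_mean_increment[OF p that(1), of x' y] power_mean_increment[OF p that(2), of x y]
    by (cases "x \<le> x'") auto
  show ?thesis
    using 1[of a a' b] 1[of b b' a'] assms by (simp add: power_mean_commute[of p a' b] power_mean_commute[of p a' b'])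
qed

lemma power_mean_quotient_tendsto:
  assumes p: "p > 1" and a: "a > 0" "b \<ge> 0" and t: "t \<longlonglongrightarrow> 0" "\<And>n. t n \<noteq> 0"
    and X: "(\<lambda>n. (X n - a) / t n) \<longlonglongrightarrow> q" "\<And>n. X n \<ge> 0"
    and Y: "(\<lambda>n. (Y n - b) / t n) \<longlonglongrightarrow> r" "\<And>n. Y n \<ge> 0"
  shows "(\<lambda>n. (power_mean p (X n) (Y n) - power_mean p a b) / t n) \<longlonglongrightarrow> power_mean_deriv p a b q r"
proof -
  define s where "s = (a powr p + b powr p) / 2"
  have s: "s > 0" using a by (simp add: s_def add_pos_nonneg)
  have "(\<lambda>n. ((X n powr p - a powr p) / t n + (Y n powr p - b powr p) / t n) / 2) \<longlonglongrightarrow>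
      (p * a powr (p - 1) * q + p * b powr (p - 1) * r) / 2"
    using powr_quotient_tendsto[OF p _ t X] powr_quotient_tendsto[OF p _ t Y] a by (intro tendsto_intros) auto
  moreover have "((X n powr p - a powr p) / t n + (Y n powr p - b powr p) / t n) / 2 = ((X n powr p + Y n powr p) / 2 - s) / t n" for n
    by (simp add: s_def add_divide_distrib diff_divide_distrib)
  ultimately have "(\<lambda>n. ((X n powr p + Y n powr p) / 2 - s) / t n) \<longlonglongrightarrow> (p * a powr (p - 1) * q + p * b powr (p - 1) * r) / 2"
    by simp
  moreover have "((\<lambda>x. x powr (1 / p)) has_real_derivative (1 / p) * s powr (1 / p - 1)) (at s)"
    using s by (rule has_real_derivative_powr)
  ultimately have "(\<lambda>n. (((X n powr p + Y n powr p) / 2) powr (1 / p) - s powr (1 / p)) / t n) \<longlonglongrightarrow>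
     (1 / p) * s powr (1 / p - 1) * ((p * a powr (p - 1) * q + p * b powr (p - 1) * r) / 2)"
    by (intro DERIV_quotient_tendsto[OF _ t])
  moreover have "(1 / p) * s powr (1 / p - 1) * ((p * a powr (p - 1) * q + p * b powr (p - 1) * r) / 2) = power_mean_deriv p a b q r"
    using p by (simp add: power_mean_deriv_def s_def field_simps)
  ultimately show ?thesis by (simp add: power_mean_def s_def)
qed

lemma powr_strict_midpoint_concave:
  fixes A B :: real
  assumes \<theta>: "0 < \<theta>" "\<theta> < 1" and AB: "0 \<le> B" "B < A"
  shows "A powr \<theta> + B powr \<theta> < 2 * ((A + B) / 2) powr \<theta>"
proof -
  define s where "s = (A + B) / 2"
  have s: "B < s" "s < A" "0 < s" "A - s = s - B" using AB by (auto simp: s_def field_simps)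
  have mv: "\<exists>z. x < z \<and> z < y \<and> y powr \<theta> - x powr \<theta> = (y - x) * (\<theta> * z powr (\<theta> - 1))" if "0 \<le> x" "x < y" for x y
  proof -
    have der: "((\<lambda>z. z powr \<theta>) has_real_derivative \<theta> * z powr (\<theta> - 1)) (at z)" if "z > 0" for z
      using that by (rule has_real_derivative_powr)
    have df: "(\<lambda>z. z powr \<theta>) differentiable (at z)" if "z > 0" for z
      unfolding real_differentiable_def by (rule exI, rule der[OF that])
    have cont: "continuous_on {x..y} (\<lambda>z. z powr \<theta>)"
      using that \<theta> by (intro continuous_on_powr' continuous_intros) auto
    have "\<exists>l z. x < z \<and> z < y \<and> ((\<lambda>z. z powr \<theta>) has_real_derivative l) (at z) \<and> y powr \<theta> - x powr \<theta> = (y - x) * l"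
      by (rule MVT[OF that(2) cont]) (rule df, use that in simp)
    then obtain l z where z: "x < z" "z < y" "((\<lambda>z. z powr \<theta>) has_real_derivative l) (at z)" "y powr \<theta> - x powr \<theta> = (y - x) * l"
      by (elim exE conjE)
    have "l = \<theta> * z powr (\<theta> - 1)" by (rule DERIV_unique[OF z(3) der]) (use z that in auto)
    then show ?thesis using z by blast
  qed
  obtain \<xi> where \<xi>: "s < \<xi>" "\<xi> < A" "A powr \<theta> - s powr \<theta> = (A - s) * (\<theta> * \<xi> powr (\<theta> - 1))"
    using mv[of s A] s by auto
  obtain \<eta> where \<eta>: "B < \<eta>" "\<eta> < s" "s powr \<theta> - B powr \<theta> = (s - B) * (\<theta> * \<eta> powr (\<theta> - 1))"
    using mv[of B s] s AB by auto
  have "\<xi> powr (\<theta> - 1) < \<eta> powr (\<theta> - 1)"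
    using \<theta> \<xi> \<eta> AB by (intro powr_less_mono2_neg) auto
  then have "(A - s) * (\<theta> * \<xi> powr (\<theta> - 1)) < (s - B) * (\<theta> * \<eta> powr (\<theta> - 1))"
    unfolding s(4) using s \<theta> by (intro mult_strict_left_mono) auto
  then show ?thesis using \<xi>(3) \<eta>(3) by (simp add: s_def)
qed

text \<open>Cauchy-Schwarz reduces the inequality to the strict concavity of \<open>x powr \<theta>\<close> for
  \<open>\<theta> = 2 - 2/p\<close>; this is where \<open>p < 2\<close> enters.\<close>
lemma power_mean_deriv_square:
  assumes p: "1 < p" "p < 2" and ab: "0 \<le> b" "b < a"
  shows "2 * (power_mean_deriv p a b q r)\<^sup>2 \<le> q\<^sup>2 + r\<^sup>2"
    and "2 * (power_mean_deriv p a b q r)\<^sup>2 = q\<^sup>2 + r\<^sup>2 \<Longrightarrow> q = 0 \<and> r = 0"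
proof -
  define s \<theta> where "s = (a powr p + b powr p) / 2" and "\<theta> = 2 - 2 / p"
  define \<alpha> \<beta> where "\<alpha> = a powr (p - 1)" and "\<beta> = b powr (p - 1)"
  have s: "s > 0" using ab by (simp add: s_def add_pos_nonneg)
  have \<theta>: "0 < \<theta>" "\<theta> < 1" using p by (auto simp: \<theta>_def field_simps)
  \<comment> \<open>The constant left by Cauchy-Schwarz. It is strictly below one because
    \<open>a\<close> and \<open>b\<close> differ, and the gap \<open>1 - \<kappa>\<close> settles
    the case of equality.\<close>
  define \<kappa> where "\<kappa> = s powr (- \<theta>) * ((\<alpha>\<^sup>2 + \<beta>\<^sup>2) / 2)"
  have sq: "(x powr (p - 1))\<^sup>2 = (x powr p) powr \<theta>" if "x \<ge> 0" for x :: real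
  proof -
    have "(x powr (p - 1))\<^sup>2 = x powr (2 * (p - 1))"
      using that by (simp only: power2_eq_square powr_add[symmetric] mult_2)
    moreover have "p * \<theta> = 2 * (p - 1)" using p by (simp add: \<theta>_def field_simps)
    ultimately show ?thesis by (simp add: powr_powr)
  qed
  have "b powr p < a powr p" using ab p by (intro powr_less_mono2) auto
  then have "\<alpha>\<^sup>2 + \<beta>\<^sup>2 < 2 * s powr \<theta>"
    using powr_strict_midpoint_concave[OF \<theta>, of "b powr p" "a powr p"] ab by (simp add: \<alpha>_def \<beta>_def sq s_def)
  then have "s powr (- \<theta>) * ((\<alpha>\<^sup>2 + \<beta>\<^sup>2) / 2) < s powr (- \<theta>) * s powr \<theta>"
    using s by (intro mult_strict_left_mono) auto
  moreover have "s powr (- \<theta>) * s powr \<theta> = 1" using s by (simp add: powr_minus)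
  ultimately have \<kappa>: "\<kappa> < 1" by (simp only: \<kappa>_def)
  have "(power_mean_deriv p a b q r)\<^sup>2 = (s powr (1 / p - 1))\<^sup>2 * (\<alpha> * q + \<beta> * r)\<^sup>2 / 4"
    by (simp add: power_mean_deriv_def s_def \<alpha>_def \<beta>_def power_mult_distrib power_divide)
  also have "(s powr (1 / p - 1))\<^sup>2 = s powr (- \<theta>)"
  proof -
    have "(1 / p - 1) + (1 / p - 1) = - \<theta>" by (simp add: \<theta>_def)
    then show ?thesis by (simp only: power2_eq_square powr_add[symmetric])
  qed
  finally have "2 * (power_mean_deriv p a b q r)\<^sup>2 = s powr (- \<theta>) * (\<alpha> * q + \<beta> * r)\<^sup>2 / 2" by simp
  also have "\<dots> \<le> s powr (- \<theta>) * ((\<alpha>\<^sup>2 + \<beta>\<^sup>2) * (q\<^sup>2 + r\<^sup>2)) / 2"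
  proof -
    have "(\<alpha>\<^sup>2 + \<beta>\<^sup>2) * (q\<^sup>2 + r\<^sup>2) - (\<alpha> * q + \<beta> * r)\<^sup>2 = (\<alpha> * r - \<beta> * q)\<^sup>2" by algebra
    then have "(\<alpha> * q + \<beta> * r)\<^sup>2 \<le> (\<alpha>\<^sup>2 + \<beta>\<^sup>2) * (q\<^sup>2 + r\<^sup>2)" by (smt (verit) zero_le_power2)
    then show ?thesis by (intro divide_right_mono mult_left_mono) auto
  qed
  also have "\<dots> = \<kappa> * (q\<^sup>2 + r\<^sup>2)" by (simp add: \<kappa>_def)
  finally have le: "2 * (power_mean_deriv p a b q r)\<^sup>2 \<le> \<kappa> * (q\<^sup>2 + r\<^sup>2)" .
  have nn: "0 \<le> q\<^sup>2 + r\<^sup>2" by simp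
  have "\<kappa> * (q\<^sup>2 + r\<^sup>2) \<le> 1 * (q\<^sup>2 + r\<^sup>2)" using \<kappa> nn by (intro mult_right_mono) auto
  with le show "2 * (power_mean_deriv p a b q r)\<^sup>2 \<le> q\<^sup>2 + r\<^sup>2" by simp
  assume "2 * (power_mean_deriv p a b q r)\<^sup>2 = q\<^sup>2 + r\<^sup>2"
  then have "(1 - \<kappa>) * (q\<^sup>2 + r\<^sup>2) \<le> 0" using le by (simp add: algebra_simps)
  then have "q\<^sup>2 + r\<^sup>2 \<le> 0" using \<kappa> by (simp add: mult_le_0_iff)
  then show "q = 0 \<and> r = 0" by (smt (verit) zero_le_power2 power2_eq_iff_nonneg zero_eq_power2)
qed

text \<open>The competitors for the smaller (\<open>c\<close>) and the larger (\<open>\<not> c\<close>) weight: both solutions are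
  replaced by their \<open>p\<close>-mean where they are in the wrong order, \<open>a > b\<close>.\<close>
definition swap_mean :: "real \<Rightarrow> bool \<Rightarrow> real \<Rightarrow> real \<Rightarrow> real" where
  "swap_mean p c a b = (if a > b then power_mean p a b else if c then a else b)"

text \<open>In this form the function is a composition of Lipschitz maps; the piecewise definition
  hides that the branches fit together at \<open>a = b\<close>.\<close>

lemma swap_mean_eq:
  assumes "p > 0" "a \<ge> 0" "b \<ge> 0"
  shows "swap_mean p c a b = (if c then power_mean p a (min a b) else power_mean p (max a b) b)"
  using assms by (auto simp: swap_mean_def power_mean_same min_def max_def)

lemma swap_mean_lipschitz:
  assumes p: "p > 1" and "0 \<le> a" "0 \<le> a'" "0 \<le> b" "0 \<le> b'"
  shows "\<bar>swap_mean p c a b - swap_mean p c a' b'\<bar> \<le> 2 * (\<bar>a - a'\<bar> + \<bar>b - b'\<bar>)"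
proof -
  have p0: "p > 0" using p by simp
  show ?thesis
  proof (cases c)
    case True
    have "\<bar>min a b - min a' b'\<bar> \<le> \<bar>a - a'\<bar> + \<bar>b - b'\<bar>" by (auto simp: min_def)
    then have "\<bar>power_mean p a (min a b) - power_mean p a' (min a' b')\<bar> \<le> 2 * (\<bar>a - a'\<bar> + \<bar>b - b'\<bar>)"
      using power_mean_lipschitz[OF p, of a a' "min a b" "min a' b'"] assms abs_ge_zero[of "a - a'"] abs_ge_zero[of "b - b'"]
      unfolding distrib_left by (smt (verit) min.boundedI max.coboundedI1)
    then show ?thesis using True assms by (simp add: swap_mean_eq[OF p0])
  next
    case False
    have "\<bar>max a b - max a' b'\<bar> \<le> \<bar>a - a'\<bar> + \<bar>b - b'\<bar>" by (auto simp: max_def)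
    then have "\<bar>power_mean p (max a b) b - power_mean p (max a' b') b'\<bar> \<le> 2 * (\<bar>a - a'\<bar> + \<bar>b - b'\<bar>)"
      using power_mean_lipschitz[OF p, of "max a b" "max a' b'" b b'] assms abs_ge_zero[of "a - a'"] abs_ge_zero[of "b - b'"]
      unfolding distrib_left by (smt (verit) min.boundedI max.coboundedI1)
    then show ?thesis using False assms by (simp add: swap_mean_eq[OF p0])
  qed
qed

text \<open>On the diagonal there is a kink, but \<open>q = r\<close> makes \<open>X\<close> and
  \<open>Y\<close> agree to first order. By the Lipschitz bound \<open>Y n\<close> may be replaced
  by \<open>X n\<close> with an error that vanishes after division by \<open>t n\<close>, and for
  equal arguments \<open>swap_mean p c\<close> returns the common value.\<close>

lemma swap_mean_quotient_tendsto:
  assumes p: "p > 1" and a: "a \<ge> 0" "b \<ge> 0" and qr: "a = b \<Longrightarrow> q = r" and t: "t \<longlonglongrightarrow> 0" "\<And>n. t n \<noteq> 0"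
    and X: "(\<lambda>n. (X n - a) / t n) \<longlonglongrightarrow> q" "\<And>n. X n \<ge> 0"
    and Y: "(\<lambda>n. (Y n - b) / t n) \<longlonglongrightarrow> r" "\<And>n. Y n \<ge> 0"
  shows "(\<lambda>n. (swap_mean p c (X n) (Y n) - swap_mean p c a b) / t n) \<longlonglongrightarrow>
    (if a > b then power_mean_deriv p a b q r else if c then q else r)"
proof -
  have lim: "X \<longlonglongrightarrow> a" "Y \<longlonglongrightarrow> b"
    using tendsto_of_quotient_tendsto[OF t X(1)] tendsto_of_quotient_tendsto[OF t Y(1)] .
  then have lim': "(\<lambda>n. X n - Y n) \<longlonglongrightarrow> a - b" by (rule tendsto_diff)
  consider "a > b" | "a < b" | "a = b" by linarith
  then show ?thesis
  proof cases
    case 1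
    have "\<forall>\<^sub>F n in sequentially. X n - Y n > 0" using lim' 1 by (intro order_tendstoD(1)[of _ "a - b"]) auto
    then have ev: "\<forall>\<^sub>F n in sequentially. (power_mean p (X n) (Y n) - power_mean p a b) / t n = (swap_mean p c (X n) (Y n) - swap_mean p c a b) / t n"
      by eventually_elim (use 1 in \<open>simp add: swap_mean_def\<close>)
    have "a > 0" using 1 a by simp
    then show ?thesis
      using Lim_transform_eventually[OF power_mean_quotient_tendsto[OF p _ a(2) t X Y] ev] 1 by simp
  next
    case 2
    have "\<forall>\<^sub>F n in sequentially. X n - Y n < 0" using lim' 2 by (intro order_tendstoD(2)[of _ "a - b"]) auto
    then have ev: "\<forall>\<^sub>F n in sequentially. (if c then (X n - a) / t n else (Y n - b) / t n) = (swap_mean p c (X n) (Y n) - swap_mean p c a b) / t n"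
      by eventually_elim (use 2 in \<open>simp add: swap_mean_def\<close>)
    have "(\<lambda>n. if c then (X n - a) / t n else (Y n - b) / t n) \<longlonglongrightarrow> (if c then q else r)"
      using X Y by simp
    from Lim_transform_eventually[OF this ev] show ?thesis using 2 by simp
  next
    case 3
    have z: "(\<lambda>n. 2 * \<bar>(X n - a) / t n - (Y n - b) / t n\<bar>) \<longlonglongrightarrow> 2 * \<bar>q - r\<bar>" by (intro tendsto_intros X Y)
    have XX: "swap_mean p c (X n) (X n) = X n" for n by (simp add: swap_mean_def)
    have "(\<lambda>n. (swap_mean p c (X n) (Y n) - X n) / t n) \<longlonglongrightarrow> 0"
    proof (rule Lim_null_comparison)
      show "\<forall>\<^sub>F n in sequentially. norm ((swap_mean p c (X n) (Y n) - X n) / t n) \<le> 2 * \<bar>(X n - a) / t n - (Y n - b) / t n\<bar>"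
      proof (rule always_eventually, rule allI)
        fix n
        have "\<bar>swap_mean p c (X n) (Y n) - X n\<bar> \<le> 2 * \<bar>X n - Y n\<bar>"
          using swap_mean_lipschitz[OF p X(2) X(2) Y(2) X(2), of c n n n n] XX[of n] by (simp add: abs_minus_commute)
        then have "\<bar>swap_mean p c (X n) (Y n) - X n\<bar> / \<bar>t n\<bar> \<le> 2 * \<bar>X n - Y n\<bar> / \<bar>t n\<bar>" by (rule divide_right_mono) simp
        moreover have "(X n - a) / t n - (Y n - b) / t n = (X n - Y n) / t n" using 3 by (simp add: diff_divide_distrib)
        ultimately show "norm ((swap_mean p c (X n) (Y n) - X n) / t n) \<le> 2 * \<bar>(X n - a) / t n - (Y n - b) / t n\<bar>" by simp
      qed
      show "(\<lambda>n. 2 * \<bar>(X n - a) / t n - (Y n - b) / t n\<bar>) \<longlonglongrightarrow> 0" using z qr[OF 3] by simp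
    qed
    from tendsto_add[OF this X(1)] have "(\<lambda>n. (swap_mean p c (X n) (Y n) - a) / t n) \<longlonglongrightarrow> q"
      by (simp add: add_divide_distrib[symmetric])
    then show ?thesis using 3 qr[OF 3] by (simp add: swap_mean_def)
  qed
qed

lemma swap_mean_bounds:
  assumes "p > 0" "a \<ge> 0" "b \<ge> 0"
  shows "0 \<le> swap_mean p c a b" "swap_mean p c a b \<le> max a b"
  using assms power_mean_le_max[OF assms] power_mean_nonneg by (auto simp: swap_mean_def)

lemma weak_dderiv_swap_mean:
  fixes u v :: "'a::euclidean_space \<Rightarrow> real"
  assumes p: "p > 1" and u: "weak_dderiv e u g" and v: "weak_dderiv e v h" and nn: "\<And>x. u x \<ge> 0" "\<And>x. v x \<ge> 0"
  shows "weak_dderiv e (\<lambda>x. swap_mean p c (u x) (v x))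
    (\<lambda>x. if u x > v x then power_mean_deriv p (u x) (v x) (g x) (h x) else if c then g x else h x)"
proof -
  have l: "locint u" "locint g" "locint v" "locint h" using u v by (auto simp: weak_dderiv_def)
  note [measurable] = l[THEN locint_measurable]
  have p0: "p > 0" using p by simp
  show ?thesis
  proof (rule weak_dderiv_chain[OF u v, of 1 "{0..} \<times> {0..}" "swap_mean p c" 2])
    show "locint (\<lambda>x. swap_mean p c (u x) (v x))"
    proof (rule locint_bound[OF locint_add[OF l(1,3)]])
      show "(\<lambda>x. swap_mean p c (u x) (v x)) \<in> borel_measurable borel"
        unfolding swap_mean_def power_mean_def by measurable
      show "\<bar>swap_mean p c (u x) (v x)\<bar> \<le> \<bar>u x + v x\<bar>" for x
        using swap_mean_bounds[OF p0 nn(1)[of x] nn(2)[of x], of c] nn[of x] by linarith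
    qed
    show "(\<lambda>x. if u x > v x then power_mean_deriv p (u x) (v x) (g x) (h x) else if c then g x else h x) \<in> borel_measurable borel"
      unfolding power_mean_deriv_def by measurable
    \<comment> \<open>Supplies the first order agreement: the weak derivative of
      \<open>u - v\<close> vanishes almost everywhere on the set where \<open>u = v\<close>.\<close>
    have "AE x in lborel. u x - v x = 0 \<longrightarrow> g x - h x = 0"
      by (rule weak_dderiv_eq_0_on_zero_set[OF weak_dderiv_diff[OF u v]])
    then show "AE x in lborel. \<forall>t X Y. t \<longlonglongrightarrow> 0 \<longrightarrow> (\<forall>n. 0 < 1 * t n) \<longrightarrow> (\<forall>n. (X n, Y n) \<in> {0..} \<times> {0..}) \<longrightarrow>
      (\<lambda>n. (X n - u x) / t n) \<longlonglongrightarrow> g x \<longrightarrow> (\<lambda>n. (Y n - v x) / t n) \<longlonglongrightarrow> h x \<longrightarrow>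
      (\<lambda>n. (swap_mean p c (X n) (Y n) - swap_mean p c (u x) (v x)) / t n) \<longlonglongrightarrow>
      (if u x > v x then power_mean_deriv p (u x) (v x) (g x) (h x) else if c then g x else h x)"
    proof eventually_elim
      case (elim x)
      show ?case
      proof (intro allI impI)
        fix t X Y :: "nat \<Rightarrow> real"
        assume a: "t \<longlonglongrightarrow> 0" "\<forall>n. 0 < 1 * t n" "\<forall>n. (X n, Y n) \<in> {0..} \<times> {0..}"
          "(\<lambda>n. (X n - u x) / t n) \<longlonglongrightarrow> g x" "(\<lambda>n. (Y n - v x) / t n) \<longlonglongrightarrow> h x"
        have t0: "t n \<noteq> 0" for n using a(2)[rule_format, of n] by simp
        show "(\<lambda>n. (swap_mean p c (X n) (Y n) - swap_mean p c (u x) (v x)) / t n) \<longlonglongrightarrow>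
          (if u x > v x then power_mean_deriv p (u x) (v x) (g x) (h x) else if c then g x else h x)"
          by (rule swap_mean_quotient_tendsto[OF p nn _ a(1) t0 a(4) _ a(5)]) (use elim a(3) in auto)
      qed
    qed
    show "\<bar>swap_mean p c a b - swap_mean p c a' b'\<bar> \<le> 2 * (\<bar>a - a'\<bar> + \<bar>b - b'\<bar>)"
      if "(a, b) \<in> {0..} \<times> {0..}" "(a', b') \<in> {0..} \<times> {0..}" for a b a' b'
      using that by (intro swap_mean_lipschitz[OF p]) auto
  qed (use nn in auto)
qed

section \<open>Borel representatives and the energy\<close>

lemma locally_integrable_measurable:
  fixes f :: "'a::euclidean_space \<Rightarrow> 'b::euclidean_space"
  assumes "locally_integrable f" shows "f \<in> borel_measurable lebesgue"
proof (rule borel_measurable_LIMSEQ_metric)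
  fix i :: nat
  have "f absolutely_integrable_on cball 0 (real i)"
    using assms by (simp add: locally_integrable_def)
  then show "(\<lambda>x. indicator (cball 0 (real i)) x *\<^sub>R f x) \<in> borel_measurable lebesgue"
    unfolding set_integrable_def by (rule borel_measurable_integrable)
next
  fix x :: 'a
  obtain N where N: "norm x \<le> real N" using real_arch_simple by blast
  have "\<forall>\<^sub>F i in sequentially. indicator (cball 0 (real i)) x *\<^sub>R f x = f x"
    unfolding eventually_sequentially by (rule exI[of _ N]) (use N in auto)
  then show "(\<lambda>i. indicator (cball 0 (real i)) x *\<^sub>R f x) \<longlonglongrightarrow> f x"
    by (rule tendsto_eventually)
qed

lemma lebesgue_AE_iff: "(AE x in lebesgue. P x) \<longleftrightarrow> (AE x in lborel. P x)"
  by (rule AE_completion_iff)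

lemma lborel_measurable_lebesgue: "f \<in> borel_measurable borel \<Longrightarrow> f \<in> borel_measurable lebesgue"
  by (rule measurable_completion) simp

text \<open>Passage from the completed measure of the statement to \<open>lborel\<close>, on which
  the calculus above is built.\<close>

lemma integral_lebesgue_cong_lborel:
  fixes f f' :: "'a::euclidean_space \<Rightarrow> real"
  assumes f: "f \<in> borel_measurable lebesgue" and f': "f' \<in> borel_measurable borel"
    and eq: "AE x in lborel. f x = f' x"
  shows "(LINT x|lebesgue. f x) = (LINT x|lborel. f' x)"
    and "integrable lebesgue f \<longleftrightarrow> integrable lborel f'"
proof -
  have f'l: "f' \<in> borel_measurable lebesgue" by (rule lborel_measurable_lebesgue[OF f'])
  have eq': "AE x in lebesgue. f x = f' x" using eq by (simp add: lebesgue_AE_iff)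
  have f'm: "f' \<in> borel_measurable lborel" using f' by simp
  show "(LINT x|lebesgue. f x) = (LINT x|lborel. f' x)"
    using integral_cong_AE[OF f f'l eq'] integral_completion[OF f'm] by simp
  show "integrable lebesgue f \<longleftrightarrow> integrable lborel f'"
    using integrable_cong_AE[OF f f'l eq'] integrable_completion[OF f'm] by simp
qed

lemma ex_borel_representative:
  fixes f :: "'a::euclidean_space \<Rightarrow> real"
  assumes "f \<in> borel_measurable lebesgue"
  shows "\<exists>f'\<in>borel_measurable borel. AE x in lborel. f x = f' x"
  using completion_ex_borel_measurable_real[OF assms] by auto

lemma locally_integrable_iff_locint:
  fixes f f' :: "'a::euclidean_space \<Rightarrow> real"
  assumes f: "f \<in> borel_measurable lebesgue" and f': "f' \<in> borel_measurable borel"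
    and eq: "AE x in lborel. f x = f' x"
  shows "locally_integrable f \<longleftrightarrow> locint f'"
proof -
  have *: "f absolutely_integrable_on C \<longleftrightarrow> integrable lborel (\<lambda>x. indicator C x * f' x)" if "compact C" for C
  proof -
    have C: "C \<in> sets borel" using that by (simp add: borel_compact)
    then have Cl: "C \<in> sets lebesgue" by simp
    show ?thesis
      unfolding set_integrable_def
    proof (rule integral_lebesgue_cong_lborel(2))
      note f[measurable] f'[measurable] C[measurable] Cl[measurable]
      show "(\<lambda>x. indicator C x *\<^sub>R f x) \<in> borel_measurable lebesgue" by measurable
      show "(\<lambda>x. indicator C x * f' x) \<in> borel_measurable borel" by measurable
      show "AE x in lborel. indicator C x *\<^sub>R f x = indicator C x * f' x" using eq by eventually_elim simp
    qed
  qed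
  show ?thesis
  proof
    assume "locally_integrable f"
    then show "locint f'"
      using * by (intro locintI f') (simp add: locally_integrable_def)
  next
    assume l: "locint f'"
    show "locally_integrable f"
      unfolding locally_integrable_def
    proof (intro allI impI)
      fix C :: "'a set" assume C: "compact C"
      then obtain r where r: "C \<subseteq> cball 0 r"
        using bounded_subset_ballD[OF compact_imp_bounded[OF C], of 0] ball_subset_cball by blast
      have [measurable]: "C \<in> sets borel" using C by (simp add: borel_compact)
      note f'[measurable]
      have "integrable lborel (\<lambda>x. indicator C x * f' x)"
      proof (rule Bochner_Integration.integrable_bound[OF locint_integrable_cball[OF l, of r]])
        show "AE x in lborel. norm (indicator C x * f' x) \<le> norm (indicator (cball 0 r) x * f' x)"
          using r by (intro AE_I2) (auto simp: indicator_def)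
      qed measurable
      then show "f absolutely_integrable_on C" using *[OF C] by simp
    qed
  qed
qed

lemma test_function_measurable:
  assumes "test_function \<phi>"
  shows "\<phi> \<in> borel_measurable borel" "(\<lambda>x. frechet_derivative \<phi> (at x) e) \<in> borel_measurable borel"
  using test_function_continuous[OF assms] by (auto intro: borel_measurable_continuous_onI)

lemma weak_dderiv_if_has_weak_gradient:
  fixes u u' g :: "'a::euclidean_space \<Rightarrow> real"
  assumes w: "has_weak_gradient u G"
    and u': "u' \<in> borel_measurable borel" "AE x in lborel. u x = u' x"
    and g: "g \<in> borel_measurable borel" "AE x in lborel. G x \<bullet> b = g x"
  shows "weak_dderiv b u' g"
proof -
  have lu: "locally_integrable u" and lG: "locally_integrable G" using w by (auto simp: has_weak_gradient_def)
  have um: "u \<in> borel_measurable lebesgue" by (rule locally_integrable_measurable[OF lu])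
  have Gm: "G \<in> borel_measurable lebesgue" by (rule locally_integrable_measurable[OF lG])
  have Gbm: "(\<lambda>x. G x \<bullet> b) \<in> borel_measurable lebesgue" using Gm by measurable
  have lGb: "locally_integrable (\<lambda>x. G x \<bullet> b)"
    unfolding locally_integrable_def
  proof (intro allI impI)
    fix C :: "'a set" assume "compact C"
    then have "G absolutely_integrable_on C" using lG by (simp add: locally_integrable_def)
    then have "integrable lebesgue (\<lambda>x. (indicator C x *\<^sub>R G x) \<bullet> b)"
      unfolding set_integrable_def by (rule integrable_inner_left)
    then show "(\<lambda>x. G x \<bullet> b) absolutely_integrable_on C" by (simp add: set_integrable_def)
  qed
  show ?thesis
    unfolding weak_dderiv_def
  proof (intro conjI allI impI)
    show "locint u'" using locally_integrable_iff_locint[OF um u'] lu by simp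
    show "locint g" using locally_integrable_iff_locint[OF Gbm g] lGb by simp
    fix \<phi> :: "'a \<Rightarrow> real" assume \<phi>: "test_function \<phi>"
    note pm[measurable] = test_function_measurable(1)[OF \<phi>] test_function_measurable(2)[OF \<phi>, of b]
    note pl[measurable] = pm[THEN lborel_measurable_lebesgue]
    note u'(1)[measurable] g(1)[measurable] um[measurable] Gbm[measurable]
    have "(LINT x|lebesgue. u x * frechet_derivative \<phi> (at x) b) = (LINT x|lborel. u' x * frechet_derivative \<phi> (at x) b)"
    proof (rule integral_lebesgue_cong_lborel(1))
      show "AE x in lborel. u x * frechet_derivative \<phi> (at x) b = u' x * frechet_derivative \<phi> (at x) b"
        using u'(2) by eventually_elim simp
    qed measurable
    moreover have "(LINT x|lebesgue. \<phi> x * (G x \<bullet> b)) = (LINT x|lborel. g x * \<phi> x)"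
    proof (rule integral_lebesgue_cong_lborel(1))
      show "AE x in lborel. \<phi> x * (G x \<bullet> b) = g x * \<phi> x"
        using g(2) by eventually_elim simp
    qed measurable
    ultimately show "(LINT x|lborel. u' x * frechet_derivative \<phi> (at x) b) = - (LINT x|lborel. g x * \<phi> x)"
      using w \<phi> by (simp add: has_weak_gradient_def)
  qed
qed

lemma has_weak_gradient_if_weak_dderiv:
  fixes u u' :: "'a::euclidean_space \<Rightarrow> real"
  assumes u: "u \<in> borel_measurable lebesgue" "AE x in lborel. u x = u' x"
    and w: "\<And>b. b \<in> Basis \<Longrightarrow> weak_dderiv b u' (g b)"
  shows "has_weak_gradient u (\<lambda>x. \<Sum>b\<in>Basis. g b x *\<^sub>R b)"
proof -
  have lg: "locint (g b)" if "b \<in> Basis" for b using w[OF that] by (simp add: weak_dderiv_def)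
  obtain b0 :: 'a where "b0 \<in> Basis" using nonempty_Basis by blast
  then have lu: "locint u'" using w[of b0] by (simp add: weak_dderiv_def)
  note u'm[measurable] = locint_measurable[OF lu]
  have gm: "g b \<in> borel_measurable borel" if "b \<in> Basis" for b by (rule locint_measurable[OF lg[OF that]])
  let ?G = "\<lambda>x. \<Sum>b\<in>Basis. g b x *\<^sub>R b"
  show ?thesis
    unfolding has_weak_gradient_def
  proof (intro conjI allI impI)
    show "locally_integrable u" using locally_integrable_iff_locint[OF u(1) u'm u(2)] lu by simp
    show "locally_integrable ?G"
      unfolding locally_integrable_def
    proof (intro allI impI)
      fix C :: "'a set" assume C: "compact C"
      have "g b absolutely_integrable_on C" if "b \<in> Basis" for b
        using locally_integrable_iff_locint[OF lborel_measurable_lebesgue[OF gm[OF that]] gm[OF that]] lg[OF that] C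
        by (simp add: locally_integrable_def)
      then show "?G absolutely_integrable_on C"
        by (intro absolutely_integrable_sum absolutely_integrable_scaleR_right finite_Basis)
    qed
    fix \<phi> :: "'a \<Rightarrow> real" and v assume \<phi>: "test_function \<phi>"
    have pm: "\<phi> \<in> borel_measurable borel" by (rule test_function_measurable(1)[OF \<phi>])
    have iu: "integrable lborel (\<lambda>x. u' x * frechet_derivative \<phi> (at x) b)" for b
      by (rule test_function_integrable(2)[OF lu \<phi>])
    have ig: "integrable lborel (\<lambda>x. g b x * \<phi> x)" if "b \<in> Basis" for b
      by (rule test_function_integrable(1)[OF lg[OF that] \<phi>])
    \<comment> \<open>The definition tests every direction \<open>v\<close>; linearity of the
      derivative of the test function reduces this to the basis directions.\<close>
    have lin: "frechet_derivative \<phi> (at x) v = (\<Sum>b\<in>Basis. (v \<bullet> b) * frechet_derivative \<phi> (at x) b)" for x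
    proof -
      have l: "linear (frechet_derivative \<phi> (at x))"
        using test_function_derivative[OF \<phi>] by (rule has_derivative_linear)
      have "frechet_derivative \<phi> (at x) v = frechet_derivative \<phi> (at x) (\<Sum>b\<in>Basis. (v \<bullet> b) *\<^sub>R b)"
        by (simp add: euclidean_representation)
      then show ?thesis by (simp add: linear_sum[OF l] linear_cmul[OF l])
    qed
    have inner: "?G x \<bullet> v = (\<Sum>b\<in>Basis. (v \<bullet> b) * g b x)" for x
      by (simp add: inner_sum_left inner_commute[of v] mult.commute)
    have dm: "(\<lambda>x. frechet_derivative \<phi> (at x) v) \<in> borel_measurable borel"
      by (rule test_function_measurable(2)[OF \<phi>])
    have "(LINT x|lebesgue. u x * frechet_derivative \<phi> (at x) v) = (LINT x|lborel. u' x * frechet_derivative \<phi> (at x) v)"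
    proof (rule integral_lebesgue_cong_lborel(1))
      show "(\<lambda>x. u x * frechet_derivative \<phi> (at x) v) \<in> borel_measurable lebesgue"
        by (intro borel_measurable_times u(1) lborel_measurable_lebesgue dm)
      show "(\<lambda>x. u' x * frechet_derivative \<phi> (at x) v) \<in> borel_measurable borel"
        by (intro borel_measurable_times u'm dm)
      show "AE x in lborel. u x * frechet_derivative \<phi> (at x) v = u' x * frechet_derivative \<phi> (at x) v"
        using u(2) by eventually_elim simp
    qed
    also have "\<dots> = (LINT x|lborel. (\<Sum>b\<in>Basis. (v \<bullet> b) * (u' x * frechet_derivative \<phi> (at x) b)))"
      unfolding lin by (simp add: sum_distrib_left mult.left_commute)
    also have "\<dots> = (\<Sum>b\<in>Basis. (v \<bullet> b) * (LINT x|lborel. u' x * frechet_derivative \<phi> (at x) b))"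
      using iu by simp
    also have "\<dots> = (\<Sum>b\<in>Basis. (v \<bullet> b) * - (LINT x|lborel. g b x * \<phi> x))"
      using w \<phi> by (intro sum.cong refl) (simp add: weak_dderiv_def)
    also have "\<dots> = - (LINT x|lborel. (\<Sum>b\<in>Basis. (v \<bullet> b) * (g b x * \<phi> x)))"
      using ig by (simp add: sum_negf)
    also have "(LINT x|lborel. (\<Sum>b\<in>Basis. (v \<bullet> b) * (g b x * \<phi> x))) = (LINT x|lborel. \<phi> x * (?G x \<bullet> v))"
      unfolding inner by (simp add: sum_distrib_left ac_simps)
    also have "(LINT x|lborel. \<phi> x * (?G x \<bullet> v)) = (LINT x|lebesgue. \<phi> x * (?G x \<bullet> v))"
      by (rule integral_completion[symmetric]) (use gm pm in \<open>auto intro!: borel_measurable_times borel_measurable_inner borel_measurable_sum borel_measurable_scaleR\<close>)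
    finally show "(LINT x|lebesgue. u x * frechet_derivative \<phi> (at x) v) = - (LINT x|lebesgue. \<phi> x * (?G x \<bullet> v))" .
  qed
qed

text \<open>Carries the gradient as an explicit family \<open>g\<close> of Borel functions indexed
  by basis vectors, in place of the choice made by \<open>weak_gradient\<close>. Competitors can
  then be given together with their derivatives.\<close>

definition Xp_borel :: "real \<Rightarrow> ('a::euclidean_space \<Rightarrow> real) \<Rightarrow> ('a \<Rightarrow> 'a \<Rightarrow> real) \<Rightarrow> bool" where
  "Xp_borel p u g \<longleftrightarrow>
     (\<forall>b\<in>Basis. weak_dderiv b u (g b) \<and> integrable lborel (\<lambda>x. (g b x)\<^sup>2)) \<and>
     integrable lborel (\<lambda>x. \<bar>u x\<bar> powr (2 * real DIM('a) / (real DIM('a) - 2))) \<and>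
     integrable lborel (\<lambda>x. \<bar>u x\<bar> powr p)"

definition energy_borel :: "real \<Rightarrow> 'a::euclidean_space set \<Rightarrow> ('a \<Rightarrow> real) \<Rightarrow> ('a \<Rightarrow> 'a \<Rightarrow> real) \<Rightarrow> real" where
  "energy_borel p \<Omega> u g = 1 / 2 * (\<Sum>b\<in>Basis. LINT x|lborel. (g b x)\<^sup>2)
     - 1 / p * (LINT x|lborel. Q_weight \<Omega> x * \<bar>u x\<bar> powr p)"

lemma Xp_borel_locint: "Xp_borel p u g \<Longrightarrow> locint u" "Xp_borel p u g \<Longrightarrow> b \<in> Basis \<Longrightarrow> locint (g b)"
  using nonempty_Basis unfolding Xp_borel_def weak_dderiv_def by blast+

lemma norm_square_eq_sum_Basis: "(norm (x::'a::euclidean_space))\<^sup>2 = (\<Sum>b\<in>Basis. (x \<bullet> b)\<^sup>2)"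
  unfolding power2_norm_eq_inner by (subst euclidean_inner) (simp add: power2_eq_square)

lemma Xp_space_borel_representative:
  fixes u u' :: "'a::euclidean_space \<Rightarrow> real"
  assumes u: "u \<in> Xp_space p" and u': "u' \<in> borel_measurable borel" "AE x in lborel. u x = u' x"
  shows "\<exists>g. Xp_borel p u' g"
proof -
  have um: "u \<in> borel_measurable lebesgue" using u by (simp add: Xp_space_def Lp_space_def)
  obtain G where G: "G \<in> Lp_space 2" "has_weak_gradient u G" using u by (auto simp: Xp_space_def D12_def)
  have Gm[measurable]: "G \<in> borel_measurable lebesgue" using G(1) by (simp add: Lp_space_def)
  have "\<forall>b. \<exists>g. g \<in> borel_measurable borel \<and> (AE x in lborel. G x \<bullet> b = g x)"
  proof
    fix b
    have "(\<lambda>x. G x \<bullet> b) \<in> borel_measurable lebesgue" by measurable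
    then show "\<exists>g. g \<in> borel_measurable borel \<and> (AE x in lborel. G x \<bullet> b = g x)"
      using ex_borel_representative by blast
  qed
  from choice[OF this] obtain g where g: "\<And>b. g b \<in> borel_measurable borel" "\<And>b. AE x in lborel. G x \<bullet> b = g b x"
    by blast
  note g(1)[measurable] u'(1)[measurable] um[measurable]
  have pw: "integrable lborel (\<lambda>x. \<bar>u' x\<bar> powr q)" if "u \<in> Lp_space q" for q
  proof -
    have "integrable lebesgue (\<lambda>x. norm (u x) powr q) \<longleftrightarrow> integrable lborel (\<lambda>x. \<bar>u' x\<bar> powr q)"
    proof (rule integral_lebesgue_cong_lborel(2))
      show "AE x in lborel. norm (u x) powr q = \<bar>u' x\<bar> powr q" using u'(2) by eventually_elim simp
    qed measurable
    then show ?thesis using that by (simp add: Lp_space_def)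
  qed
  have "integrable lborel (\<lambda>x. (g b x)\<^sup>2)" if b: "b \<in> Basis" for b
  proof -
    have i: "integrable lebesgue (\<lambda>x. norm (G x) powr 2)" using G(1) by (simp add: Lp_space_def)
    have "integrable lebesgue (\<lambda>x. (G x \<bullet> b)\<^sup>2)"
    proof (rule Bochner_Integration.integrable_bound[OF i])
      have "(G x \<bullet> b)\<^sup>2 \<le> norm (G x) powr 2" for x
      proof -
        have "\<bar>G x \<bullet> b\<bar> \<le> norm (G x)" by (rule Basis_le_norm[OF b])
        then have "\<bar>G x \<bullet> b\<bar>\<^sup>2 \<le> (norm (G x))\<^sup>2" by (intro power_mono) auto
        then show ?thesis by simp
      qed
      then show "AE x in lebesgue. norm ((G x \<bullet> b)\<^sup>2) \<le> norm (norm (G x) powr 2)" by simp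
    qed measurable
    moreover have "integrable lebesgue (\<lambda>x. (G x \<bullet> b)\<^sup>2) \<longleftrightarrow> integrable lborel (\<lambda>x. (g b x)\<^sup>2)"
    proof (rule integral_lebesgue_cong_lborel(2))
      show "AE x in lborel. (G x \<bullet> b)\<^sup>2 = (g b x)\<^sup>2" using g(2)[of b] by eventually_elim simp
    qed measurable
    ultimately show ?thesis by simp
  qed
  moreover have "weak_dderiv b u' (g b)" for b
    by (rule weak_dderiv_if_has_weak_gradient[OF G(2) u' g])
  ultimately have "Xp_borel p u' g"
    using u pw by (auto simp: Xp_borel_def Xp_space_def D12_def)
  then show ?thesis by blast
qed

lemma Xp_space_if_Xp_borel:
  fixes u u' :: "'a::euclidean_space \<Rightarrow> real"
  assumes x: "Xp_borel p u' g" and u: "u \<in> borel_measurable lebesgue" "AE x in lborel. u x = u' x"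
  shows "u \<in> Xp_space p" and "\<Omega> \<in> sets borel \<Longrightarrow> energy p \<Omega> u = energy_borel p \<Omega> u' g"
proof -
  have w: "weak_dderiv b u' (g b)" and i2: "integrable lborel (\<lambda>x. (g b x)\<^sup>2)" if "b \<in> Basis" for b
    using x that by (auto simp: Xp_borel_def)
  note u'm[measurable] = locint_measurable[OF Xp_borel_locint(1)[OF x]]
  have gm: "g b \<in> borel_measurable borel" if "b \<in> Basis" for b
    by (rule locint_measurable[OF Xp_borel_locint(2)[OF x that]])
  let ?G = "\<lambda>x. \<Sum>b\<in>Basis. g b x *\<^sub>R b"
  have Gm: "?G \<in> borel_measurable borel" using gm by (intro borel_measurable_sum borel_measurable_scaleR) auto
  have hG: "has_weak_gradient u ?G" by (rule has_weak_gradient_if_weak_dderiv[OF u w])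
  have nG: "(norm (?G x))\<^sup>2 = (\<Sum>b\<in>Basis. (g b x)\<^sup>2)" for x
    unfolding norm_square_eq_sum_Basis
    by (intro sum.cong refl) (simp add: inner_sum_left inner_Basis if_distrib cong: if_cong)
  have isum: "integrable lborel (\<lambda>x. \<Sum>b\<in>Basis. (g b x)\<^sup>2)" using i2 by (intro Bochner_Integration.integrable_sum)
  have pw: "u \<in> Lp_space q" if "integrable lborel (\<lambda>x. \<bar>u' x\<bar> powr q)" for q
  proof -
    note u(1)[measurable]
    have "integrable lebesgue (\<lambda>x. norm (u x) powr q) \<longleftrightarrow> integrable lborel (\<lambda>x. \<bar>u' x\<bar> powr q)"
    proof (rule integral_lebesgue_cong_lborel(2))
      show "AE x in lborel. norm (u x) powr q = \<bar>u' x\<bar> powr q" using u(2) by eventually_elim simp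
    qed measurable
    then show ?thesis using that u(1) by (simp add: Lp_space_def)
  qed
  have "?G \<in> Lp_space 2"
  proof -
    have "integrable lborel (\<lambda>x. norm (?G x) powr 2)" using isum by (simp add: nG)
    then have "integrable lebesgue (\<lambda>x. norm (?G x) powr 2)" using Gm by (subst integrable_completion) simp_all
    then show ?thesis using lborel_measurable_lebesgue[OF Gm] by (simp add: Lp_space_def)
  qed
  then show "u \<in> Xp_space p"
    using pw hG x unfolding Xp_space_def D12_def Xp_borel_def by blast
  assume \<Omega>: "\<Omega> \<in> sets borel"
  \<comment> \<open>\<open>weak_gradient\<close> picks some weak gradient; uniqueness in each basis
    direction identifies its components with \<open>g\<close> almost everywhere, so the energy does
    not depend on the pick.\<close>
  define W where "W = weak_gradient u"
  have hW: "has_weak_gradient u W"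
    unfolding W_def weak_gradient_def by (rule someI[of _ ?G]) (rule hG)
  have Wm: "W \<in> borel_measurable lebesgue"
    using hW by (intro locally_integrable_measurable) (simp add: has_weak_gradient_def)
  have "AE x in lborel. W x \<bullet> b = g b x" if b: "b \<in> Basis" for b
  proof -
    have "(\<lambda>x. W x \<bullet> b) \<in> borel_measurable lebesgue" using Wm by measurable
    then obtain k where k: "k \<in> borel_measurable borel" "AE x in lborel. W x \<bullet> b = k x"
      using ex_borel_representative by blast
    have "weak_dderiv b u' k" by (rule weak_dderiv_if_has_weak_gradient[OF hW u'm u(2) k])
    from weak_dderiv_unique[OF this w[OF b]] k(2) show ?thesis by eventually_elim simp
  qed
  then have "AE x in lborel. \<forall>b\<in>Basis. W x \<bullet> b = g b x" by (intro AE_finite_allI finite_Basis)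
  then have eq: "AE x in lborel. (norm (W x))\<^sup>2 = (\<Sum>b\<in>Basis. (g b x)\<^sup>2)"
    by eventually_elim (simp add: norm_square_eq_sum_Basis)
  have "(LINT x|lebesgue. (norm (W x))\<^sup>2) = (LINT x|lborel. (\<Sum>b\<in>Basis. (g b x)\<^sup>2))"
    by (rule integral_lebesgue_cong_lborel(1)[OF _ _ eq]) (use Wm gm in measurable)
  also have "\<dots> = (\<Sum>b\<in>Basis. LINT x|lborel. (g b x)\<^sup>2)" using i2 by simp
  finally have 1: "(LINT x|lebesgue. (norm (W x))\<^sup>2) = (\<Sum>b\<in>Basis. LINT x|lborel. (g b x)\<^sup>2)" .
  have Qm: "Q_weight \<Omega> \<in> borel_measurable borel" unfolding Q_weight_def[abs_def] using \<Omega> by measurable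
  have 2: "(LINT x|lebesgue. Q_weight \<Omega> x * \<bar>u x\<bar> powr p) = (LINT x|lborel. Q_weight \<Omega> x * \<bar>u' x\<bar> powr p)"
  proof (rule integral_lebesgue_cong_lborel(1))
    note u(1)[measurable] Qm[measurable] lborel_measurable_lebesgue[OF Qm, measurable]
    show "(\<lambda>x. Q_weight \<Omega> x * \<bar>u x\<bar> powr p) \<in> borel_measurable lebesgue" by measurable
    show "(\<lambda>x. Q_weight \<Omega> x * \<bar>u' x\<bar> powr p) \<in> borel_measurable borel" by measurable
    show "AE x in lborel. Q_weight \<Omega> x * \<bar>u x\<bar> powr p = Q_weight \<Omega> x * \<bar>u' x\<bar> powr p"
      using u(2) by eventually_elim simp
  qed
  show "energy p \<Omega> u = energy_borel p \<Omega> u' g"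
    unfolding energy_def energy_borel_def 1[unfolded W_def] 2 ..
qed

section \<open>Comparison of minimizers\<close>

lemma Xp_borel_swap_mean:
  fixes u v :: "'a::euclidean_space \<Rightarrow> real"
  assumes d: "DIM('a) \<ge> 3" and p: "1 < p" "p < 2" and u: "Xp_borel p u g" and v: "Xp_borel p v h"
    and nn: "\<And>x. u x \<ge> 0" "\<And>x. v x \<ge> 0"
  shows "Xp_borel p (\<lambda>x. swap_mean p c (u x) (v x))
    (\<lambda>b x. if u x > v x then power_mean_deriv p (u x) (v x) (g b x) (h b x) else if c then g b x else h b x)"
proof -
  have p0: "p > 0" using p by simp
  note [measurable] = locint_measurable[OF Xp_borel_locint(1)[OF u]] locint_measurable[OF Xp_borel_locint(1)[OF v]]
  have swm[measurable]: "(\<lambda>x. swap_mean p c (u x) (v x)) \<in> borel_measurable borel"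
    unfolding swap_mean_def power_mean_def by measurable
  have pw: "integrable lborel (\<lambda>x. \<bar>swap_mean p c (u x) (v x)\<bar> powr q)"
    if q: "q \<ge> 0" and i: "integrable lborel (\<lambda>x. \<bar>u x\<bar> powr q)" "integrable lborel (\<lambda>x. \<bar>v x\<bar> powr q)" for q
  proof (rule Bochner_Integration.integrable_bound[OF Bochner_Integration.integrable_add[OF i]])
    have "\<bar>swap_mean p c (u x) (v x)\<bar> powr q \<le> \<bar>u x\<bar> powr q + \<bar>v x\<bar> powr q" for x
    proof -
      have "\<bar>swap_mean p c (u x) (v x)\<bar> powr q \<le> max (u x) (v x) powr q"
        using swap_mean_bounds[OF p0 nn(1)[of x] nn(2)[of x], of c] q by (intro powr_mono2) auto
      also have "\<dots> \<le> \<bar>u x\<bar> powr q + \<bar>v x\<bar> powr q" using nn[of x] by (simp add: max_def)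
      finally show ?thesis .
    qed
    then show "AE x in lborel. norm (\<bar>swap_mean p c (u x) (v x)\<bar> powr q) \<le> norm (\<bar>u x\<bar> powr q + \<bar>v x\<bar> powr q)"
      by simp
  qed measurable
  have "integrable lborel (\<lambda>x. (if u x > v x then power_mean_deriv p (u x) (v x) (g b x) (h b x) else if c then g b x else h b x)\<^sup>2)"
    if b: "b \<in> Basis" for b
  proof -
    have i: "integrable lborel (\<lambda>x. (g b x)\<^sup>2)" "integrable lborel (\<lambda>x. (h b x)\<^sup>2)"
      using u v b by (auto simp: Xp_borel_def)
    note [measurable] = locint_measurable[OF Xp_borel_locint(2)[OF u b]] locint_measurable[OF Xp_borel_locint(2)[OF v b]]
    show ?thesis
    proof (rule Bochner_Integration.integrable_bound[OF Bochner_Integration.integrable_add[OF i]])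
      have "(if u x > v x then power_mean_deriv p (u x) (v x) (g b x) (h b x) else if c then g b x else h b x)\<^sup>2 \<le> (g b x)\<^sup>2 + (h b x)\<^sup>2" for x
      proof (cases "u x > v x")
        case True
        then show ?thesis
          using power_mean_deriv_square(1)[OF p nn(2)[of x] True, of "g b x" "h b x"]
            zero_le_power2[of "power_mean_deriv p (u x) (v x) (g b x) (h b x)"] by (simp only: if_True)
      qed simp
      then show "AE x in lborel. norm ((if u x > v x then power_mean_deriv p (u x) (v x) (g b x) (h b x) else if c then g b x else h b x)\<^sup>2) \<le> norm ((g b x)\<^sup>2 + (h b x)\<^sup>2)"
        by simp
    qed (unfold power_mean_deriv_def, measurable)
  qed
  moreover have "weak_dderiv b (\<lambda>x. swap_mean p c (u x) (v x))
    (\<lambda>x. if u x > v x then power_mean_deriv p (u x) (v x) (g b x) (h b x) else if c then g b x else h b x)"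
    if "b \<in> Basis" for b
    using u v that by (intro weak_dderiv_swap_mean[OF p(1) _ _ nn]) (auto simp: Xp_borel_def)
  \<comment> \<open>The dimension bound makes the critical exponent nonnegative, as monotonicity of
    \<open>powr\<close> in the base requires.\<close>
  moreover have "integrable lborel (\<lambda>x. \<bar>swap_mean p c (u x) (v x)\<bar> powr (2 * real DIM('a) / (real DIM('a) - 2)))"
    using u v d by (intro pw) (auto simp: Xp_borel_def)
  moreover have "integrable lborel (\<lambda>x. \<bar>swap_mean p c (u x) (v x)\<bar> powr p)"
    using u v p by (intro pw) (auto simp: Xp_borel_def)
  ultimately show ?thesis unfolding Xp_borel_def by blast
qed

text \<open>By the line integral formula \<open>z\<close> is invariant under translations in the direction \<open>e\<close>.\<close>
lemma AE_zero_if_weak_dderiv_zero: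
  fixes z :: "'a::euclidean_space \<Rightarrow> real"
  assumes z: "weak_dderiv e z (\<lambda>x. 0)" and e: "e \<noteq> 0" and i: "integrable lborel (\<lambda>x. \<bar>z x\<bar> powr p)"
  shows "AE x in lborel. z x = 0"
proof -
  define f where "f x = \<bar>z x\<bar> powr p" for x
  have fi: "integrable lborel f" using i by (simp add: f_def[abs_def])
  note fm[measurable] = borel_measurable_integrable[OF fi, simplified]
  have inv: "AE x in lborel. f (t *\<^sub>R e + x) = f x" for t
    using weak_dderiv_line_integral[OF z, of t] by eventually_elim (simp add: f_def)
  have I: "AE x in lborel. indicator (cball 0 R) x * f x = 0" for R
  proof -
    have [measurable]: "cball 0 R \<in> sets (borel :: 'a measure)" by simp
    \<comment> \<open>The integral of \<open>f\<close> over the ball equals the one over the ball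
      shifted by \<open>- n e\<close>. For growing \<open>n\<close> the shifted ball leaves every
      point behind, and integrability of \<open>f\<close> forces the common value to be
      zero.\<close>
    have eq: "(LINT x|lborel. indicator (cball 0 R) x * f x) = (LINT x|lborel. indicator (cball 0 R) (real n *\<^sub>R e + x) * f x)" for n
    proof -
      have "(LINT x|lborel. indicator (cball 0 R) x * f x) = (LINT x|lborel. indicator (cball 0 R) (real n *\<^sub>R e + x) * f (real n *\<^sub>R e + x))"
        using integral_translate[of "\<lambda>x. indicator (cball 0 R) x * f x" "real n *\<^sub>R e"] by simp
      also have "\<dots> = (LINT x|lborel. indicator (cball 0 R) (real n *\<^sub>R e + x) * f x)"
      proof (rule integral_cong_AE)
        show "AE x in lborel. indicator (cball 0 R) (real n *\<^sub>R e + x) * f (real n *\<^sub>R e + x) = indicator (cball 0 R) (real n *\<^sub>R e + x) * f x"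
          using inv[of "real n"] by eventually_elim simp
      qed measurable
      finally show ?thesis .
    qed
    have "(\<lambda>n. LINT x|lborel. indicator (cball 0 R) (real n *\<^sub>R e + x) * f x) \<longlonglongrightarrow> (LINT x|(lborel :: 'a measure). 0)"
    proof (rule integral_dominated_convergence[where w = f])
      have "(\<lambda>n. indicator (cball 0 R) (real n *\<^sub>R e + x) * f x) \<longlonglongrightarrow> 0" for x
      proof (rule tendsto_eventually)
        obtain N where N: "(R + norm x) / norm e < real N" using reals_Archimedean2 by blast
        have "indicator (cball 0 R) (real n *\<^sub>R e + x) * f x = 0" if "n \<ge> N" for n
        proof -
          have "R + norm x < real N * norm e" using N e by (simp add: field_simps)
          also have "\<dots> \<le> real n * norm e" using that by (intro mult_right_mono) auto
          also have "\<dots> \<le> norm (real n *\<^sub>R e + x) + norm x"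
            using norm_triangle_ineq4[of "real n *\<^sub>R e + x" x] by simp
          finally show ?thesis by simp
        qed
        then show "\<forall>\<^sub>F n in sequentially. indicator (cball 0 R) (real n *\<^sub>R e + x) * f x = 0"
          unfolding eventually_sequentially by blast
      qed
      then show "AE x in lborel. (\<lambda>n. indicator (cball 0 R) (real n *\<^sub>R e + x) * f x) \<longlonglongrightarrow> 0" by simp
      show "AE x in lborel. norm (indicator (cball 0 R) (real n *\<^sub>R e + x) * f x) \<le> f x" for n
        by (auto simp: f_def indicator_def)
    qed (use fi in measurable)
    then have "(LINT x|lborel. indicator (cball 0 R) x * f x) = 0"
      unfolding eq[symmetric] by (simp add: LIMSEQ_const_iff)
    moreover have "integrable lborel (\<lambda>x. indicator (cball 0 R) x * f x)"
      by (rule Bochner_Integration.integrable_bound[OF fi]) (measurable, auto simp: indicator_def)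
    ultimately show ?thesis
      by (subst (asm) integral_nonneg_eq_0_iff_AE) (auto simp: f_def)
  qed
  have "AE x in lborel. \<forall>n. indicator (cball 0 (real n)) x * f x = 0"
    unfolding AE_all_countable by (intro allI I)
  then show ?thesis
  proof eventually_elim
    case (elim x)
    obtain N where "norm x \<le> real N" using real_arch_simple by blast
    then show ?case using elim[rule_format, of N] by (simp add: f_def)
  qed
qed

text \<open>Where \<open>u < v\<close> the quotients of the positive part are eventually zero.
  Elsewhere the weak derivatives agree almost everywhere, on \<open>u = v\<close> automatically, and
  the quotients are bounded by the difference of those of \<open>u\<close> and \<open>v\<close>,
  which tends to zero.\<close>

lemma pos_part_diff_weak_dderiv_zero:
  fixes u v :: "'a::euclidean_space \<Rightarrow> real"
  assumes u: "weak_dderiv e u g" and v: "weak_dderiv e v h"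
    and eq: "AE x in lborel. u x > v x \<longrightarrow> g x = h x"
  shows "weak_dderiv e (\<lambda>x. max 0 (u x - v x)) (\<lambda>x. 0)"
proof (rule weak_dderiv_chain[OF u v, of 1 UNIV "\<lambda>a b. max 0 (a - b)" 1])
  have l: "locint u" "locint v" using u v by (auto simp: weak_dderiv_def)
  note [measurable] = l[THEN locint_measurable]
  show "locint (\<lambda>x. max 0 (u x - v x))"
    by (rule locint_bound[OF locint_diff[OF l]]) auto
  have "AE x in lborel. u x - v x = 0 \<longrightarrow> g x - h x = 0"
    by (rule weak_dderiv_eq_0_on_zero_set[OF weak_dderiv_diff[OF u v]])
  then show "AE x in lborel. \<forall>t X Y. t \<longlonglongrightarrow> 0 \<longrightarrow> (\<forall>n. 0 < 1 * t n) \<longrightarrow> (\<forall>n. (X n, Y n) \<in> UNIV) \<longrightarrow>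
      (\<lambda>n. (X n - u x) / t n) \<longlonglongrightarrow> g x \<longrightarrow> (\<lambda>n. (Y n - v x) / t n) \<longlonglongrightarrow> h x \<longrightarrow>
      (\<lambda>n. (max 0 (X n - Y n) - max 0 (u x - v x)) / t n) \<longlonglongrightarrow> 0"
    using eq
  proof eventually_elim
    case (elim x)
    show ?case
    proof (intro allI impI)
      fix t X Y :: "nat \<Rightarrow> real"
      assume t: "t \<longlonglongrightarrow> 0" "\<forall>n. 0 < 1 * t n"
        and X: "(\<lambda>n. (X n - u x) / t n) \<longlonglongrightarrow> g x" and Y: "(\<lambda>n. (Y n - v x) / t n) \<longlonglongrightarrow> h x"
      have t0: "t n \<noteq> 0" for n using t(2)[rule_format, of n] by simp
      have "X \<longlonglongrightarrow> u x" "Y \<longlonglongrightarrow> v x"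
        using tendsto_of_quotient_tendsto[OF t(1) t0 X] tendsto_of_quotient_tendsto[OF t(1) t0 Y] .
      then have XY: "(\<lambda>n. X n - Y n) \<longlonglongrightarrow> u x - v x" by (rule tendsto_diff)
      show "(\<lambda>n. (max 0 (X n - Y n) - max 0 (u x - v x)) / t n) \<longlonglongrightarrow> 0"
      proof (cases "u x < v x")
        case True
        have "\<forall>\<^sub>F n in sequentially. X n - Y n < 0" using XY True by (intro order_tendstoD(2)[of _ "u x - v x"]) auto
        then have "\<forall>\<^sub>F n in sequentially. (max 0 (X n - Y n) - max 0 (u x - v x)) / t n = 0"
          by eventually_elim (use True in simp)
        then show ?thesis by (rule tendsto_eventually)
      next
        case False
        then have gh: "g x = h x" using elim by (cases "u x = v x") auto
        have z: "(\<lambda>n. \<bar>(X n - u x) / t n - (Y n - v x) / t n\<bar>) \<longlonglongrightarrow> \<bar>g x - h x\<bar>" by (intro tendsto_intros X Y)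
        show ?thesis
        proof (rule Lim_null_comparison)
          show "\<forall>\<^sub>F n in sequentially. norm ((max 0 (X n - Y n) - max 0 (u x - v x)) / t n) \<le> \<bar>(X n - u x) / t n - (Y n - v x) / t n\<bar>"
          proof (rule always_eventually, rule allI)
            fix n
            have "\<bar>max 0 (X n - Y n) - max 0 (u x - v x)\<bar> \<le> \<bar>(X n - u x) - (Y n - v x)\<bar>" by (auto simp: max_def)
            then have "\<bar>max 0 (X n - Y n) - max 0 (u x - v x)\<bar> / \<bar>t n\<bar> \<le> \<bar>(X n - u x) - (Y n - v x)\<bar> / \<bar>t n\<bar>"
              by (rule divide_right_mono) simp
            then show "norm ((max 0 (X n - Y n) - max 0 (u x - v x)) / t n) \<le> \<bar>(X n - u x) / t n - (Y n - v x) / t n\<bar>"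
              by (simp only: diff_divide_distrib[symmetric] real_norm_def abs_divide)
          qed
          show "(\<lambda>n. \<bar>(X n - u x) / t n - (Y n - v x) / t n\<bar>) \<longlonglongrightarrow> 0" using z gh by simp
        qed
      qed
    qed
  qed
qed auto

lemma Q_weight_measurable:
  assumes "\<Omega> \<in> sets borel" shows "Q_weight \<Omega> \<in> borel_measurable borel"
  unfolding Q_weight_def[abs_def] using assms by measurable

lemma integrable_Q_weight:
  assumes "\<Omega> \<in> sets borel" "integrable lborel f" shows "integrable lborel (\<lambda>x. Q_weight \<Omega> x * f x)"
  by (rule Bochner_Integration.integrable_bound[OF assms(2)])
    (use Q_weight_measurable[OF assms(1)] assms(2) in \<open>auto simp: Q_weight_def[abs_def] abs_mult\<close>)

lemma minimizer_comparison:
  fixes u v :: "'a::euclidean_space \<Rightarrow> real"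
  assumes d: "DIM('a) \<ge> 3" and p: "1 < p" "p < 2" and u: "Xp_borel p u g" and v: "Xp_borel p v h"
    and nn: "\<And>x. u x \<ge> 0" "\<And>x. v x \<ge> 0"
    and \<Omega>: "\<Omega>1 \<in> sets borel" "\<Omega>2 \<in> sets borel" "\<Omega>1 \<subseteq> \<Omega>2"
    and minu: "\<And>u' g'. Xp_borel p u' g' \<Longrightarrow> energy_borel p \<Omega>1 u g \<le> energy_borel p \<Omega>1 u' g'"
    and minv: "\<And>u' g'. Xp_borel p u' g' \<Longrightarrow> energy_borel p \<Omega>2 v h \<le> energy_borel p \<Omega>2 u' g'"
  shows "AE x in lborel. u x \<le> v x"
proof -
  have p0: "p > 0" using p by simp
  define U where "U c x = swap_mean p c (u x) (v x)" for c x
  define K where "K c b x = (if u x > v x then power_mean_deriv p (u x) (v x) (g b x) (h b x) else if c then g b x else h b x)" for c b x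
  have XU: "Xp_borel p (U c) (K c)" for c
    using Xp_borel_swap_mean[OF d p u v nn, of c] by (simp add: U_def[abs_def] K_def[abs_def])
  have i2: "integrable lborel (\<lambda>x. (g b x)\<^sup>2)" "integrable lborel (\<lambda>x. (h b x)\<^sup>2)" "integrable lborel (\<lambda>x. (K c b x)\<^sup>2)"
    if "b \<in> Basis" for b c
    using u v XU[of c] that by (auto simp: Xp_borel_def)
  have ip: "integrable lborel (\<lambda>x. \<bar>u x\<bar> powr p)" "integrable lborel (\<lambda>x. \<bar>v x\<bar> powr p)" "integrable lborel (\<lambda>x. \<bar>U c x\<bar> powr p)" for c
    using u v XU[of c] by (auto simp: Xp_borel_def)
  have iQ: "integrable lborel (\<lambda>x. Q_weight \<Omega>1 x * \<bar>u x\<bar> powr p)" "integrable lborel (\<lambda>x. Q_weight \<Omega>2 x * \<bar>v x\<bar> powr p)"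
    "integrable lborel (\<lambda>x. Q_weight \<Omega>1 x * \<bar>U True x\<bar> powr p)" "integrable lborel (\<lambda>x. Q_weight \<Omega>2 x * \<bar>U False x\<bar> powr p)"
    by (intro integrable_Q_weight \<Omega> ip)+
  \<comment> \<open>\<open>D b\<close> and \<open>V\<close> are the decreases of the squared
    derivatives and of the weighted potential when both functions are replaced by their competitors.
    Adding the two minimality inequalities bounds the integrals of the nonnegative
    \<open>D b\<close> by that of the nonpositive \<open>V\<close>, up to positive
    constants.\<close>
  define D where "D b x = (g b x)\<^sup>2 + (h b x)\<^sup>2 - (K True b x)\<^sup>2 - (K False b x)\<^sup>2" for b x
  define V where "V x = Q_weight \<Omega>1 x * \<bar>u x\<bar> powr p + Q_weight \<Omega>2 x * \<bar>v x\<bar> powr p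
     - Q_weight \<Omega>1 x * \<bar>U True x\<bar> powr p - Q_weight \<Omega>2 x * \<bar>U False x\<bar> powr p" for x
  have D0: "D b x \<ge> 0" for b x
    using power_mean_deriv_square(1)[OF p nn(2)[of x], of "u x" "g b x" "h b x"] by (auto simp: D_def K_def)
  have Di: "integrable lborel (D b)" if "b \<in> Basis" for b
    unfolding D_def[abs_def] using i2[OF that] by (intro Bochner_Integration.integrable_add Bochner_Integration.integrable_diff)
  have V0: "V x \<le> 0" for x
  proof (cases "u x > v x")
    case True
    \<comment> \<open>Both competitors have the same \<open>p\<close>-th power here, the average, so
      \<open>V x\<close> collapses to half the product of the gap of the weights and the gap of the
      powers, which have opposite signs.\<close>
    have "\<bar>U c x\<bar> powr p = (u x powr p + v x powr p) / 2" for c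
      using True power_mean_powr[OF p0] power_mean_nonneg[of p "u x" "v x"] by (simp add: U_def swap_mean_def)
    then have "V x = (Q_weight \<Omega>1 x - Q_weight \<Omega>2 x) * (u x powr p - v x powr p) / 2"
      using nn[of x] by (simp add: V_def field_simps)
    moreover have "Q_weight \<Omega>1 x \<le> Q_weight \<Omega>2 x" using \<Omega>(3) by (auto simp: Q_weight_def)
    moreover have "v x powr p \<le> u x powr p" using True nn[of x] p0 by (intro powr_mono2) auto
    ultimately show ?thesis
      using mult_nonpos_nonneg[of "Q_weight \<Omega>1 x - Q_weight \<Omega>2 x" "u x powr p - v x powr p"] by simp
  next
    case False
    then show ?thesis by (simp add: V_def U_def swap_mean_def)
  qed
  have "energy_borel p \<Omega>1 u g + energy_borel p \<Omega>2 v h \<le> energy_borel p \<Omega>1 (U True) (K True) + energy_borel p \<Omega>2 (U False) (K False)"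
    using minu[OF XU] minv[OF XU] by (rule add_mono)
  moreover have "(\<Sum>b\<in>Basis. LINT x|lborel. D b x) = (\<Sum>b\<in>Basis. LINT x|lborel. (g b x)\<^sup>2) + (\<Sum>b\<in>Basis. LINT x|lborel. (h b x)\<^sup>2)
      - (\<Sum>b\<in>Basis. LINT x|lborel. (K True b x)\<^sup>2) - (\<Sum>b\<in>Basis. LINT x|lborel. (K False b x)\<^sup>2)"
    unfolding sum.distrib[symmetric] sum_subtractf[symmetric] D_def using i2 by (intro sum.cong refl) simp
  moreover have "(LINT x|lborel. V x) = (LINT x|lborel. Q_weight \<Omega>1 x * \<bar>u x\<bar> powr p) + (LINT x|lborel. Q_weight \<Omega>2 x * \<bar>v x\<bar> powr p)
      - (LINT x|lborel. Q_weight \<Omega>1 x * \<bar>U True x\<bar> powr p) - (LINT x|lborel. Q_weight \<Omega>2 x * \<bar>U False x\<bar> powr p)"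
    unfolding V_def using iQ by simp
  ultimately have "1 / 2 * (\<Sum>b\<in>Basis. LINT x|lborel. D b x) \<le> 1 / p * (LINT x|lborel. V x)"
    unfolding energy_borel_def by (simp only: right_diff_distrib distrib_left)
  moreover have "(LINT x|lborel. V x) \<le> 0"
  proof -
    have "0 \<le> (LINT x|lborel. - V x)" using V0 by (intro integral_nonneg_AE) simp
    then show ?thesis by simp
  qed
  then have "1 / p * (LINT x|lborel. V x) \<le> 0" using p0 by (simp add: divide_nonpos_pos)
  ultimately have "1 / 2 * (\<Sum>b\<in>Basis. LINT x|lborel. D b x) \<le> 0" by (rule order_trans)
  then have "(\<Sum>b\<in>Basis. LINT x|lborel. D b x) \<le> 0" by simp
  moreover have DI0: "(LINT x|lborel. D b x) \<ge> 0" for b using D0 by (intro integral_nonneg_AE) simp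
  ultimately have "(\<Sum>b\<in>Basis. LINT x|lborel. D b x) = 0" by (simp add: order_antisym sum_nonneg)
  then have DI: "\<forall>b\<in>Basis. (LINT x|lborel. D b x) = 0"
    using sum_nonneg_eq_0_iff[OF finite_Basis, of "\<lambda>b. LINT x|lborel. D b x"] DI0 by blast
  \<comment> \<open>One direction is enough: a function whose \<open>p\<close>-th power is
    integrable and which has one vanishing weak directional derivative is zero almost
    everywhere.\<close>
  obtain e :: 'a where e: "e \<in> Basis" using nonempty_Basis by blast
  have "AE x in lborel. D e x = 0"
    using DI e integral_nonneg_eq_0_iff_AE[OF Di[OF e]] D0 by simp
  then have "AE x in lborel. u x > v x \<longrightarrow> g e x = h e x"
  proof eventually_elim
    case (elim x)
    show ?case
    proof
      assume "v x < u x"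
      then have "g e x = 0 \<and> h e x = 0"
        using power_mean_deriv_square(2)[OF p nn(2)[of x], of "u x" "g e x" "h e x"] elim by (simp add: D_def K_def)
      then show "g e x = h e x" by simp
    qed
  qed
  then have w: "weak_dderiv e (\<lambda>x. max 0 (u x - v x)) (\<lambda>x. 0)"
    using u v e by (intro pos_part_diff_weak_dderiv_zero) (auto simp: Xp_borel_def)
  have "integrable lborel (\<lambda>x. \<bar>max 0 (u x - v x)\<bar> powr p)"
  proof (rule Bochner_Integration.integrable_bound[OF ip(1)])
    note [measurable] = locint_measurable[OF Xp_borel_locint(1)[OF u]] locint_measurable[OF Xp_borel_locint(1)[OF v]]
    show "(\<lambda>x. \<bar>max 0 (u x - v x)\<bar> powr p) \<in> borel_measurable lborel" by measurable
    have "\<bar>max 0 (u x - v x)\<bar> powr p \<le> \<bar>u x\<bar> powr p" for x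
      using nn[of x] p0 by (intro powr_mono2) auto
    then show "AE x in lborel. norm (\<bar>max 0 (u x - v x)\<bar> powr p) \<le> norm (\<bar>u x\<bar> powr p)" by simp
  qed
  then have "AE x in lborel. max 0 (u x - v x) = 0"
    using e by (intro AE_zero_if_weak_dderiv_zero[OF w]) auto
  then show ?thesis by eventually_elim (auto simp: max_def split: if_splits)
qed

section \<open>Scaling and the support of the ground state\<close>

lemma Xp_borel_affine:
  fixes u :: "'a::euclidean_space \<Rightarrow> real"
  assumes u: "Xp_borel p u g" and c: "c \<noteq> 0"
  shows "Xp_borel p (\<lambda>x. a * u (h + c *\<^sub>R x)) (\<lambda>b x. a * c * g b (h + c *\<^sub>R x))"
proof -
  have i: "integrable lborel (\<lambda>x. k * f (h + c *\<^sub>R x))" if "integrable lborel f" for f :: "'a \<Rightarrow> real" and k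
    using integrable_lborel_affine_iff[of f c h] that c borel_measurable_integrable[OF that] by simp
  have pw: "integrable lborel (\<lambda>x. \<bar>a * u (h + c *\<^sub>R x)\<bar> powr q)" if "integrable lborel (\<lambda>x. \<bar>u x\<bar> powr q)" for q
    using i[OF that, of "\<bar>a\<bar> powr q"] by (simp add: abs_mult powr_mult)
  have "integrable lborel (\<lambda>x. (a * c * g b (h + c *\<^sub>R x))\<^sup>2)" if "b \<in> Basis" for b
    using i[of "\<lambda>x. (g b x)\<^sup>2" "(a * c)\<^sup>2"] u that by (simp add: Xp_borel_def power_mult_distrib)
  then show ?thesis
    using u pw weak_dderiv_affine[OF _ c] unfolding Xp_borel_def by blast
qed

text \<open>The relation \<open>(a * c)\<^sup>2 = a powr p\<close> makes the Dirichlet and the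
  potential term scale by the same factor, so the rescaling takes minimizers for
  \<open>\<Omega>\<close> to minimizers for its preimage.\<close>

lemma energy_borel_affine:
  fixes u :: "'a::euclidean_space \<Rightarrow> real"
  assumes u: "Xp_borel p u g" and c: "c > 0" and a: "a > 0" "(a * c)\<^sup>2 = a powr p" and \<Omega>: "\<Omega> \<in> sets borel"
  shows "energy_borel p {x. h + c *\<^sub>R x \<in> \<Omega>} (\<lambda>x. a * u (h + c *\<^sub>R x)) (\<lambda>b x. a * c * g b (h + c *\<^sub>R x)) =
    a powr p / c ^ DIM('a) * energy_borel p \<Omega> u g"
proof -
  have I: "(LINT x|lborel. k * f (h + c *\<^sub>R x)) = k / c ^ DIM('a) * (LINT x|lborel. f x)"
    if "f \<in> borel_measurable borel" for f :: "'a \<Rightarrow> real" and k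
    using integral_lborel_affine[OF that, of c h] c by simp
  note um = locint_measurable[OF Xp_borel_locint(1)[OF u]]
  have 1: "(LINT x|lborel. (a * c * g b (h + c *\<^sub>R x))\<^sup>2) = a powr p / c ^ DIM('a) * (LINT x|lborel. (g b x)\<^sup>2)" if "b \<in> Basis" for b
    using I[of "\<lambda>x. (g b x)\<^sup>2" "(a * c)\<^sup>2"] locint_measurable[OF Xp_borel_locint(2)[OF u that]] a(2)
    by (simp add: power_mult_distrib)
  have "Q_weight {x. h + c *\<^sub>R x \<in> \<Omega>} x = Q_weight \<Omega> (h + c *\<^sub>R x)" for x by (simp add: Q_weight_def)
  then have 2: "(LINT x|lborel. Q_weight {x. h + c *\<^sub>R x \<in> \<Omega>} x * \<bar>a * u (h + c *\<^sub>R x)\<bar> powr p) =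
     a powr p / c ^ DIM('a) * (LINT x|lborel. Q_weight \<Omega> x * \<bar>u x\<bar> powr p)"
    using I[of "\<lambda>x. Q_weight \<Omega> x * \<bar>u x\<bar> powr p" "a powr p"] um Q_weight_measurable[OF \<Omega>] a(1)
    by (simp add: abs_mult powr_mult mult.left_commute)
  have "(\<Sum>b\<in>Basis. LINT x|lborel. (a * c * g b (h + c *\<^sub>R x))\<^sup>2) = a powr p / c ^ DIM('a) * (\<Sum>b\<in>Basis. LINT x|lborel. (g b x)\<^sup>2)"
    unfolding sum_distrib_left by (rule sum.cong[OF refl 1])
  then show ?thesis
    unfolding energy_borel_def 2 by (simp add: algebra_simps)
qed

lemma ground_state_borel:
  fixes w :: "'a::euclidean_space \<Rightarrow> real"
  assumes w: "nonneg_ground_state p \<Omega> w" and \<Omega>: "\<Omega> \<in> sets borel"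
  shows "\<exists>u g. Xp_borel p u g \<and> (\<forall>x. u x \<ge> 0) \<and> (AE x in lborel. w x = u x) \<and>
    (\<forall>v k. Xp_borel p v k \<longrightarrow> energy_borel p \<Omega> u g \<le> energy_borel p \<Omega> v k)"
proof -
  have wX: "w \<in> Xp_space p" and nn: "AE x in lborel. 0 \<le> w x"
    and inf: "ereal (energy p \<Omega> w) = (INF u\<in>Xp_space p. ereal (energy p \<Omega> u))"
    using w by (auto simp: nonneg_ground_state_def lebesgue_AE_iff)
  have wm: "w \<in> borel_measurable lebesgue" using wX by (simp add: Xp_space_def Lp_space_def)
  obtain w' where w': "w' \<in> borel_measurable borel" "AE x in lborel. w x = w' x"
    using ex_borel_representative[OF wm] by blast
  \<comment> \<open>Turns nonnegativity almost everywhere into nonnegativity everywhere, as the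
    pointwise range condition of the chain rule demands.\<close>
  define u where "u x = max 0 (w' x)" for x
  have um: "u \<in> borel_measurable borel" unfolding u_def[abs_def] using w'(1) by measurable
  have wu: "AE x in lborel. w x = u x" using w'(2) nn by eventually_elim (simp add: u_def)
  obtain g where g: "Xp_borel p u g" using Xp_space_borel_representative[OF wX um wu] by blast
  have "energy_borel p \<Omega> u g \<le> energy_borel p \<Omega> v k" if v: "Xp_borel p v k" for v k
  proof -
    have vm: "v \<in> borel_measurable lebesgue"
      by (rule lborel_measurable_lebesgue[OF locint_measurable[OF Xp_borel_locint(1)[OF v]]])
    have vX: "v \<in> Xp_space p" and ve: "energy p \<Omega> v = energy_borel p \<Omega> v k"
      using Xp_space_if_Xp_borel[OF v vm] \<Omega> by simp_all
    have "ereal (energy p \<Omega> w) \<le> ereal (energy p \<Omega> v)" unfolding inf by (rule INF_lower[OF vX])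
    then show ?thesis using ve Xp_space_if_Xp_borel(2)[OF g wm wu \<Omega>] by simp
  qed
  then show ?thesis using g wu by (intro exI[of _ u] exI[of _ g]) (auto simp: u_def)
qed

lemma ground_state_scaling_le:
  fixes u :: "'a::euclidean_space \<Rightarrow> real"
  assumes d: "DIM('a) \<ge> 3" and p: "1 < p" "p < 2" and u: "Xp_borel p u g" and nn: "\<And>x. u x \<ge> 0"
    and \<Omega>: "\<Omega> \<in> sets borel"
    and min: "\<And>v k. Xp_borel p v k \<Longrightarrow> energy_borel p \<Omega> u g \<le> energy_borel p \<Omega> v k"
    and c: "c > 0" and sub: "{x. h + c *\<^sub>R x \<in> \<Omega>} \<subseteq> \<Omega>"
  shows "AE x in lborel. c powr (- 2 / (2 - p)) * u (h + c *\<^sub>R x) \<le> u x"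
proof -
  \<comment> \<open>Solving \<open>(a * c)\<^sup>2 = a powr p\<close> for \<open>a\<close> gives
    \<open>a powr (2 - p) = c powr (- 2)\<close>.\<close>
  define a where "a = c powr (- 2 / (2 - p))"
  have a: "a > 0" using c by (simp add: a_def)
  have ap: "(a * c)\<^sup>2 = a powr p"
  proof -
    have "a * c = c powr (- 2 / (2 - p) + 1)" using c by (simp only: a_def powr_add powr_one)
    then have "(a * c)\<^sup>2 = c powr (2 * (- 2 / (2 - p) + 1))"
      by (simp only: power2_eq_square powr_add[symmetric] mult_2)
    also have "2 * (- 2 / (2 - p) + 1) = - 2 / (2 - p) * p" using p by (simp add: field_simps)
    finally show ?thesis by (simp only: a_def powr_powr)
  qed
  let ?T = "\<lambda>x. h + c *\<^sub>R x"
  have \<Omega>': "{x. ?T x \<in> \<Omega>} \<in> sets borel"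
  proof -
    have "?T -` \<Omega> \<inter> space borel \<in> sets borel" by (rule measurable_sets[OF _ \<Omega>]) measurable
    then show ?thesis by (simp add: vimage_def)
  qed
  show ?thesis
    unfolding a_def[symmetric]
  proof (rule minimizer_comparison[OF d p Xp_borel_affine[OF u] u _ nn \<Omega>' \<Omega> sub _ min])
    show "c \<noteq> 0" using c by simp
    show "0 \<le> a * u (?T x)" for x using a nn by simp
    fix v :: "'a \<Rightarrow> real" and k assume v: "Xp_borel p v k"
    \<comment> \<open>Every competitor for the preimage is the rescaling of a competitor for
      \<open>\<Omega>\<close>, namely of \<open>v\<close> transported by the inverse affine map;
      thus minimality carries over.\<close>
    define v' where "v' y = (1 / a) * v ((- (1 / c)) *\<^sub>R h + (1 / c) *\<^sub>R y)" for y
    define k' where "k' b y = (1 / a) * (1 / c) * k b ((- (1 / c)) *\<^sub>R h + (1 / c) *\<^sub>R y)" for b y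
    have X: "Xp_borel p v' k'"
      unfolding v'_def[abs_def] k'_def[abs_def] by (rule Xp_borel_affine[OF v]) (use c in simp)
    have inv: "(- (1 / c)) *\<^sub>R h + (1 / c) *\<^sub>R (h + c *\<^sub>R x) = x" for x
      using c by (simp add: algebra_simps)
    have "v = (\<lambda>x. a * v' (?T x))" "k = (\<lambda>b x. a * c * k' b (?T x))"
      unfolding v'_def k'_def inv using a c by simp_all
    then have "energy_borel p {x. ?T x \<in> \<Omega>} v k = a powr p / c ^ DIM('a) * energy_borel p \<Omega> v' k'"
      using energy_borel_affine[OF X c a ap \<Omega>, of h] by simp
    moreover have "a powr p / c ^ DIM('a) * energy_borel p \<Omega> u g \<le> a powr p / c ^ DIM('a) * energy_borel p \<Omega> v' k'"
      using c by (intro mult_left_mono min X) auto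
    ultimately show "energy_borel p {x. ?T x \<in> \<Omega>} (\<lambda>x. a * u (?T x)) (\<lambda>b x. a * c * g b (?T x)) \<le> energy_borel p {x. ?T x \<in> \<Omega>} v k"
      using energy_borel_affine[OF u c a ap \<Omega>, of h] by simp
  qed
qed

section \<open>The essential support\<close>

lemma ess_support_cong:
  assumes "AE x in lborel. u x = v x" shows "ess_support u = ess_support v"
proof -
  have "(AE x in lebesgue. x \<in> U \<longrightarrow> u x = 0) \<longleftrightarrow> (AE x in lebesgue. x \<in> U \<longrightarrow> v x = 0)" for U
    unfolding lebesgue_AE_iff using assms by (auto elim: eventually_elim2)
  then show ?thesis unfolding ess_support_def by presburger
qed

lemma closed_ess_support: "closed (ess_support u)"
  unfolding ess_support_def by (intro closed_Compl open_Union) blast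

text \<open>The complement of the support is a union of possibly uncountably many open sets, each
  with its own exceptional null set; by Lindelof countably many of them cover it.\<close>

lemma AE_zero_outside_ess_support:
  fixes u :: "'a::euclidean_space \<Rightarrow> real"
  shows "AE x in lborel. x \<notin> ess_support u \<longrightarrow> u x = 0"
proof -
  define F where "F = {U. open U \<and> (AE x in lebesgue. x \<in> U \<longrightarrow> u x = 0)}"
  obtain F' where F': "F' \<subseteq> F" "countable F'" "\<Union>F' = \<Union>F"
    by (rule Lindelof[of F]) (auto simp: F_def)
  have "AE x in lborel. \<forall>U\<in>F'. x \<in> U \<longrightarrow> u x = 0"
    unfolding AE_ball_countable[OF F'(2)] using F'(1) by (auto simp: F_def lebesgue_AE_iff)
  then show ?thesis
  proof eventually_elim
    case (elim x)
    show ?case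
    proof
      assume "x \<notin> ess_support u"
      then have "x \<in> \<Union>F'" unfolding F'(3) ess_support_def F_def by blast
      then show "u x = 0" using elim by blast
    qed
  qed
qed

text \<open>Where \<open>u\<close> vanishes, the inequality and nonnegativity force the rescaled
  function to vanish as well. Undoing the affine map turns a neighbourhood of \<open>x\<close> on
  which \<open>u\<close> is zero into such a neighbourhood of the image point.\<close>

lemma ess_support_scaling:
  fixes u :: "'a::euclidean_space \<Rightarrow> real"
  assumes le: "AE x in lborel. a * u (h + c *\<^sub>R x) \<le> u x" and nn: "\<And>x. u x \<ge> 0" and c: "c \<noteq> 0" and a: "a > 0"
    and x: "x \<notin> ess_support u"
  shows "h + c *\<^sub>R x \<notin> ess_support u"
proof -
  obtain U where "open U \<and> (AE x in lebesgue. x \<in> U \<longrightarrow> u x = 0)" "x \<in> U"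
    using x unfolding ess_support_def by blast
  then have U: "open U" "AE x in lborel. x \<in> U \<longrightarrow> u x = 0" "x \<in> U"
    by (simp_all add: lebesgue_AE_iff)
  let ?S = "\<lambda>y. (- (1 / c)) *\<^sub>R h + (1 / c) *\<^sub>R y"
  have inv: "?S (h + c *\<^sub>R x) = x" "h + c *\<^sub>R ?S x = x" for x
    using c by (simp_all add: algebra_simps)
  have "AE x in lborel. x \<in> U \<longrightarrow> u (h + c *\<^sub>R x) = 0"
    using le U(2)
  proof eventually_elim
    case (elim x)
    show ?case
    proof
      assume "x \<in> U"
      then have "a * u (h + c *\<^sub>R x) \<le> 0" using elim by simp
      then have "u (h + c *\<^sub>R x) \<le> 0" using a by (simp add: mult_le_0_iff)
      then show "u (h + c *\<^sub>R x) = 0" using nn[of "h + c *\<^sub>R x"] by simp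
    qed
  qed
  then have "AE y in lborel. ?S y \<in> U \<longrightarrow> u (h + c *\<^sub>R ?S y) = 0"
    by (rule AE_lborel_affine) (use c in simp)
  then have ae: "AE y in lebesgue. y \<in> ?S -` U \<longrightarrow> u y = 0" by (simp only: inv lebesgue_AE_iff vimage_eq)
  have "open (?S -` U)"
    by (intro open_vimage U(1) continuous_intros)
  moreover have "h + c *\<^sub>R x \<in> ?S -` U" using U(3) by (simp only: vimage_eq inv)
  ultimately show ?thesis using ae unfolding ess_support_def by blast
qed

section \<open>Negativity of the minimal energy\<close>

lemma cball_finite_measure: "emeasure lborel (cball a r) < top"
  using emeasure_bounded_finite[OF bounded_cball] by simp

lemma test_function_locint:
  fixes \<phi> :: "'a::euclidean_space \<Rightarrow> real"
  assumes "test_function \<phi>"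
  shows "locint \<phi>" "locint (\<lambda>x. frechet_derivative \<phi> (at x) e)"
proof -
  obtain R C where RC: "C > 0" "\<forall>x. norm x > R \<longrightarrow> \<phi> x = 0 \<and> frechet_derivative \<phi> (at x) e = 0"
    "\<forall>x. \<bar>\<phi> x\<bar> \<le> C \<and> \<bar>frechet_derivative \<phi> (at x) e\<bar> \<le> C"
    using test_function_bounds[OF assms, of e] by (elim exE conjE)
  have c: "locint (\<lambda>x::'a. C)"
  proof (rule locintI)
    show "integrable lborel (\<lambda>x. indicator (cball 0 r) x * C)" for r
      by (intro integrable_mult_left integrable_real_indicator) (auto simp: cball_finite_measure)
  qed simp
  show "locint \<phi>" "locint (\<lambda>x. frechet_derivative \<phi> (at x) e)"
    by (rule locint_bound[OF c]; use test_function_measurable[OF assms] RC in force)+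
qed

lemma test_function_powr_integrable:
  fixes f :: "'a::euclidean_space \<Rightarrow> real"
  assumes m: "f \<in> borel_measurable borel" and b: "\<And>x. \<bar>f x\<bar> \<le> C" and z: "\<And>x. norm x > R \<Longrightarrow> f x = 0" and q: "q > 0"
  shows "integrable lborel (\<lambda>x. \<bar>f x\<bar> powr q)"
proof -
  have i: "integrable lborel (\<lambda>x::'a. indicator (cball 0 R) x * C powr q)"
    by (intro integrable_mult_left integrable_real_indicator) (auto simp: cball_finite_measure)
  show ?thesis
  proof (rule Bochner_Integration.integrable_bound[OF i])
    show "(\<lambda>x. \<bar>f x\<bar> powr q) \<in> borel_measurable lborel" using m by measurable
    have "\<bar>f x\<bar> powr q \<le> indicator (cball 0 R) x * C powr q" for x
      using b[of x] z[of x] q by (cases "norm x \<le> R") (auto intro: powr_mono2)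
    then show "AE x in lborel. norm (\<bar>f x\<bar> powr q) \<le> norm (indicator (cball 0 R) x * C powr q)" by simp
  qed
qed

lemma test_function_weak_dderiv:
  fixes \<phi> :: "'a::euclidean_space \<Rightarrow> real"
  assumes \<phi>: "test_function \<phi>"
  shows "weak_dderiv e \<phi> (\<lambda>x. frechet_derivative \<phi> (at x) e)"
proof (rule weak_dderivI[OF test_function_locint[OF \<phi>]])
  let ?t = "\<lambda>n. inverse (real (Suc n))"
  show t: "?t \<longlonglongrightarrow> 0" by (rule LIMSEQ_inverse_real_of_nat)
  show t0: "?t n \<noteq> 0" for n by simp
  obtain R C where RC: "C > 0" "\<forall>x. norm x > R \<longrightarrow> \<phi> x = 0 \<and> frechet_derivative \<phi> (at x) e = 0"
    "\<forall>x. \<bar>\<phi> x\<bar> \<le> C \<and> \<bar>frechet_derivative \<phi> (at x) e\<bar> \<le> C"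
    using test_function_bounds[OF \<phi>, of e] by (elim exE conjE)
  note [measurable] = test_function_measurable(1)[OF \<phi>] test_function_measurable(2)[OF \<phi>, of e]
  show "L1loc_tendsto (\<lambda>n. diff_quot e \<phi> (?t n)) (\<lambda>x. frechet_derivative \<phi> (at x) e)"
    unfolding L1loc_tendsto_def
  proof
    fix r
    have [measurable]: "cball 0 r \<in> sets (borel :: 'a measure)" by simp
    let ?F = "\<lambda>n x. ennreal \<bar>diff_quot e \<phi> (?t n) x - frechet_derivative \<phi> (at x) e\<bar> * indicator (cball 0 r) x"
    have "(\<lambda>n. \<integral>\<^sup>+x. ?F n x \<partial>lborel) \<longlonglongrightarrow> (\<integral>\<^sup>+x. 0 \<partial>(lborel :: 'a measure))"
    proof (rule nn_integral_dominated_convergence[where w = "\<lambda>x. ennreal (2 * C) * indicator (cball 0 r) x"])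
      have "(\<lambda>n. ?F n x) \<longlonglongrightarrow> 0" for x
      proof -
        have "((\<lambda>s. (\<phi> (x + s *\<^sub>R e) - \<phi> x) / s) \<longlongrightarrow> frechet_derivative \<phi> (at x) e) (at 0)"
          using test_function_ray_derivative[OF \<phi>, of x e 0] by (simp add: has_field_derivative_iff)
        moreover have "filterlim ?t (at 0) sequentially"
          using t t0 by (intro filterlim_atI) auto
        ultimately have "(\<lambda>n. (\<phi> (x + ?t n *\<^sub>R e) - \<phi> x) / ?t n) \<longlonglongrightarrow> frechet_derivative \<phi> (at x) e"
          by (rule filterlim_compose)
        then have "(\<lambda>n. diff_quot e \<phi> (?t n) x) \<longlonglongrightarrow> frechet_derivative \<phi> (at x) e"
          by (simp add: diff_quot_def add.commute)
        then have "(\<lambda>n. \<bar>diff_quot e \<phi> (?t n) x - frechet_derivative \<phi> (at x) e\<bar>) \<longlonglongrightarrow> \<bar>frechet_derivative \<phi> (at x) e - frechet_derivative \<phi> (at x) e\<bar>"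
          by (intro tendsto_intros)
        then have "(\<lambda>n. ennreal \<bar>diff_quot e \<phi> (?t n) x - frechet_derivative \<phi> (at x) e\<bar>) \<longlonglongrightarrow> ennreal 0"
          by (intro tendsto_ennrealI) simp
        then show ?thesis by (cases "x \<in> cball 0 r") simp_all
      qed
      then show "AE x in lborel. (\<lambda>n. ?F n x) \<longlonglongrightarrow> 0" by simp
      show "AE x in lborel. ?F n x \<le> ennreal (2 * C) * indicator (cball 0 r) x" for n
      proof (intro AE_I2 mult_right_mono ennreal_leI)
        fix x
        have "\<bar>\<phi> (x + ?t n *\<^sub>R e) - \<phi> x\<bar> \<le> C * \<bar>?t n\<bar>"
          using RC(3) by (intro test_function_lipschitz_ray[OF \<phi>]) auto
        then have "\<bar>diff_quot e \<phi> (?t n) x\<bar> \<le> C"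
          unfolding diff_quot_def abs_divide by (subst pos_divide_le_eq) (simp_all add: add.commute)
        moreover have "\<bar>frechet_derivative \<phi> (at x) e\<bar> \<le> C" using RC(3) by simp
        ultimately show "\<bar>diff_quot e \<phi> (?t n) x - frechet_derivative \<phi> (at x) e\<bar> \<le> 2 * C" by linarith
      qed simp
      show "(\<integral>\<^sup>+x. ennreal (2 * C) * indicator (cball 0 r) x \<partial>lborel) < \<infinity>"
        by (simp add: nn_integral_cmult_indicator ennreal_mult_less_top cball_finite_measure)
    qed (unfold diff_quot_def, measurable)
    then show "(\<lambda>n. \<integral>\<^sup>+x. ?F n x \<partial>lborel) \<longlonglongrightarrow> 0" by simp
  qed
qed

text \<open>For small \<open>t\<close> the sublinear potential term dominates the energy of \<open>t\<close> times a bump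
  supported in \<open>\<Omega>\<close>.\<close>
lemma energy_borel_negative:
  fixes \<Omega> :: "'a::euclidean_space set"
  assumes d: "DIM('a) \<ge> 3" and p: "1 < p" "p < 2" and \<Omega>: "open \<Omega>" "\<Omega> \<noteq> {}"
  shows "\<exists>v k. Xp_borel p v k \<and> energy_borel p \<Omega> v k < 0"
proof -
  obtain x0 where x0: "x0 \<in> \<Omega>" using \<Omega>(2) by blast
  obtain a b where ab: "x0 \<in> box a b" "box a b \<subseteq> \<Omega>"
    using open_contains_box[OF \<Omega>(1) x0] by metis
  define \<phi> where "\<phi> = box_bump a b 1"
  have \<phi>: "test_function \<phi>" unfolding \<phi>_def by (rule test_function_box_bump) simp
  have \<phi>0: "\<phi> x \<ge> 0" for x unfolding \<phi>_def by (rule box_bump_bounds)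
  have \<phi>z: "\<phi> x = 0" if "x \<notin> \<Omega>" for x
    unfolding \<phi>_def by (rule box_bump_eq_0) (use that ab in auto)
  define g where "g e x = frechet_derivative \<phi> (at x) e" for e x
  have ip: "integrable lborel (\<lambda>x. \<bar>\<phi> x\<bar> powr q)" "integrable lborel (\<lambda>x. \<bar>g e x\<bar> powr q)" if "q > 0" for q e
  proof -
    obtain R C where RC: "C > 0" "\<forall>x. norm x > R \<longrightarrow> \<phi> x = 0 \<and> frechet_derivative \<phi> (at x) e = 0"
      "\<forall>x. \<bar>\<phi> x\<bar> \<le> C \<and> \<bar>frechet_derivative \<phi> (at x) e\<bar> \<le> C"
      using test_function_bounds[OF \<phi>, of e] by (elim exE conjE)
    show "integrable lborel (\<lambda>x. \<bar>\<phi> x\<bar> powr q)"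
      by (rule test_function_powr_integrable[OF test_function_measurable(1)[OF \<phi>] _ _ that, of C R]) (use RC in auto)
    show "integrable lborel (\<lambda>x. \<bar>g e x\<bar> powr q)"
      unfolding g_def
      by (rule test_function_powr_integrable[OF test_function_measurable(2)[OF \<phi>] _ _ that, of e C R]) (use RC in auto)
  qed
  have X: "Xp_borel p \<phi> g"
    unfolding Xp_borel_def
  proof (intro conjI ballI)
    show "weak_dderiv e \<phi> (g e)" for e unfolding g_def[abs_def] by (rule test_function_weak_dderiv[OF \<phi>])
    show "integrable lborel (\<lambda>x. (g e x)\<^sup>2)" for e using ip(2)[of 2 e] by simp
  qed (use ip p d in auto)
  define A where "A = (\<Sum>e\<in>Basis. LINT x|lborel. (g e x)\<^sup>2)"
  define B where "B = (LINT x|lborel. \<bar>\<phi> x\<bar> powr p) / p"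
  have A: "A \<ge> 0" unfolding A_def by (intro sum_nonneg integral_nonneg_AE) simp
  have "(LINT x|lborel. \<bar>\<phi> x\<bar> powr p) \<noteq> 0"
  proof
    assume "(LINT x|lborel. \<bar>\<phi> x\<bar> powr p) = 0"
    then have "AE x in lborel. \<bar>\<phi> x\<bar> powr p = 0"
      using integral_nonneg_eq_0_iff_AE[OF ip(1)[of p]] p by simp
    then have "AE x in lborel. x \<notin> box a b"
    proof eventually_elim
      case (elim x)
      then show ?case using box_bump_pos[of 1 x a b] by (auto simp: \<phi>_def)
    qed
    then have "box a b \<in> null_sets lborel" by (subst (asm) AE_iff_null_sets[symmetric]) auto
    then show False
      using ab(1) open_not_negligible[OF open_box, of a b] by (auto simp: negligible_iff_null_sets null_sets_completionI)
  qed
  moreover have "(LINT x|lborel. \<bar>\<phi> x\<bar> powr p) \<ge> 0" by (intro integral_nonneg_AE) simp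
  ultimately have "(LINT x|lborel. \<bar>\<phi> x\<bar> powr p) > 0" by linarith
  then have B: "B > 0" using p by (simp add: B_def)
  \<comment> \<open>Chosen so that \<open>t powr (2 - p) * (A + 1) = B\<close>. Then
    \<open>t\<^sup>2 * A\<close> is at most \<open>t powr p * B\<close>, and the factor one half in
    the energy makes the sum negative; the summand 1 admits \<open>A = 0\<close>.\<close>
  define t where "t = (B / (A + 1)) powr (1 / (2 - p))"
  have t: "t > 0" using A B by (simp add: t_def)
  have "t powr (2 - p) = B / (A + 1)" using A B p by (simp add: t_def powr_powr)
  then have "t powr (2 - p) * (A + 1) = B" using A by simp
  then have tA: "t powr (2 - p) * A \<le> B" unfolding distrib_left using powr_ge_zero[of t "2 - p"] by linarith
  have "t\<^sup>2 = t powr p * t powr (2 - p)" using t by (simp add: powr_add[symmetric])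
  then have "t\<^sup>2 * A \<le> t powr p * B" using tA by (simp add: mult_left_mono mult.assoc)
  moreover have "0 < t powr p * B" using t B by simp
  ultimately have neg: "1 / 2 * (t\<^sup>2 * A) - t powr p * B < 0" by linarith
  have Xt: "Xp_borel p (\<lambda>x. t * \<phi> x) (\<lambda>e x. t * g e x)"
    using Xp_borel_affine[OF X, of 1 t 0] by simp
  \<comment> \<open>The bump vanishes off \<open>\<Omega>\<close>, so the weight is 1 wherever it
    counts.\<close>
  have "Q_weight \<Omega> x * \<bar>t * \<phi> x\<bar> powr p = t powr p * \<bar>\<phi> x\<bar> powr p" for x
    using \<phi>z[of x] t p by (cases "x \<in> \<Omega>") (simp_all add: Q_weight_def abs_mult powr_mult)
  then have "energy_borel p \<Omega> (\<lambda>x. t * \<phi> x) (\<lambda>e x. t * g e x) = 1 / 2 * (t\<^sup>2 * A) - t powr p * B"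
    unfolding energy_borel_def A_def B_def by (simp add: power_mult_distrib sum_distrib_left)
  then show ?thesis using Xt neg by (intro exI conjI) auto
qed

text \<open>If \<open>u\<close> vanished almost everywhere, so would its derivatives, and the energy
  would be zero although some competitor has negative energy.\<close>

lemma ess_support_ground_state_nonempty:
  fixes u :: "'a::euclidean_space \<Rightarrow> real"
  assumes d: "DIM('a) \<ge> 3" and p: "1 < p" "p < 2" and \<Omega>: "open \<Omega>" "\<Omega> \<noteq> {}" and u: "Xp_borel p u g"
    and min: "\<And>v k. Xp_borel p v k \<Longrightarrow> energy_borel p \<Omega> u g \<le> energy_borel p \<Omega> v k"
  shows "ess_support u \<noteq> {}"
proof
  assume "ess_support u = {}"
  then have u0: "AE x in lborel. u x = 0" using AE_zero_outside_ess_support[of u] by simp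
  have "(LINT x|lborel. (g b x)\<^sup>2) = 0" if "b \<in> Basis" for b
  proof -
    have "AE x in lborel. u x = 0 \<longrightarrow> g b x = 0"
      using u that by (intro weak_dderiv_eq_0_on_zero_set) (auto simp: Xp_borel_def)
    with u0 have "AE x in lborel. (g b x)\<^sup>2 = 0" by eventually_elim simp
    then show ?thesis by (rule integral_eq_zero_AE)
  qed
  moreover have "AE x in lborel. Q_weight \<Omega> x * \<bar>u x\<bar> powr p = 0" using u0 by eventually_elim simp
  then have "(LINT x|lborel. Q_weight \<Omega> x * \<bar>u x\<bar> powr p) = 0" by (rule integral_eq_zero_AE)
  ultimately have "energy_borel p \<Omega> u g = 0" by (simp add: energy_borel_def)
  moreover obtain v k where "Xp_borel p v k" "energy_borel p \<Omega> v k < 0"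
    using energy_borel_negative[OF d p \<Omega>] by blast
  ultimately show False using min[of v k] by simp
qed

section \<open>Star centers of the domain and of the support\<close>

lemma ess_support_ground_state_star_center:
  fixes w :: "'a::euclidean_space \<Rightarrow> real"
  assumes d: "DIM('a) \<ge> 3" and p: "1 < p" "p < 2" and w: "nonneg_ground_state p \<Omega> w"
    and \<Omega>: "open \<Omega>" and x0: "x0 \<in> \<Omega>" "\<And>x. x \<in> \<Omega> \<Longrightarrow> closed_segment x0 x \<subseteq> \<Omega>"
  shows "x0 \<in> ess_support w \<and> (\<forall>y\<in>ess_support w. closed_segment x0 y \<subseteq> ess_support w)"
proof -
  have \<Omega>b: "\<Omega> \<in> sets borel" using \<Omega> by simp
  obtain u g where u: "Xp_borel p u g" "\<forall>x. u x \<ge> 0" "AE x in lborel. w x = u x"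
    "\<forall>v k. Xp_borel p v k \<longrightarrow> energy_borel p \<Omega> u g \<le> energy_borel p \<Omega> v k"
    using ground_state_borel[OF w \<Omega>b] by (elim exE conjE)
  define K where "K = ess_support u"
  have K: "ess_support w = K" unfolding K_def by (rule ess_support_cong[OF u(3)])
  have step: "x0 + s *\<^sub>R (y - x0) \<in> K" if y: "y \<in> K" and s: "0 < s" "s \<le> 1" for y s
  proof (rule ccontr)
    assume n: "x0 + s *\<^sub>R (y - x0) \<notin> K"
    \<comment> \<open>The dilation about \<open>x0\<close> with factor \<open>c\<close> maps
      \<open>x0 + s *\<^sub>R (y - x0)\<close> to \<open>y\<close>, so it would carry a point
      outside the support to \<open>y\<close>. Since \<open>x0\<close> is a star center of
      \<open>\<Omega>\<close>, the preimage of \<open>\<Omega>\<close> under this dilation lies in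
      \<open>\<Omega>\<close>.\<close>
    define c where "c = 1 / s"
    define h where "h = (1 - c) *\<^sub>R x0"
    have c: "c \<ge> 1" "c > 0" "s * c = 1" using s by (simp_all add: c_def)
    have "{x. h + c *\<^sub>R x \<in> \<Omega>} \<subseteq> \<Omega>"
    proof
      fix x assume "x \<in> {x. h + c *\<^sub>R x \<in> \<Omega>}"
      then have "closed_segment x0 (h + c *\<^sub>R x) \<subseteq> \<Omega>" using x0(2) by simp
      moreover have "x = (1 - s) *\<^sub>R x0 + s *\<^sub>R (h + c *\<^sub>R x)"
      proof -
        have "s *\<^sub>R (h + c *\<^sub>R x) = (s - s * c) *\<^sub>R x0 + (s * c) *\<^sub>R x"
          by (simp add: h_def scaleR_add_right right_diff_distrib)
        then show ?thesis using c(3) by (simp add: algebra_simps)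
      qed
      then have "x \<in> closed_segment x0 (h + c *\<^sub>R x)" using s unfolding in_segment by (intro exI[of _ s]) auto
      ultimately show "x \<in> \<Omega>" by blast
    qed
    then have "AE x in lborel. c powr (- 2 / (2 - p)) * u (h + c *\<^sub>R x) \<le> u x"
      using u c by (intro ground_state_scaling_le[OF d p u(1) _ \<Omega>b]) auto
    from ess_support_scaling[OF this _ _ _ n[unfolded K_def]] u(2) c
    have "h + c *\<^sub>R (x0 + s *\<^sub>R (y - x0)) \<notin> K" by (auto simp: K_def)
    moreover have "h + c *\<^sub>R (x0 + s *\<^sub>R (y - x0)) = y"
    proof -
      have "c *\<^sub>R (x0 + s *\<^sub>R (y - x0)) = c *\<^sub>R x0 + (s * c) *\<^sub>R (y - x0)"
        by (simp add: scaleR_add_right mult.commute)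
      then show ?thesis using c(3) by (simp add: h_def algebra_simps)
    qed
    ultimately show False using y by simp
  qed
  have x0K: "x0 \<in> K"
  proof -
    obtain y where y: "y \<in> K"
      using ess_support_ground_state_nonempty[OF d p \<Omega> _ u(1)] x0 u(4) unfolding K_def by blast
    \<comment> \<open>The dilation argument leaves out \<open>s = 0\<close>; the center is reached
      as a limit, the support being closed and nonempty.\<close>
    have "(\<lambda>n. x0 + inverse (real (Suc n)) *\<^sub>R (y - x0)) \<longlonglongrightarrow> x0 + 0 *\<^sub>R (y - x0)"
      by (intro tendsto_intros LIMSEQ_inverse_real_of_nat)
    then have "(\<lambda>n. x0 + inverse (real (Suc n)) *\<^sub>R (y - x0)) \<longlonglongrightarrow> x0" by simp
    then show ?thesis
      by (rule closed_sequentially[OF closed_ess_support[of u, folded K_def], rotated])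
        (intro step y, auto simp: inverse_eq_divide)
  qed
  moreover have "closed_segment x0 y \<subseteq> K" if y: "y \<in> K" for y
  proof
    fix z assume "z \<in> closed_segment x0 y"
    then obtain s where s: "0 \<le> s" "s \<le> 1" "z = (1 - s) *\<^sub>R x0 + s *\<^sub>R y" unfolding in_segment by blast
    have z: "z = x0 + s *\<^sub>R (y - x0)" using s(3) by (simp add: algebra_simps)
    show "z \<in> K"
    proof (cases "s = 0")
      case True
      then show ?thesis using z x0K by simp
    next
      case False
      then show ?thesis unfolding z using step[OF y] s by simp
    qed
  qed
  ultimately show ?thesis unfolding K by blast
qed

section \<open>Starshapedness with respect to a ball\<close>

lemma local_defining_function_gradient:
  assumes ld: "local_defining_function \<Omega> x U \<rho>" and y: "y \<in> U"
  shows "(\<rho> has_derivative frechet_derivative \<rho> (at y)) (at y)"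
    and "frechet_derivative \<rho> (at y) v = (\<Sum>b\<in>Basis. (v \<bullet> b) * frechet_derivative \<rho> (at y) b)"
proof -
  have "Ck_on (Suc 0) \<rho> U" using ld unfolding local_defining_function_def smooth_on_def by blast
  then show d: "(\<rho> has_derivative frechet_derivative \<rho> (at y)) (at y)"
    using y by (simp add: frechet_derivative_works[symmetric])
  have l: "linear (frechet_derivative \<rho> (at y))" using d by (rule has_derivative_linear)
  have "frechet_derivative \<rho> (at y) v = frechet_derivative \<rho> (at y) (\<Sum>b\<in>Basis. (v \<bullet> b) *\<^sub>R b)"
    by (simp add: euclidean_representation)
  then show "frechet_derivative \<rho> (at y) v = (\<Sum>b\<in>Basis. (v \<bullet> b) * frechet_derivative \<rho> (at y) b)"
    by (simp add: linear_sum[OF l] linear_cmul[OF l])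
qed

lemma outward_ray_leaves:
  fixes \<Omega> :: "'a::euclidean_space set"
  assumes ld: "local_defining_function \<Omega> y U \<rho>" and y: "y \<notin> \<Omega>" and d: "frechet_derivative \<rho> (at y) d > 0"
  shows "\<forall>\<^sub>F s in at_right 0. y + s *\<^sub>R d \<notin> \<Omega>"
proof -
  have U: "open U" "y \<in> U" "\<Omega> \<inter> U = {y \<in> U. \<rho> y < 0}" using ld by (auto simp: local_defining_function_def)
  then have \<rho>y: "\<rho> y \<ge> 0" using y by (metis (mono_tags, lifting) IntE linorder_not_le mem_Collect_eq)
  have 1: "((\<lambda>s. y + s *\<^sub>R d) has_derivative (\<lambda>s. s *\<^sub>R d)) (at 0)" by (auto intro!: derivative_eq_intros)
  have der: "(\<rho> has_derivative frechet_derivative \<rho> (at y)) (at (y + 0 *\<^sub>R d))"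
    using local_defining_function_gradient(1)[OF ld U(2)] by simp
  have "((\<lambda>s. \<rho> (y + s *\<^sub>R d)) has_derivative (\<lambda>s. frechet_derivative \<rho> (at y) (s *\<^sub>R d))) (at 0)"
    by (rule has_derivative_compose[OF 1 der])
  moreover have "frechet_derivative \<rho> (at y) (s *\<^sub>R d) = frechet_derivative \<rho> (at y) d * s" for s
    using linear_cmul[OF has_derivative_linear[OF local_defining_function_gradient(1)[OF ld U(2)]]] by (simp add: mult.commute)
  ultimately have "((\<lambda>s. \<rho> (y + s *\<^sub>R d)) has_real_derivative frechet_derivative \<rho> (at y) d) (at 0)"
    by (simp add: has_field_derivative_def)
  from DERIV_pos_inc_right[OF this d] have "\<forall>\<^sub>F s in at_right 0. \<rho> y < \<rho> (y + s *\<^sub>R d)"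
    by (auto simp: eventually_at_right_field)
  moreover have "((\<lambda>s. y + s *\<^sub>R d) \<longlongrightarrow> y + 0 *\<^sub>R d) (at_right 0)" by (intro tendsto_intros)
  then have "\<forall>\<^sub>F s in at_right 0. y + s *\<^sub>R d \<in> U"
    using U(1,2) by (intro topological_tendstoD[where l = y]) simp_all
  ultimately show ?thesis
  proof eventually_elim
    case (elim s)
    then have "\<not> \<rho> (y + s *\<^sub>R d) < 0" using \<rho>y by simp
    then show ?case using U(3) elim by auto
  qed
qed

text \<open>Consider the last parameter \<open>T\<close> at which the segment is outside
  \<open>\<Omega>\<close>. It yields a frontier point, and the outward condition there keeps the
  segment outside just after \<open>T\<close>, a contradiction.\<close>

lemma closed_segment_subset_if_outward:
  fixes \<Omega> :: "'a::euclidean_space set"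
  assumes \<Omega>: "open \<Omega>" and z: "z \<in> \<Omega>" and x: "x \<in> \<Omega>"
    and out: "\<And>y. y \<in> frontier \<Omega> \<Longrightarrow> \<exists>U \<rho>. local_defining_function \<Omega> y U \<rho> \<and> frechet_derivative \<rho> (at y) (y - z) > 0"
  shows "closed_segment z x \<subseteq> \<Omega>"
proof (rule ccontr)
  define \<gamma> where "\<gamma> t = z + t *\<^sub>R (x - z)" for t
  have \<gamma>c: "continuous_on A \<gamma>" for A unfolding \<gamma>_def by (intro continuous_intros)
  assume "\<not> closed_segment z x \<subseteq> \<Omega>"
  then obtain q where "q \<in> closed_segment z x" "q \<notin> \<Omega>" by blast
  then obtain t0 where t0: "0 \<le> t0" "t0 \<le> 1" "q = (1 - t0) *\<^sub>R z + t0 *\<^sub>R x"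
    unfolding in_segment by blast
  then have "\<gamma> t0 = q" by (simp add: \<gamma>_def algebra_simps)
  with \<open>q \<notin> \<Omega>\<close> have "\<gamma> t0 \<notin> \<Omega>" by simp
  define S where "S = {t \<in> {0..1}. \<gamma> t \<notin> \<Omega>}"
  have "S = {0..1} \<inter> \<gamma> -` (- \<Omega>)" by (auto simp: S_def)
  moreover have "closed ({0..1} \<inter> \<gamma> -` (- \<Omega>))"
    using \<Omega> by (intro continuous_closed_preimage \<gamma>c) auto
  ultimately have "compact S" by (auto simp: compact_eq_bounded_closed intro: bounded_subset[of "{0..1}"])
  moreover have "S \<noteq> {}" using t0(1,2) \<open>\<gamma> t0 \<notin> \<Omega>\<close> by (auto simp: S_def)
  ultimately obtain T where T: "T \<in> S" "\<forall>t\<in>S. t \<le> T" using compact_attains_sup by metis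
  have T01: "0 \<le> T" "T \<le> 1" "\<gamma> T \<notin> \<Omega>" using T(1) by (auto simp: S_def)
  have "T \<noteq> 0" "T \<noteq> 1" using T01(3) z x by (auto simp: \<gamma>_def)
  then have T1: "0 < T" "T < 1" using T01 by auto
  have after: "\<gamma> t \<in> \<Omega>" if "T < t" "t \<le> 1" for t
  proof (rule ccontr)
    assume "\<gamma> t \<notin> \<Omega>"
    then have "t \<in> S" using that T1 by (simp add: S_def)
    then show False using T(2) that by force
  qed
  have "\<gamma> T \<in> closure \<Omega>"
    unfolding closure_approachable
  proof (intro allI impI)
    fix r :: real assume r: "r > 0"
    have "(\<gamma> \<longlongrightarrow> \<gamma> T) (at_right T)" unfolding \<gamma>_def by (intro tendsto_intros)
    then have "\<forall>\<^sub>F t in at_right T. dist (\<gamma> t) (\<gamma> T) < r" using r by (rule tendstoD)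
    moreover have "\<forall>\<^sub>F t in at_right T. t < 1" using T1 by (auto simp: eventually_at_right_field)
    moreover have "\<forall>\<^sub>F t in at_right T. T < t" by (rule eventually_at_right_less)
    ultimately have "\<forall>\<^sub>F t in at_right T. \<gamma> t \<in> \<Omega> \<and> dist (\<gamma> t) (\<gamma> T) < r"
      by eventually_elim (use after in auto)
    from eventually_happens[OF this] show "\<exists>y\<in>\<Omega>. dist y (\<gamma> T) < r" by auto
  qed
  then have "\<gamma> T \<in> frontier \<Omega>" using T01(3) \<Omega> by (simp add: frontier_def interior_open)
  from out[OF this] obtain U \<rho> where ld: "local_defining_function \<Omega> (\<gamma> T) U \<rho>" "frechet_derivative \<rho> (at (\<gamma> T)) (\<gamma> T - z) > 0"
    by blast
  have "\<forall>\<^sub>F s in at_right 0. \<gamma> T + s *\<^sub>R (\<gamma> T - z) \<notin> \<Omega>"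
    by (rule outward_ray_leaves[OF ld(1) T01(3) ld(2)])
  \<comment> \<open>Going outward from \<open>\<gamma> T\<close> by \<open>s\<close> leads to
    \<open>\<gamma> (T * (1 + s))\<close>; the bound keeps this parameter at most 1.\<close>
  moreover have "\<forall>\<^sub>F s in at_right 0. s < 1 / T - 1"
    using T1 by (auto simp: eventually_at_right_field intro!: exI[of _ "1 / T - 1"])
  moreover have "\<forall>\<^sub>F s::real in at_right 0. 0 < s" by (rule eventually_at_right_less)
  ultimately have "\<forall>\<^sub>F s::real in at_right 0. False"
  proof eventually_elim
    case (elim s)
    have "\<gamma> T + s *\<^sub>R (\<gamma> T - z) = \<gamma> (T * (1 + s))" by (simp add: \<gamma>_def algebra_simps)
    moreover have "T < T * (1 + s)" using T1 elim(3) by simp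
    moreover have "T * (1 + s) \<le> 1" using T1 elim(2) by (simp add: field_simps)
    ultimately show ?case using after elim(1) by simp
  qed
  then show False by simp
qed

text \<open>Being outward is an open condition on the frontier point and the center jointly;
  compactness of the frontier then yields one radius that works for all frontier points.\<close>

lemma strictly_starshaped_ball:
  fixes \<Omega> :: "'a::euclidean_space set"
  assumes sm: "smooth_open_set \<Omega>" and bd: "bounded \<Omega>" and st: "strictly_starshaped \<Omega>"
  shows "\<exists>x0 \<delta>. \<delta> > 0 \<and> (\<forall>z\<in>ball x0 \<delta>. z \<in> \<Omega> \<and> (\<forall>x\<in>\<Omega>. closed_segment z x \<subseteq> \<Omega>))"
proof -
  have \<Omega>: "open \<Omega>" using sm by (simp add: smooth_open_set_def)
  obtain x0 where x0: "x0 \<in> \<Omega>" "\<forall>x\<in>frontier \<Omega>. outer_unit_normal \<Omega> x \<bullet> (x - x0) > 0"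
    using st by (auto simp: strictly_starshaped_def)
  obtain r0 where r0: "r0 > 0" "ball x0 r0 \<subseteq> \<Omega>" using \<Omega> x0(1) open_contains_ball by metis
  have loc: "\<exists>V \<delta>. open V \<and> x \<in> V \<and> \<delta> > 0 \<and> (\<forall>y\<in>V. \<forall>z\<in>ball x0 \<delta>.
      \<exists>U \<rho>. local_defining_function \<Omega> y U \<rho> \<and> frechet_derivative \<rho> (at y) (y - z) > 0)"
    if x: "x \<in> frontier \<Omega>" for x
  proof -
    obtain U \<rho> where ld: "local_defining_function \<Omega> x U \<rho>" using sm x by (auto simp: smooth_open_set_def)
    have U: "open U" "x \<in> U" "smooth_on \<rho> U" using ld by (auto simp: local_defining_function_def)
    obtain D where D: "GDERIV \<rho> x :> D" using smooth_on_gderiv[OF U(3,2)] by blast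
    have "D \<noteq> 0" using ld U(2) D by (auto simp: local_defining_function_def)
    have "outer_unit_normal \<Omega> x \<bullet> (x - x0) > 0" using x0(2) x by blast
    then have "inverse (norm D) * (D \<bullet> (x - x0)) > 0" unfolding outer_unit_normal_eq[OF x ld D] by simp
    then have "D \<bullet> (x - x0) > 0" using \<open>D \<noteq> 0\<close> by (simp add: zero_less_mult_iff)
    moreover have "frechet_derivative \<rho> (at x) = (\<lambda>h. h \<bullet> D)"
      using D unfolding gderiv_def by (rule frechet_derivative_at[symmetric])
    ultimately have pos: "frechet_derivative \<rho> (at x) (x - x0) > 0" by (simp add: inner_commute)
    \<comment> \<open>The derivative is expanded over the basis because \<open>Ck_on\<close>
      provides continuity in the point only for a fixed direction.\<close>
    define \<Phi> where "\<Phi> q = (\<Sum>b\<in>Basis. ((fst q - snd q) \<bullet> b) * frechet_derivative \<rho> (at (fst q)) b)" for q :: "'a \<times> 'a"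
    have \<Phi>: "\<Phi> (y, z) = frechet_derivative \<rho> (at y) (y - z)" if "y \<in> U" for y z
      unfolding \<Phi>_def by (simp add: local_defining_function_gradient(2)[OF ld that, of "y - z"])
    have c1: "continuous_on U (\<lambda>y. frechet_derivative \<rho> (at y) b)" for b
    proof -
      have "Ck_on (Suc 0) \<rho> U" using U(3) unfolding smooth_on_def by blast
      then show ?thesis by simp
    qed
    have "continuous_on (U \<times> UNIV) \<Phi>"
      unfolding \<Phi>_def
      by (intro continuous_intros continuous_on_compose2[OF c1]) auto
    moreover have "open (U \<times> (UNIV :: 'a set))" using U(1) by (intro open_Times) auto
    ultimately have "open ((U \<times> UNIV) \<inter> \<Phi> -` {0<..})"
      by (intro continuous_open_preimage) auto
    moreover have "(x, x0) \<in> (U \<times> UNIV) \<inter> \<Phi> -` {0<..}" using U(2) pos \<Phi>[OF U(2), of x0] by simp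
    ultimately obtain V W where VW: "open V" "open W" "(x, x0) \<in> V \<times> W" "V \<times> W \<subseteq> (U \<times> UNIV) \<inter> \<Phi> -` {0<..}"
      by (rule open_prod_elim)
    obtain \<delta> where \<delta>: "\<delta> > 0" "ball x0 \<delta> \<subseteq> W" using VW(2,3) open_contains_ball by (metis mem_Sigma_iff)
    have "\<exists>U \<rho>. local_defining_function \<Omega> y U \<rho> \<and> frechet_derivative \<rho> (at y) (y - z) > 0"
      if "y \<in> V" "z \<in> ball x0 \<delta>" for y z
    proof -
      have "(y, z) \<in> V \<times> W" using that \<delta>(2) by blast
      then have *: "y \<in> U" "\<Phi> (y, z) > 0" using VW(4) by auto
      have "local_defining_function \<Omega> y U \<rho>" using ld *(1) by (simp add: local_defining_function_def)
      then show ?thesis using * \<Phi>[OF *(1)] by auto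
    qed
    then show ?thesis using VW(1,3) \<delta>(1) by (intro exI[of _ V] exI[of _ \<delta>]) auto
  qed
  have "\<exists>V \<delta>. \<forall>x\<in>frontier \<Omega>. open (V x) \<and> x \<in> V x \<and> \<delta> x > 0 \<and> (\<forall>y\<in>V x. \<forall>z\<in>ball x0 (\<delta> x).
      \<exists>U \<rho>. local_defining_function \<Omega> y U \<rho> \<and> frechet_derivative \<rho> (at y) (y - z) > 0)"
    using loc by metis
  then obtain V \<delta> where V: "\<And>x. x \<in> frontier \<Omega> \<Longrightarrow> open (V x)" "\<And>x. x \<in> frontier \<Omega> \<Longrightarrow> x \<in> V x"
      "\<And>x. x \<in> frontier \<Omega> \<Longrightarrow> \<delta> x > (0::real)"
      "\<And>x y z. x \<in> frontier \<Omega> \<Longrightarrow> y \<in> V x \<Longrightarrow> z \<in> ball x0 (\<delta> x) \<Longrightarrow>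
      \<exists>U \<rho>. local_defining_function \<Omega> y U \<rho> \<and> frechet_derivative \<rho> (at y) (y - z) > 0"
    by metis
  have "compact (frontier \<Omega>)" using bd by (rule compact_frontier_bounded)
  moreover have "frontier \<Omega> \<subseteq> (\<Union>x\<in>frontier \<Omega>. V x)" using V(2) by blast
  ultimately obtain C where C: "C \<subseteq> frontier \<Omega>" "finite C" "frontier \<Omega> \<subseteq> (\<Union>x\<in>C. V x)"
    using compactE_image[of "frontier \<Omega>" "frontier \<Omega>" V] V(1) by metis
  \<comment> \<open>Including \<open>r0\<close> keeps the ball inside \<open>\<Omega>\<close> and
    the minimum meaningful should the finite cover be empty.\<close>
  define d where "d = Min (insert r0 (\<delta> ` C))"
  have d: "d > 0" unfolding d_def using C(1,2) V(3) r0(1) by (subst Min_gr_iff) auto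
  have dr: "d \<le> r0" and d\<delta>: "\<And>x. x \<in> C \<Longrightarrow> d \<le> \<delta> x" unfolding d_def using C(2) by auto
  have "z \<in> \<Omega> \<and> (\<forall>x\<in>\<Omega>. closed_segment z x \<subseteq> \<Omega>)" if z: "z \<in> ball x0 d" for z
  proof -
    have z\<Omega>: "z \<in> \<Omega>" using z r0(2) dr by auto
    have "\<exists>U \<rho>. local_defining_function \<Omega> y U \<rho> \<and> frechet_derivative \<rho> (at y) (y - z) > 0" if y: "y \<in> frontier \<Omega>" for y
    proof -
      obtain x where x: "x \<in> C" "y \<in> V x" using C(3) y by blast
      show ?thesis by (rule V(4)[of x]) (use x C(1) z d\<delta>[OF x(1)] in auto)
    qed
    then show ?thesis using closed_segment_subset_if_outward[OF \<Omega> z\<Omega>] z\<Omega> by blast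
  qed
  then show ?thesis using d by blast
qed

text \<open>The homothety with center \<open>y\<close> and ratio \<open>s\<close> maps the ball of
  star centers into \<open>K\<close>; the images for all \<open>s\<close> fill a truncated cone with
  apex \<open>y\<close>.\<close>

lemma starshaped_ball_interior_cone:
  fixes K :: "'a::euclidean_space set"
  assumes star: "\<And>x y. x \<in> ball c r \<Longrightarrow> y \<in> K \<Longrightarrow> closed_segment x y \<subseteq> K"
    and y: "y \<in> K" and s: "0 < s" "s \<le> 1" and z: "norm (z - y - s *\<^sub>R (c - y)) < s * r"
  shows "z \<in> interior K"
proof -
  have "ball (y + s *\<^sub>R (c - y)) (s * r) \<subseteq> K"
  proof
    fix q assume q: "q \<in> ball (y + s *\<^sub>R (c - y)) (s * r)"
    define x where "x = y + (1 / s) *\<^sub>R (q - y)"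
    have "q - (y + s *\<^sub>R (c - y)) = s *\<^sub>R (x - c)" using s by (simp add: x_def algebra_simps)
    then have "s * norm (x - c) < s * r" using q s by (simp add: dist_norm norm_minus_commute)
    then have "x \<in> ball c r" using s by (simp add: dist_norm norm_minus_commute)
    moreover have "q = (1 - (1 - s)) *\<^sub>R x + (1 - s) *\<^sub>R y" using s by (simp add: x_def algebra_simps)
    then have "q \<in> closed_segment x y" unfolding in_segment using s by (intro exI[of _ "1 - s"]) auto
    ultimately show "q \<in> K" using star y by blast
  qed
  moreover have "z \<in> ball (y + s *\<^sub>R (c - y)) (s * r)" using z by (simp add: dist_norm norm_minus_commute algebra_simps)
  ultimately show ?thesis by (meson interiorI open_ball)
qed

text \<open>The roles are reversed: if a point \<open>z\<close> of the opposite cone at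
  \<open>y\<close> belonged to \<open>K\<close>, then \<open>y\<close> would lie in the interior
  cone with apex \<open>z\<close>. Seen from \<open>z\<close>, the ratio is
  \<open>\<sigma> = s / (1 + s)\<close>.\<close>

lemma starshaped_ball_exterior_cone:
  fixes K :: "'a::euclidean_space set"
  assumes star: "\<And>x y. x \<in> ball c r \<Longrightarrow> y \<in> K \<Longrightarrow> closed_segment x y \<subseteq> K"
    and y: "y \<notin> interior K" and s: "0 < s" and z: "norm (z - y - s *\<^sub>R (y - c)) < s * r"
  shows "z \<notin> K"
proof
  assume zK: "z \<in> K"
  define \<sigma> where "\<sigma> = s / (1 + s)"
  have \<sigma>: "0 < \<sigma>" "\<sigma> \<le> 1" "\<sigma> * (1 + s) = s" using s by (auto simp: \<sigma>_def)
  have "y \<in> interior K"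
  proof (rule starshaped_ball_interior_cone[OF star zK \<sigma>(1,2)])
    have e: "(1 - \<sigma>) * s = \<sigma>" using \<sigma>(3) by (simp add: algebra_simps)
    have \<sigma>1: "1 - \<sigma> > 0" using s by (simp add: \<sigma>_def field_simps)
    have "y - z - \<sigma> *\<^sub>R (c - z) = (1 - \<sigma>) *\<^sub>R (- (z - y - s *\<^sub>R (y - c)))"
    proof -
      have "(1 - \<sigma>) *\<^sub>R (- (z - y - s *\<^sub>R (y - c))) = (1 - \<sigma>) *\<^sub>R (y - z) + ((1 - \<sigma>) * s) *\<^sub>R (y - c)"
        by (simp add: algebra_simps)
      then show ?thesis unfolding e by (simp add: algebra_simps)
    qed
    then have "norm (y - z - \<sigma> *\<^sub>R (c - z)) = (1 - \<sigma>) * norm (z - y - s *\<^sub>R (y - c))"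
      using \<sigma>(2) by (simp only: norm_scaleR norm_minus_cancel abs_of_nonneg diff_ge_0_iff_ge)
    also have "\<dots> < (1 - \<sigma>) * (s * r)" using z \<sigma>1 by (intro mult_strict_left_mono)
    also have "\<dots> = \<sigma> * r" using e by (simp add: mult.assoc[symmetric])
    finally show "norm (y - z - \<sigma> *\<^sub>R (c - z)) < \<sigma> * r" .
  qed
  then show False using y by simp
qed

text \<open>The exterior cones at frontier points near \<open>y0\<close> contain cones with a common
  axis \<open>e\<close>, from the center towards \<open>y0\<close>, and a common opening; this
  bounds the slope of the frontier over the hyperplane orthogonal to \<open>e\<close>. The interior
  and exterior cones at \<open>y0\<close> itself ensure that every nearby vertical line meets the
  frontier.\<close>

lemma starshaped_ball_frontier_Lipschitz_graph:
  fixes K :: "'a::euclidean_space set"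
  assumes K: "closed K" and r: "r > 0" and sub: "ball c r \<subseteq> K"
    and star: "\<And>x y. x \<in> ball c r \<Longrightarrow> y \<in> K \<Longrightarrow> closed_segment x y \<subseteq> K"
  shows "locally_Lipschitz_graph (frontier K)"
  unfolding locally_Lipschitz_graph_def
proof
  fix y0 assume y0: "y0 \<in> frontier K"
  have fK: "y \<in> K" "y \<notin> interior K" if "y \<in> frontier K" for y
    using that K by (auto simp: frontier_def)
  define m where "m = norm (y0 - c)"
  have "c \<in> interior K" using sub r by (meson centre_in_ball interiorI open_ball)
  have mr: "m \<ge> r"
  proof (rule ccontr)
    assume "\<not> m \<ge> r"
    then have "y0 \<in> ball c r" by (simp add: m_def dist_norm norm_minus_commute)
    then show False using sub fK(2)[OF y0] by (meson interiorI open_ball)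
  qed
  then have m: "m > 0" using r by simp
  define e where "e = (1 / m) *\<^sub>R (y0 - c)"
  have e: "norm e = 1" "e \<bullet> e = 1" "y0 - c = m *\<^sub>R e"
    using m by (auto simp: e_def m_def dot_square_norm[symmetric] power2_norm_eq_inner[symmetric] power_divide)
  define P where "P x = x - (x \<bullet> e) *\<^sub>R e" for x
  have P_diff: "P (x - y) = P x - P y" for x y by (simp add: P_def algebra_simps)
  have P_dec: "x = P x + (x \<bullet> e) *\<^sub>R e" for x by (simp add: P_def)
  have P_le: "norm (P x) \<le> norm x" for x
  proof -
    have "(norm x)\<^sup>2 = (norm (P x))\<^sup>2 + (x \<bullet> e)\<^sup>2"
      unfolding P_def power2_norm_eq_inner by (simp add: algebra_simps inner_diff_left inner_diff_right e inner_commute power2_eq_square)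
    then have "(norm (P x))\<^sup>2 \<le> (norm x)\<^sup>2" by simp
    then show ?thesis by (rule power2_le_imp_le) simp
  qed
  \<comment> \<open>Half of the radius pays for the lateral distance, the other half for the tilt
    between \<open>y - c\<close> and the axis \<open>e\<close> when \<open>y\<close> is within
    \<open>r / 2\<close> of \<open>y0\<close>; this is the origin of the factor 2.\<close>
  define L where "L = 2 * m / r"
  have L: "L \<ge> 2" using mr r by (simp add: L_def field_simps)
  have up: "z \<notin> K" if y: "y \<in> frontier K" "norm (y - y0) < r / 2" and pos: "(z - y) \<bullet> e > 0"
    and small: "L * norm (P (z - y)) < (z - y) \<bullet> e" for y z
  proof -
    define s where "s = ((z - y) \<bullet> e) / m"
    have s: "s > 0" "(z - y) \<bullet> e = s * m" using pos m by (auto simp: s_def)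
    have "z - y - s *\<^sub>R (y - c) = P (z - y) - s *\<^sub>R (y - y0)"
    proof -
      have yc: "y - c = m *\<^sub>R e + (y - y0)" using e(3) by (simp add: algebra_simps)
      have "s *\<^sub>R (y - c) = (s * m) *\<^sub>R e + s *\<^sub>R (y - y0)" by (simp only: yc scaleR_add_right scaleR_scaleR)
      then show ?thesis using P_dec[of "z - y"] unfolding s(2) by (simp add: algebra_simps)
    qed
    then have "norm (z - y - s *\<^sub>R (y - c)) \<le> norm (P (z - y)) + s * norm (y - y0)"
      using norm_triangle_ineq4[of "P (z - y)" "s *\<^sub>R (y - y0)"] s by simp
    also have "\<dots> < s * (r / 2) + s * (r / 2)"
    proof (rule add_strict_mono)
      show "norm (P (z - y)) < s * (r / 2)" using small r m unfolding s(2) by (simp add: L_def field_simps)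
      show "s * norm (y - y0) < s * (r / 2)" using y(2) s(1) by simp
    qed
    finally have "norm (z - y - s *\<^sub>R (y - c)) < s * r" by (simp add: mult.commute)
    from starshaped_ball_exterior_cone[OF star fK(2)[OF y(1)] s(1) this] show ?thesis .
  qed
  have down: "z \<in> interior K" if neg: "(y0 - z) \<bullet> e > 0" "(y0 - z) \<bullet> e \<le> m"
    and small: "L * norm (P (z - y0)) < (y0 - z) \<bullet> e" for z
  proof -
    define s where "s = ((y0 - z) \<bullet> e) / m"
    have s: "s > 0" "s \<le> 1" "(y0 - z) \<bullet> e = s * m" using neg m by (auto simp: s_def)
    have "z - y0 - s *\<^sub>R (c - y0) = P (z - y0)"
    proof -
      have "c - y0 = - m *\<^sub>R e" using e(3) by (simp add: algebra_simps)
      then have "s *\<^sub>R (c - y0) = - (s * m) *\<^sub>R e" by simp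
      moreover have "(z - y0) \<bullet> e = - (s * m)" using s(3) by (simp add: inner_diff_left)
      ultimately show ?thesis unfolding P_def by simp
    qed
    moreover have "norm (P (z - y0)) < s * r"
    proof -
      have "L * norm (P (z - y0)) < s * m" using small s(3) by simp
      then have "norm (P (z - y0)) < s * (r / 2)" using r m by (simp add: L_def field_simps)
      also have "\<dots> < s * r" using s(1) r by simp
      finally show ?thesis .
    qed
    ultimately have "norm (z - y0 - s *\<^sub>R (c - y0)) < s * r" by simp
    from starshaped_ball_interior_cone[OF star fK(1)[OF y0] s(1,2) this] show ?thesis .
  qed
  have lip: "\<bar>y \<bullet> e - z \<bullet> e\<bar> \<le> L * norm (P y - P z)"
    if yz: "y \<in> frontier K" "norm (y - y0) < r / 2" "z \<in> frontier K" "norm (z - y0) < r / 2" for y z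
  proof -
    have one: "z \<bullet> e - y \<bullet> e \<le> L * norm (P z - P y)"
      if "y \<in> frontier K" "norm (y - y0) < r / 2" "z \<in> frontier K" for y z
    proof (rule ccontr)
      assume n: "\<not> ?thesis"
      then have small: "L * norm (P (z - y)) < (z - y) \<bullet> e" by (simp add: P_diff inner_diff_left)
      moreover have "0 \<le> L * norm (P (z - y))" using L by simp
      ultimately have "z \<notin> K" using that by (intro up[of y]) auto
      then show False using fK(1)[OF that(3)] by simp
    qed
    show ?thesis using one[OF yz(1,2,3)] one[OF yz(3,4,1)] by (simp add: norm_minus_commute abs_le_iff)
  qed
  \<comment> \<open>\<open>\<eta> + h < r / 2\<close> keeps the cylinder \<open>U\<close> in the
    ball where the estimates hold, and \<open>L * \<eta> = h / 2\<close> lets a vertical step of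
    \<open>h / 2\<close> from \<open>y0\<close> win against any lateral displacement below
    \<open>\<eta>\<close>.\<close>
  define h where "h = r / 4"
  define \<eta> where "\<eta> = h / (2 * L)"
  have h: "h > 0" "h \<le> m" using r mr by (auto simp: h_def)
  have \<eta>: "\<eta> > 0" "\<eta> < h" "L * \<eta> = h / 2" using h L by (auto simp: \<eta>_def field_simps)
  define U where "U = {x. norm (P (x - y0)) < \<eta> \<and> \<bar>(x - y0) \<bullet> e\<bar> < h}"
  have oU: "open U"
    unfolding U_def P_def by (intro open_Collect_conj open_Collect_less continuous_intros)
  have y0U: "y0 \<in> U" using \<eta> h by (simp add: U_def P_def)
  have Uball: "norm (x - y0) < r / 2" if "x \<in> U" for x
  proof -
    have "norm (x - y0) \<le> norm (P (x - y0)) + norm (((x - y0) \<bullet> e) *\<^sub>R e)"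
      using norm_triangle_ineq[of "P (x - y0)" "((x - y0) \<bullet> e) *\<^sub>R e"] P_dec[of "x - y0"] by simp
    then show ?thesis using that \<eta>(2) e(1) by (simp add: U_def h_def)
  qed
  define F where "F = frontier K \<inter> U"
  have y0F: "y0 \<in> F" using y0 y0U by (simp add: F_def)
  have Flip: "\<bar>y \<bullet> e - z \<bullet> e\<bar> \<le> L * norm (P y - P z)" if "y \<in> F" "z \<in> F" for y z
    using that Uball by (intro lip) (auto simp: F_def)
  (* McShane's extension of the height function from the projection of F. *)
  define \<gamma> where "\<gamma> z = (INF y\<in>F. y \<bullet> e + L * norm (z - P y))" for z
  have bdd: "bdd_below ((\<lambda>y. y \<bullet> e + L * norm (z - P y)) ` F)" for z
  proof (rule bdd_belowI2)
    fix y assume "y \<in> F"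
    then have "\<bar>(y - y0) \<bullet> e\<bar> < h" by (simp add: F_def U_def)
    then have "y0 \<bullet> e - h \<le> y \<bullet> e" by (simp add: inner_diff_left)
    then show "y0 \<bullet> e - h \<le> y \<bullet> e + L * norm (z - P y)" using L by (simp add: add_increasing2)
  qed
  have \<gamma>le: "\<gamma> z \<le> \<gamma> z' + L * norm (z - z')" for z z'
  proof -
    have "\<gamma> z - L * norm (z - z') \<le> y \<bullet> e + L * norm (z' - P y)" if "y \<in> F" for y
    proof -
      have "\<gamma> z \<le> y \<bullet> e + L * norm (z - P y)" unfolding \<gamma>_def by (rule cINF_lower[OF bdd that])
      moreover have "L * norm (z - P y) \<le> L * (norm (z - z') + norm (z' - P y))"
        using norm_triangle_ineq[of "z - z'" "z' - P y"] L by (intro mult_left_mono) auto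
      ultimately show ?thesis by (simp add: distrib_left)
    qed
    then have "\<gamma> z - L * norm (z - z') \<le> \<gamma> z'" unfolding \<gamma>_def[of z'] using y0F by (intro cINF_greatest) auto
    then show ?thesis by simp
  qed
  have \<gamma>lip: "L-lipschitz_on {y. y \<bullet> e = 0} \<gamma>"
  proof (rule lipschitz_onI)
    fix z z'
    show "dist (\<gamma> z) (\<gamma> z') \<le> L * dist z z'"
      using \<gamma>le[of z z'] \<gamma>le[of z' z] by (simp add: dist_norm norm_minus_commute abs_le_iff)
  qed (use L in simp)
  have \<gamma>F: "\<gamma> (P y) = y \<bullet> e" if y: "y \<in> F" for y
  proof (rule antisym)
    show "\<gamma> (P y) \<le> y \<bullet> e" using cINF_lower[OF bdd[of "P y"] y] unfolding \<gamma>_def by simp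
    show "y \<bullet> e \<le> \<gamma> (P y)"
      unfolding \<gamma>_def
    proof (rule cINF_greatest)
      fix z assume "z \<in> F"
      from Flip[OF y this] show "y \<bullet> e \<le> z \<bullet> e + L * norm (P y - P z)" by linarith
    qed (use y0F in auto)
  qed
  \<comment> \<open>The vertical segment over the projection of \<open>x\<close> starts in
    \<open>K\<close> and ends outside it, hence meets the frontier within \<open>U\<close>. So the
    values of \<open>\<gamma>\<close> over \<open>U\<close> all come from points of
    \<open>F\<close>, and the extension beyond them cannot add points to the graph.\<close>
  have ex: "\<exists>y\<in>F. P y = P x" if x: "x \<in> U" for x
  proof -
    define q where "q t = P x + (y0 \<bullet> e + t) *\<^sub>R e" for t
    have Pe: "P x \<bullet> e = 0" for x by (simp add: P_def inner_diff_left e)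
    have qe: "q t \<bullet> e = y0 \<bullet> e + t" for t by (simp add: q_def inner_add_left Pe e)
    have Pq: "P (q t) = P x" for t unfolding P_def[of "q t"] qe by (simp add: q_def)
    have Px: "norm (P x - P y0) < \<eta>" using x by (simp add: U_def P_diff)
    have sm: "L * norm (P x - P y0) < h / 2"
      using mult_strict_left_mono[OF Px, of L] L \<eta>(3) by simp
    have "q (h / 2) \<notin> K"
      by (rule up[OF y0]) (use r h sm in \<open>auto simp: P_diff Pq inner_diff_left qe\<close>)
    moreover have "q (- (h / 2)) \<in> K"
    proof -
      have "q (- (h / 2)) \<in> interior K"
        by (rule down) (use h sm in \<open>auto simp: P_diff Pq inner_diff_left qe\<close>)
      then show ?thesis using interior_subset by blast
    qed
    moreover have "connected (q ` {- (h / 2)..h / 2})"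
      unfolding q_def by (intro connected_continuous_image continuous_intros) simp
    moreover have "q (h / 2) \<in> q ` {- (h / 2)..h / 2}" "q (- (h / 2)) \<in> q ` {- (h / 2)..h / 2}" using h by auto
    ultimately have "q ` {- (h / 2)..h / 2} \<inter> frontier K \<noteq> {}"
      by (intro connected_Int_frontier) auto
    then obtain t where t: "- (h / 2) \<le> t" "t \<le> h / 2" "q t \<in> frontier K" by auto
    have "q t \<in> U" using t(1,2) h Px by (simp add: U_def P_diff Pq inner_diff_left qe abs_less_iff)
    then show ?thesis using t(3) Pq[of t] by (auto simp: F_def)
  qed
  have "frontier K \<inter> U = {x \<in> U. x \<bullet> e = \<gamma> (x - (x \<bullet> e) *\<^sub>R e)}"
  proof (intro set_eqI iffI)
    fix x assume "x \<in> frontier K \<inter> U"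
    then show "x \<in> {x \<in> U. x \<bullet> e = \<gamma> (x - (x \<bullet> e) *\<^sub>R e)}" using \<gamma>F[of x] by (simp add: F_def P_def)
  next
    fix x assume "x \<in> {x \<in> U. x \<bullet> e = \<gamma> (x - (x \<bullet> e) *\<^sub>R e)}"
    then have x: "x \<in> U" "x \<bullet> e = \<gamma> (P x)" by (auto simp: P_def)
    obtain y where y: "y \<in> F" "P y = P x" using ex[OF x(1)] by blast
    have "x \<bullet> e = y \<bullet> e" using x(2) \<gamma>F[OF y(1)] y(2) by simp
    then have "x = y" using P_dec[of x] P_dec[of y] y(2) by simp
    then show "x \<in> frontier K \<inter> U" using y(1) by (simp add: F_def)
  qed
  then show "\<exists>U e \<gamma> L. open U \<and> y0 \<in> U \<and> norm e = 1 \<and> L-lipschitz_on {y. y \<bullet> e = 0} \<gamma> \<and>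
      frontier K \<inter> U = {x \<in> U. x \<bullet> e = \<gamma> (x - (x \<bullet> e) *\<^sub>R e)}"
    using oU y0U e(1) \<gamma>lip by (intro exI[of _ U] exI[of _ e] exI[of _ \<gamma>] exI[of _ L]) simp
qed

theorem theorem1p2:
  fixes \<Omega> :: "(real ^ 'n) set" and p :: real and w :: "real ^ 'n \<Rightarrow> real"
  assumes "CARD('n) \<ge> 3"
    and "1 < p" and "p < 2"
    and "\<Omega> \<noteq> {}" and "bounded \<Omega>" and "smooth_open_set \<Omega>"
    and "nonneg_ground_state p \<Omega> w"
  shows "(starlike \<Omega> \<longrightarrow> starlike (ess_support w)) \<and>
         (strictly_starshaped \<Omega> \<longrightarrow> locally_Lipschitz_graph (frontier (ess_support w)))"
proof (intro conjI impI)
  have d: "DIM(real ^ 'n) \<ge> 3" using assms(1) by simp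
  have \<Omega>: "open \<Omega>" using assms(6) by (simp add: smooth_open_set_def)
  note star = ess_support_ground_state_star_center[OF d assms(2,3,7) \<Omega>]
  show "starlike (ess_support w)" if st: "starlike \<Omega>"
  proof -
    obtain x0 where "x0 \<in> \<Omega>" "\<forall>x\<in>\<Omega>. closed_segment x0 x \<subseteq> \<Omega>" using st unfolding starlike_def by blast
    then show ?thesis unfolding starlike_def using star[of x0] by blast
  qed
  show "locally_Lipschitz_graph (frontier (ess_support w))" if st: "strictly_starshaped \<Omega>"
  proof -
    obtain x0 \<delta> where \<delta>: "\<delta> > 0" "\<forall>z\<in>ball x0 \<delta>. z \<in> \<Omega> \<and> (\<forall>x\<in>\<Omega>. closed_segment z x \<subseteq> \<Omega>)"
      using strictly_starshaped_ball[OF assms(6,5) st] by blast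
    have "z \<in> ess_support w \<and> (\<forall>y\<in>ess_support w. closed_segment z y \<subseteq> ess_support w)" if "z \<in> ball x0 \<delta>" for z
      using star[of z] \<delta>(2) that by blast
    then show ?thesis
      by (intro starshaped_ball_frontier_Lipschitz_graph[OF closed_ess_support \<delta>(1), of x0]) auto
  qed
qed

end
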